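(* Let $m\in C^\infty(\mathbb{R}^n\setminus\{0\})$ be the function such that for every $l\in\mathbb{Z}$, every $f\in L^2(\mathbb{R}^n)$ and every sequence of cubes $\{Q_N\}_{N\in\mathbb{N}}$ with $2Q_N\subset Q_{N+1}$ for all $N$, $$\lim_{N\to\infty}\int_{Q_N}M_{-\eta}A_{\eta,l}M_\eta f\,\frac{d\eta}{|Q_N|}=\mathcal{F}^{-1}[m(2^l\cdot)\,\mathcal{F}f]\quad\text{in }L^2,$$ and put $M(\xi)=\sum_{l=-\infty}^\infty m(2^l\xi)$. Let $\alpha>0$ be the constant given by $$\alpha:=\int_{SO(n)}\int_0^1M(2^\kappa A\xi)\,d\kappa\,d\mu(A)$$ for $\xi\in\mathbb{R}^n\setminus\{0\}$. Then for any sequence of cubes $\{Q_N\}_{N\in\mathbb{N}}$ with $2Q_N\subset Q_{N+1}$ for all $N$, $$\alpha\,\mathrm{id}_{L^2}=\int_{SO(n)}\int_0^1\left(\sum_{l=-\infty}^\infty\lim_{N\to\infty}\int_{Q_N}\rho(A^{-1})D_{2^{-\kappa}}M_{-\eta}A_{\eta,l}M_\eta D_{2^\kappa}\rho(A)\,\frac{d\eta}{|Q_N|}\right)d\kappa\,d\mu(A),$$ where all the convergences take place in the strong topology of $L^2$.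
   Context: Everything takes place on $\mathbb{R}^n$. Fourier transform: $\mathcal{F}f(\xi)=\int f(x)e^{-2\pi ix\cdot\xi}dx$. Operators: $T_af(x)=f(x-a)$, $M_\xi f(x)=e^{2\pi i\xi\cdot x}f(x)$, $D_\lambda f(x)=\lambda^{-n/2}f(\lambda^{-1}x)$. $SO(n)$ is the group of orthogonal matrices of determinant $1$, $\mu$ is its normalized Haar measure, and $\rho(A)f=f(A^{-1}\cdot)$ for $f\in L^2$. A cube is a set $Q(x,r)=\{y:\max_i|x_i-y_i|\le r\}$, with $\kappa Q(x,r)=Q(x,\kappa r)$; $Q(r)=Q(0,r)$. A dyadic cube is $Q_{\nu m}=\prod_{j=1}^n[2^{-\nu}m_j,2^{-\nu}(m_j+1))$, $\nu\in\mathbb{Z}$, $m\in\mathbb{Z}^n$, with center $c(Q_{\nu m})$ and side length $\ell(Q_{\nu m})=2^{-\nu}$. A dyadic cube $Q$ is bisected into $2^n$ dyadic cubes of equal side length labelled $Q_{(1)},\dots,Q_{(2^n)}$ so that their centers are increasing in the lexicographic order of $\mathbb{R}^n$. A tile is a product $s=I_s\times\omega_s$ with $I_s=Q_{\nu m}$, $\omega_s=Q_{-\nu m'}$ ($\nu\in\mathbb{Z}$, $m,m'\in\mathbb{Z}^n$); $\mathbb{D}$ is the set of all tiles; $\omega_{s(i)}:=(\omega_s)_{(i)}$. $\Phi$ is a fixed Schwartz function with $\chi_{Q(9/100)}\le\Phi\le\chi_{Q(1/10)}$, $\varphi=\mathcal{F}^{-1}\Phi$, and $\varphi_s=M_{c(\omega_{s(1)})}T_{c(I_s)}D_{\ell(I_s)}\varphi$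 for $s\in\mathbb{D}$. For $\eta\in\mathbb{R}^n$, $l\in\mathbb{Z}$, $$A_{\eta,l}f=\sum_{s\in\mathbb{D}:\ \omega_{s(2^n)}\ni\eta,\ |I_s|=2^{ln}}\langle f,\varphi_s\rangle_{L^2}\,\varphi_s .$$ *)

theory Defs
  imports "HOL-Analysis.Analysis" "HOL-Library.Fun_Lexorder"
begin

section \<open>The Hilbert space of square-integrable functions\<close>

definition square_integrable :: "('a::euclidean_space \<Rightarrow> complex) \<Rightarrow> bool" where
  "square_integrable f \<longleftrightarrow>
     f \<in> borel_measurable lborel \<and> integrable lborel (\<lambda>x. (cmod (f x))\<^sup>2)"

lemma square_integrableD:
  assumes "square_integrable f"
  shows "f \<in> borel_measurable lborel" "f \<in> borel_measurable borel"
    "integrable lborel (\<lambda>x. (cmod (f x))\<^sup>2)"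
  using assms by (auto simp: square_integrable_def)

lemma square_integrable_zero: "square_integrable (\<lambda>x. 0)"
  by (simp add: square_integrable_def)

lemma square_integrable_add:
  assumes "square_integrable f" "square_integrable g"
  shows "square_integrable (\<lambda>x. f x + g x)"
proof -
  note [measurable] = square_integrableD(2)[OF assms(1)] square_integrableD(2)[OF assms(2)]
  have "(cmod (a + b))\<^sup>2 \<le> 2 * (cmod a)\<^sup>2 + 2 * (cmod b)\<^sup>2" for a b
  proof -
    have "(cmod (a + b))\<^sup>2 \<le> (cmod a + cmod b)\<^sup>2"
      by (intro power_mono norm_triangle_ineq) simp
    also have "\<dots> \<le> 2 * (cmod a)\<^sup>2 + 2 * (cmod b)\<^sup>2"
      using sum_squares_bound[of "cmod a" "cmod b"] by (simp add: power2_sum)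
    finally show ?thesis .
  qed
  then have bound: "norm ((cmod (f x + g x))\<^sup>2) \<le> norm (2 * (cmod (f x))\<^sup>2 + 2 * (cmod (g x))\<^sup>2)" for x
    by (metis abs_ge_self abs_of_nonneg order_trans real_norm_def zero_le_power2)
  have "integrable lborel (\<lambda>x. (cmod (f x + g x))\<^sup>2)"
    by (rule Bochner_Integration.integrable_bound[OF _ _ AE_I2[OF bound]])
      (simp_all add: square_integrableD(3)[OF assms(1)] square_integrableD(3)[OF assms(2)])
  then show ?thesis by (simp add: square_integrable_def)
qed

lemma square_integrable_mult:
  assumes "square_integrable f"
  shows "square_integrable (\<lambda>x. c * f x)"
  using assms by (auto simp: square_integrable_def norm_mult power_mult_distrib)

lemma square_integrable_uminus:
  "square_integrable f \<Longrightarrow> square_integrable (\<lambda>x. - f x)"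
  using square_integrable_mult[of f "-1"] by simp

lemma square_integrable_diff:
  "square_integrable f \<Longrightarrow> square_integrable g \<Longrightarrow> square_integrable (\<lambda>x. f x - g x)"
  using square_integrable_add[OF _ square_integrable_uminus, of f g] by simp

lemma borel_measurable_cnj [measurable (raw)]:
  "f \<in> borel_measurable M \<Longrightarrow> (\<lambda>x. cnj (f x)) \<in> borel_measurable M"
  by (intro borel_measurable_continuous_on[of cnj] continuous_intros)

lemma square_integrable_inner:
  assumes "square_integrable f" "square_integrable g"
  shows "integrable lborel (\<lambda>x. f x * cnj (g x))"
proof -
  note [measurable] = square_integrableD(2)[OF assms(1)] square_integrableD(2)[OF assms(2)]
  have "cmod a * cmod b \<le> (cmod a)\<^sup>2 + (cmod b)\<^sup>2" for a b
    using sum_squares_bound[of "cmod a" "cmod b"] mult_nonneg_nonneg[of "cmod a" "cmod b"]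
    by (simp del: mult_nonneg_nonneg)
  then have bound: "norm (f x * cnj (g x)) \<le> norm ((cmod (f x))\<^sup>2 + (cmod (g x))\<^sup>2)" for x
    unfolding norm_mult complex_mod_cnj real_norm_def by (rule order_trans[OF _ abs_ge_self])
  show ?thesis
    by (rule Bochner_Integration.integrable_bound[OF _ _ AE_I2[OF bound]])
      (simp_all add: square_integrableD(3)[OF assms(1)] square_integrableD(3)[OF assms(2)])
qed

text \<open>Elements are classes of square-integrable functions modulo equality almost everywhere;
  Borel measurable representatives lose nothing over Lebesgue measurable ones.\<close>

quotient_type (overloaded) 'a L2 = "'a::euclidean_space \<Rightarrow> complex" / partial:
  "\<lambda>f g. square_integrable f \<and> square_integrable g \<and> (AE x in lborel. f x = g x)"
proof (rule part_equivpI)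
  show "\<exists>f::'a \<Rightarrow> complex. square_integrable f \<and> square_integrable f \<and> (AE x in lborel. f x = f x)"
    using square_integrable_zero by auto
  show "symp (\<lambda>f g::'a \<Rightarrow> complex. square_integrable f \<and> square_integrable g \<and> (AE x in lborel. f x = g x))"
    by (auto simp: symp_def elim: eventually_mono)
  show "transp (\<lambda>f g::'a \<Rightarrow> complex. square_integrable f \<and> square_integrable g \<and> (AE x in lborel. f x = g x))"
  proof (rule transpI, elim conjE, intro conjI)
    fix f g h :: "'a \<Rightarrow> complex"
    assume "AE x in lborel. f x = g x" "AE x in lborel. g x = h x"
    then show "AE x in lborel. f x = h x" by eventually_elim simp
  qed
qed

instantiation L2 :: (euclidean_space) real_vector
begin

lift_definition zero_L2 :: "'a L2" is "\<lambda>x. 0"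
  by (simp add: square_integrable_zero)

lift_definition plus_L2 :: "'a L2 \<Rightarrow> 'a L2 \<Rightarrow> 'a L2" is "\<lambda>f g x. f x + g x"
proof (elim conjE, intro conjI)
  fix f f' g g' :: "'a \<Rightarrow> complex"
  assume "AE x in lborel. f x = f' x" "AE x in lborel. g x = g' x"
  then show "AE x in lborel. f x + g x = f' x + g' x" by eventually_elim simp
qed (rule square_integrable_add; assumption)+

lift_definition uminus_L2 :: "'a L2 \<Rightarrow> 'a L2" is "\<lambda>f x. - f x"
  by (auto intro: square_integrable_uminus)

lift_definition minus_L2 :: "'a L2 \<Rightarrow> 'a L2 \<Rightarrow> 'a L2" is "\<lambda>f g x. f x - g x"
proof (elim conjE, intro conjI)
  fix f f' g g' :: "'a \<Rightarrow> complex"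
  assume "AE x in lborel. f x = f' x" "AE x in lborel. g x = g' x"
  then show "AE x in lborel. f x - g x = f' x - g' x" by eventually_elim simp
qed (rule square_integrable_diff; assumption)+

lift_definition scaleR_L2 :: "real \<Rightarrow> 'a L2 \<Rightarrow> 'a L2" is "\<lambda>c f x. of_real c * f x"
  by (auto intro: square_integrable_mult)

instance
proof
  fix f g h :: "'a L2" and a b :: real
  note [intro] = square_integrable_zero square_integrable_add square_integrable_mult
    square_integrable_uminus square_integrable_diff
  show "f + g + h = f + (g + h)" by transfer (auto simp: add.assoc)
  show "f + g = g + f" by transfer (auto simp: add.commute)
  show "0 + f = f" by transfer auto
  show "- f + f = 0" by transfer auto
  show "f - g = f + - g" by transfer auto
  show "a *\<^sub>R (f + g) = a *\<^sub>R f + a *\<^sub>R g" by transfer (auto simp: distrib_left)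
  show "(a + b) *\<^sub>R f = a *\<^sub>R f + b *\<^sub>R f" by transfer (auto simp: distrib_right)
  show "a *\<^sub>R b *\<^sub>R f = (a * b) *\<^sub>R f" by transfer (auto simp: mult.assoc)
  show "1 *\<^sub>R f = f" by transfer auto
qed

end

lift_definition scaleC_L2 :: "complex \<Rightarrow> 'a::euclidean_space L2 \<Rightarrow> 'a L2"  (infixr "*\<^sub>C" 75)
  is "\<lambda>c f x. c * f x"
  by (auto intro: square_integrable_mult)

lift_definition cinner_L2 :: "'a::euclidean_space L2 \<Rightarrow> 'a L2 \<Rightarrow> complex"
  is "\<lambda>f g. LINT x|lborel. f x * cnj (g x)"
proof -
  fix f f' g g' :: "'a \<Rightarrow> complex"
  assume f: "square_integrable f \<and> square_integrable f' \<and> (AE x in lborel. f x = f' x)"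
    and g: "square_integrable g \<and> square_integrable g' \<and> (AE x in lborel. g x = g' x)"
  have [measurable]: "f \<in> borel_measurable borel" "f' \<in> borel_measurable borel"
    "g \<in> borel_measurable borel" "g' \<in> borel_measurable borel"
    using f g by (auto dest: square_integrableD(2))
  from f g have "AE x in lborel. f x = f' x" "AE x in lborel. g x = g' x"
    by simp_all
  then have "AE x in lborel. f x * cnj (g x) = f' x * cnj (g' x)"
    by eventually_elim simp
  then show "(LINT x|lborel. f x * cnj (g x)) = (LINT x|lborel. f' x * cnj (g' x))"
    by (intro integral_cong_AE) auto
qed

lemma cinner_L2_commute: "cinner_L2 f g = cnj (cinner_L2 g f)"
proof transfer
  fix f g :: "'a \<Rightarrow> complex"
  have "cnj (LINT x|lborel. g x * cnj (f x)) = (LINT x|lborel. cnj (g x * cnj (f x)))"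
    by (rule Bochner_Integration.integral_cnj[symmetric])
  then show "(LINT x|lborel. f x * cnj (g x)) = cnj (LINT x|lborel. g x * cnj (f x))"
    by (simp add: mult.commute)
qed

lemma cinner_L2_add_left: "cinner_L2 (f + g) h = cinner_L2 f h + cinner_L2 g h"
  by transfer (simp only: distrib_right Bochner_Integration.integral_add square_integrable_inner)

lemma cinner_L2_self:
  assumes "square_integrable f"
  shows "(LINT x|lborel. f x * cnj (f x)) = of_real (LINT x|lborel. (cmod (f x))\<^sup>2)"
  by (simp only: complex_norm_square[symmetric] integral_complex_of_real)

instantiation L2 :: (euclidean_space) real_inner
begin

definition inner_L2 :: "'a L2 \<Rightarrow> 'a L2 \<Rightarrow> real" where
  "inner_L2 f g = Re (cinner_L2 f g)"

definition norm_L2 :: "'a L2 \<Rightarrow> real" where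
  "norm_L2 f = sqrt (inner f f)"

definition dist_L2 :: "'a L2 \<Rightarrow> 'a L2 \<Rightarrow> real" where
  "dist_L2 f g = norm (f - g)"

definition sgn_L2 :: "'a L2 \<Rightarrow> 'a L2" where
  "sgn_L2 f = f /\<^sub>R norm f"

definition uniformity_L2 :: "('a L2 \<times> 'a L2) filter" where
  "uniformity_L2 = (INF e\<in>{0<..}. principal {(f, g). dist f g < e})"

definition open_L2 :: "'a L2 set \<Rightarrow> bool" where
  "open_L2 U = (\<forall>f\<in>U. eventually (\<lambda>(f', g). f' = f \<longrightarrow> g \<in> U) uniformity)"

instance
proof
  fix f g h :: "'a L2" and c :: real
  show "inner f g = inner g f"
    unfolding inner_L2_def by (subst cinner_L2_commute) simp
  show "inner (f + g) h = inner f h + inner g h"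
    by (simp add: inner_L2_def cinner_L2_add_left)
  show "inner (c *\<^sub>R f) g = c * inner f g"
    unfolding inner_L2_def
  proof transfer
    fix f g :: "'a \<Rightarrow> complex" and c :: real
    have "(LINT x|lborel. of_real c * f x * cnj (g x)) = of_real c * (LINT x|lborel. f x * cnj (g x))"
      by (simp only: mult.assoc integral_mult_right_zero)
    then show "Re (LINT x|lborel. of_real c * f x * cnj (g x)) = c * Re (LINT x|lborel. f x * cnj (g x))"
      by simp
  qed
  show "0 \<le> inner f f"
    unfolding inner_L2_def by transfer (subst cinner_L2_self, simp_all)
  show "inner f f = 0 \<longleftrightarrow> f = 0"
    unfolding inner_L2_def
  proof transfer
    fix f :: "'a \<Rightarrow> complex"
    assume f: "square_integrable f \<and> square_integrable f \<and> (AE x in lborel. f x = f x)"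
    then have "(LINT x|lborel. (cmod (f x))\<^sup>2) = 0 \<longleftrightarrow> (AE x in lborel. (cmod (f x))\<^sup>2 = 0)"
      by (intro integral_nonneg_eq_0_iff_AE) (auto dest: square_integrableD)
    moreover have "(LINT x|lborel. f x * cnj (f x)) = of_real (LINT x|lborel. (cmod (f x))\<^sup>2)"
      using f cinner_L2_self by blast
    ultimately show "Re (LINT x|lborel. f x * cnj (f x)) = 0 \<longleftrightarrow>
      square_integrable f \<and> square_integrable (\<lambda>x. 0::complex) \<and> (AE x in lborel. f x = 0)"
      using f by (simp add: square_integrable_zero)
  qed
qed (fact norm_L2_def dist_L2_def sgn_L2_def uniformity_L2_def open_L2_def[rule_format])+

end

text \<open>The class of a function. The value \<open>0\<close> for a function that is not square integrable
  is a dummy.\<close>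

definition L2_of :: "('a::euclidean_space \<Rightarrow> complex) \<Rightarrow> 'a L2" where
  "L2_of f = (if square_integrable f then abs_L2 f else 0)"

lemma norm_L2_of:
  assumes "square_integrable f"
  shows "norm (L2_of f) = sqrt (LINT x|lborel. (cmod (f x))\<^sup>2)"
proof -
  have "cinner_L2 (abs_L2 f) (abs_L2 f) = (LINT x|lborel. f x * cnj (f x))"
    using assms by (intro cinner_L2.abs_eq) auto
  then show ?thesis using assms by (simp add: norm_L2_def inner_L2_def L2_of_def cinner_L2_self)
qed

lemma square_integrable_rep_L2: "square_integrable (rep_L2 f)"
  using Quotient_rep_reflp[OF Quotient_L2, of f] by simp

lemma L2_of_rep [simp]: "L2_of (rep_L2 f) = f"
  using Quotient_abs_rep[OF Quotient_L2] by (simp add: L2_of_def square_integrable_rep_L2)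

lemma L2_of_eq_iff:
  assumes "square_integrable f" "square_integrable g"
  shows "L2_of f = L2_of g \<longleftrightarrow> (AE x in lborel. f x = g x)"
  using Quotient_rel[OF Quotient_L2, of f g] assms by (simp add: L2_of_def)

lemma rep_L2_of:
  assumes "square_integrable f"
  shows "AE x in lborel. rep_L2 (L2_of f) x = f x"
  using assms by (subst L2_of_eq_iff[symmetric]) (auto simp: square_integrable_rep_L2)

lemma L2_of_diff:
  assumes "square_integrable f" "square_integrable g"
  shows "L2_of f - L2_of g = L2_of (\<lambda>x. f x - g x)"
  using assms by (simp add: L2_of_def square_integrable_diff minus_L2.abs_eq)

lemma L2_of_add:
  assumes "square_integrable f" "square_integrable g"
  shows "L2_of f + L2_of g = L2_of (\<lambda>x. f x + g x)"
  using assms by (simp add: L2_of_def square_integrable_add plus_L2.abs_eq)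

lemma L2_of_mult:
  assumes "square_integrable f"
  shows "c *\<^sub>C L2_of f = L2_of (\<lambda>x. c * f x)"
  using assms by (simp add: L2_of_def square_integrable_mult scaleC_L2.abs_eq)

lemma norm_L2_diff:
  "(norm (f - g))\<^sup>2 = (LINT x|lborel. (cmod (rep_L2 f x - rep_L2 g x))\<^sup>2)"
proof -
  have "norm (f - g) = norm (L2_of (\<lambda>x. rep_L2 f x - rep_L2 g x))"
    by (subst L2_of_diff[symmetric]) (auto simp: square_integrable_rep_L2)
  also have "\<dots> = sqrt (LINT x|lborel. (cmod (rep_L2 f x - rep_L2 g x))\<^sup>2)"
    by (intro norm_L2_of square_integrable_diff square_integrable_rep_L2)
  finally show ?thesis by (simp add: integral_nonneg_AE)
qed

lemma square_integrable_iff_nn_integral: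
  "square_integrable f \<longleftrightarrow>
     f \<in> borel_measurable lborel \<and> (\<integral>\<^sup>+x. ennreal ((cmod (f x))\<^sup>2) \<partial>lborel) < \<infinity>"
  by (auto simp: square_integrable_def integrable_iff_bounded)

instance L2 :: (euclidean_space) banach
proof
  fix X :: "nat \<Rightarrow> 'a L2"
  assume X: "Cauchy X"
  have "\<forall>k. \<exists>N. \<forall>m\<ge>N. \<forall>n\<ge>N. norm (X m - X n) < (1/4) ^ k"
    using CauchyD[OF X] by simp
  then obtain N where N: "norm (X m - X n) < (1/4) ^ k" if "m \<ge> N k" "n \<ge> N k" for m n k
    by metis
  define r where "r k = (\<Sum>i\<le>k. N i) + k" for k
  have r: "strict_mono r"
    by (auto simp: r_def strict_mono_Suc_iff)
  have rN: "N k \<le> r j" if "k \<le> j" for k j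
    using member_le_sum[of k "{..j}" N] that by (auto simp: r_def)
  define f where "f k = rep_L2 (X (r k))" for k
  have f: "square_integrable (f k)" for k
    by (simp add: f_def square_integrable_rep_L2)
  note [measurable] = square_integrableD(2)[OF f]
  define d where "d j k x = (cmod (f j x - f k x))\<^sup>2" for j k x
  have d_int: "integrable lborel (d j k)" for j k
    using square_integrable_diff[OF f f, of j k] by (simp add: square_integrable_def d_def[abs_def])
  have d_nn: "(\<integral>\<^sup>+x. ennreal (d j k x) \<partial>lborel) = ennreal ((norm (X (r j) - X (r k)))\<^sup>2)" for j k
    using d_int[of j k] by (subst nn_integral_eq_integral) (auto simp: d_def[abs_def] norm_L2_diff f_def)
  have d_le: "(\<integral>\<^sup>+x. ennreal (d j k x) \<partial>lborel) \<le> ennreal ((1/16) ^ k)" if "k \<le> j" for j k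
  proof -
    have "(norm (X (r j) - X (r k)))\<^sup>2 \<le> ((1/4) ^ k)\<^sup>2"
      using N[OF rN[OF that] rN[OF order_refl]] by (intro power_mono) (auto intro: less_imp_le)
    also have "\<dots> = (1/16) ^ k"
      by (simp add: power2_eq_square flip: power_mult_distrib)
    finally show ?thesis by (simp add: d_nn ennreal_leI)
  qed
  have "(\<integral>\<^sup>+x. (\<Sum>k. ennreal (4 ^ k * d (Suc k) k x)) \<partial>lborel)
      = (\<Sum>k. \<integral>\<^sup>+x. ennreal (4 ^ k * d (Suc k) k x) \<partial>lborel)"
    by (rule nn_integral_suminf) (simp add: d_def)
  also have "\<dots> \<le> (\<Sum>k. ennreal ((1/4) ^ k))"
  proof (rule suminf_le)
    fix k
    have "(\<integral>\<^sup>+x. ennreal (4 ^ k * d (Suc k) k x) \<partial>lborel)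
        = ennreal (4 ^ k) * (\<integral>\<^sup>+x. ennreal (d (Suc k) k x) \<partial>lborel)"
      by (simp add: ennreal_mult d_def nn_integral_cmult)
    also have "\<dots> \<le> ennreal (4 ^ k) * ennreal ((1/16) ^ k)"
      by (intro mult_left_mono d_le) auto
    also have "\<dots> = ennreal ((4 * (1/16)) ^ k)"
      by (simp only: power_mult_distrib ennreal_mult zero_le_power zero_le_numeral
          zero_le_divide_1_iff)
    also have "\<dots> = ennreal ((1/4) ^ k)" by simp
    finally show "(\<integral>\<^sup>+x. ennreal (4 ^ k * d (Suc k) k x) \<partial>lborel) \<le> ennreal ((1/4) ^ k)" .
  qed auto
  also have "\<dots> < \<infinity>"
    by (subst suminf_ennreal2) (auto intro: summable_geometric simp: less_top)
  finally have "AE x in lborel. (\<Sum>k. ennreal (4 ^ k * d (Suc k) k x)) \<noteq> \<infinity>"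
    by (intro nn_integral_PInf_AE) (auto simp: d_def)
  then have conv: "AE x in lborel. convergent (\<lambda>k. f k x)"
  proof eventually_elim
    case (elim x)
    then have "summable (\<lambda>k. 4 ^ k * d (Suc k) k x)"
      by (intro summable_suminf_not_top) (auto simp: d_def)
    then have "bounded (range (\<lambda>k. 4 ^ k * d (Suc k) k x))"
      by (rule convergent_imp_bounded[OF summable_LIMSEQ_zero])
    then obtain C where C: "norm (4 ^ k * d (Suc k) k x) \<le> C" for k
      by (auto simp: bounded_iff)
    have bound: "norm (f (Suc k) x - f k x) \<le> sqrt C * (1/2) ^ k" for k
    proof -
      have "(2 ^ k)\<^sup>2 = (4 ^ k :: real)"
        by (simp add: power2_eq_square flip: power_mult_distrib)
      then have "(2 ^ k * cmod (f (Suc k) x - f k x))\<^sup>2 = 4 ^ k * d (Suc k) k x"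
        by (simp add: d_def power_mult_distrib)
      then have "2 ^ k * cmod (f (Suc k) x - f k x) \<le> sqrt C"
        using C[of k] by (intro real_le_rsqrt) simp
      then show ?thesis by (simp add: field_simps power_divide)
    qed
    have "summable (\<lambda>k. sqrt C * (1/2) ^ k)"
      by (intro summable_mult summable_geometric) simp
    then have "summable (\<lambda>k. f (Suc k) x - f k x)"
      by (rule summable_comparison_test') (rule bound)
    then have "convergent (\<lambda>n. \<Sum>k<n. f (Suc k) x - f k x)"
      by (simp add: summable_iff_convergent)
    then have "convergent (\<lambda>n. (f n x - f 0 x) + f 0 x)"
      by (intro convergent_add convergent_const) (simp add: sum_lessThan_telescope[of "\<lambda>k. f k x"])
    then show ?case by simp
  qed
  define g where "g x = lim (\<lambda>k. f k x)" for x
  have [measurable]: "g \<in> borel_measurable borel"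
    unfolding g_def[abs_def] by (rule borel_measurable_lim_metric) simp
  have g_le: "(\<integral>\<^sup>+x. ennreal ((cmod (g x - f k x))\<^sup>2) \<partial>lborel) \<le> ennreal ((1/16) ^ k)" for k
  proof -
    have "AE x in lborel. ennreal ((cmod (g x - f k x))\<^sup>2) = liminf (\<lambda>j. ennreal (d j k x))"
      using conv
    proof eventually_elim
      case (elim x)
      then have "(\<lambda>j. f j x) \<longlonglongrightarrow> g x" by (simp add: g_def convergent_LIMSEQ_iff)
      then have "(\<lambda>j. ennreal (d j k x)) \<longlonglongrightarrow> ennreal ((cmod (g x - f k x))\<^sup>2)"
        unfolding d_def by (intro tendsto_intros)
      then show ?case by (intro lim_imp_Liminf[symmetric]) auto
    qed
    then have "(\<integral>\<^sup>+x. ennreal ((cmod (g x - f k x))\<^sup>2) \<partial>lborel)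
        = (\<integral>\<^sup>+x. liminf (\<lambda>j. ennreal (d j k x)) \<partial>lborel)"
      by (rule nn_integral_cong_AE)
    also have "\<dots> \<le> liminf (\<lambda>j. \<integral>\<^sup>+x. ennreal (d j k x) \<partial>lborel)"
      by (rule nn_integral_liminf) (simp add: d_def)
    also have "\<dots> \<le> limsup (\<lambda>j. \<integral>\<^sup>+x. ennreal (d j k x) \<partial>lborel)"
      by (rule Liminf_le_Limsup) simp
    also have "\<dots> \<le> ennreal ((1/16) ^ k)"
      by (rule Limsup_bounded) (auto intro!: eventually_sequentiallyI[of k] d_le)
    finally show ?thesis .
  qed
  have gf: "square_integrable (\<lambda>x. g x - f k x)" for k
    using g_le[of k] by (auto simp: square_integrable_iff_nn_integral less_top intro: le_less_trans)
  have g: "square_integrable g"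
    using square_integrable_add[OF gf[of 0] f[of 0]] by simp
  have "norm (X (r k) - L2_of g) \<le> (1/4) ^ k" for k
  proof -
    have "norm (X (r k) - L2_of g) = norm (L2_of g - L2_of (f k))"
      by (simp add: f_def norm_minus_commute)
    also have "\<dots> = sqrt (LINT x|lborel. (cmod (g x - f k x))\<^sup>2)"
      using norm_L2_of[OF gf] by (simp add: L2_of_diff g f)
    also have "\<dots> \<le> sqrt ((1/16) ^ k)"
    proof (rule real_sqrt_le_mono)
      have "ennreal (LINT x|lborel. (cmod (g x - f k x))\<^sup>2) \<le> ennreal ((1/16) ^ k)"
        using g_le[of k] gf[of k]
        by (subst nn_integral_eq_integral[symmetric]) (auto simp: square_integrable_def)
      then show "(LINT x|lborel. (cmod (g x - f k x))\<^sup>2) \<le> (1/16) ^ k" by simp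
    qed
    also have "\<dots> = (1/4) ^ k"
      by (rule real_sqrt_unique) (simp_all add: power2_eq_square flip: power_mult_distrib)
    finally show ?thesis .
  qed
  then have "(\<lambda>k. X (r k) - L2_of g) \<longlonglongrightarrow> 0"
    by (intro Lim_null_comparison[OF always_eventually LIMSEQ_realpow_zero[of "1/4"]]) auto
  then have "(X \<circ> r) \<longlonglongrightarrow> L2_of g"
    by (simp add: LIM_zero_iff o_def)
  then show "convergent X"
    using Cauchy_converges_subseq[OF X r] by (auto simp: convergent_def)
qed

lemma square_integrable_indicator:
  assumes "A \<in> sets lborel" "emeasure lborel A < \<infinity>"
  shows "square_integrable (\<lambda>x. c * indicator A x)"
proof -
  have "(cmod (c * indicator A x))\<^sup>2 = (cmod c)\<^sup>2 * indicator A x" for x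
    by (simp add: indicator_def)
  then show ?thesis
    using assms by (simp add: square_integrable_def integrable_real_indicator)
qed

lemma norm_L2_indicator_diff:
  assumes "A \<in> sets lborel" "emeasure lborel A < \<infinity>" "B \<subseteq> A" "B \<in> sets lborel"
  shows "(norm (L2_of (\<lambda>x. c * indicator A x) - L2_of (\<lambda>x. c * indicator B x)))\<^sup>2
      = (cmod c)\<^sup>2 * measure lborel (A - B)"
proof -
  have B: "emeasure lborel B < \<infinity>"
    using assms by (auto intro: le_less_trans[OF emeasure_mono])
  have sq: "(cmod (c * indicator A x - c * indicator B x))\<^sup>2 = (cmod c)\<^sup>2 * indicator (A - B) x" for x
    using assms(3) by (auto simp: indicator_def)
  have "norm (L2_of (\<lambda>x. c * indicator A x) - L2_of (\<lambda>x. c * indicator B x))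
      = sqrt (LINT x|lborel. (cmod (c * indicator A x - c * indicator B x))\<^sup>2)"
    using assms B
    by (simp only: L2_of_diff norm_L2_of square_integrable_indicator square_integrable_diff)
  then show ?thesis using assms by (simp add: sq)
qed

lemma L2_separable: "\<exists>D :: 'a::euclidean_space L2 set. countable D \<and> closure D = UNIV"
proof -
  obtain B :: "'a set set" where B: "countable B" "topological_basis B"
    using ex_countable_basis by blast
  define B' where "B' = {U \<in> Union ` {F. F \<subseteq> B \<and> finite F}. emeasure lborel U < \<infinity>}"
  have "countable {F. F \<subseteq> B \<and> finite F}"
    using countable_Collect_finite_subset[OF B(1)] by (simp add: conj_commute)
  then have B'_count: "countable B'" by (auto simp: B'_def)
  have B'_open: "open U" if "U \<in> B'" for U
    using that B(2) by (auto simp: B'_def dest: topological_basis_open)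
  define q :: "rat \<times> rat \<times> 'a set \<Rightarrow> 'a L2" where
    "q = (\<lambda>(a, b, U). L2_of (\<lambda>x. Complex (of_rat a) (of_rat b) * indicator U x))"
  define D where "D = (\<lambda>ts. sum_list (map q ts)) ` lists (UNIV \<times> UNIV \<times> B')"
  have "countable D"
    using B'_count by (auto simp: D_def intro!: countable_image countable_lists)
  moreover have "closure D = UNIV"
  proof -
    let ?I = "\<lambda>c A. L2_of (\<lambda>x. c * indicator A x)"
    have closed: "f \<in> closure D" if "\<And>n. u n \<in> closure D" "u \<longlonglongrightarrow> f" for u f
      using closed_sequentially[OF closed_closure] that by blast
    have D_add: "f + g \<in> D" if "f \<in> D" "g \<in> D" for f g
    proof -
      from that obtain s t where "s \<in> lists (UNIV \<times> UNIV \<times> B')" "f = sum_list (map q s)"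
        "t \<in> lists (UNIV \<times> UNIV \<times> B')" "g = sum_list (map q t)" by (auto simp: D_def)
      then show ?thesis unfolding D_def by (intro image_eqI[of _ _ "s @ t"]) auto
    qed
    have add: "f + g \<in> closure D" if fg: "f \<in> closure D" "g \<in> closure D" for f g
    proof -
      from fg obtain u v where "\<And>n. u n \<in> D" "u \<longlonglongrightarrow> f" "\<And>n. v n \<in> D" "v \<longlonglongrightarrow> g"
        unfolding closure_sequential by blast
      then show ?thesis
        unfolding closure_sequential
        by (intro exI[of _ "\<lambda>n. u n + v n"]) (auto intro: D_add tendsto_add)
    qed
    have "0 \<in> D" unfolding D_def by (intro image_eqI[of _ _ "[]"]) auto
    then have zero: "0 \<in> closure D" using closure_subset by blast
    have basic: "?I c U \<in> closure D" if U: "U \<in> B'" for c U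
    proof -
      have "\<exists>a. (\<forall>n. a n \<in> \<rat>) \<and> a \<longlonglongrightarrow> x" for x :: real
      proof -
        have "x \<in> closure \<rat>" using Rats_closure_real by simp
        then show ?thesis by (simp add: closure_sequential)
      qed
      then obtain a b where a: "\<And>n. a n \<in> \<rat>" "a \<longlonglongrightarrow> Re c" and b: "\<And>n. b n \<in> \<rat>" "b \<longlonglongrightarrow> Im c"
        by metis
      have Ufin: "U \<in> sets lborel" "emeasure lborel U < \<infinity>"
        using U B'_open by (auto simp: B'_def)
      have sqU: "square_integrable (\<lambda>x. d * indicator U x)" for d
        by (rule square_integrable_indicator[OF Ufin])
      have eq: "norm (?I d U - ?I c U) = cmod (d - c) * norm (?I 1 U)" for d
      proof -
        have "?I d U - ?I c U = ?I (d - c) U"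
          using sqU by (simp add: L2_of_diff left_diff_distrib)
        also have "norm \<dots> = sqrt (LINT x|lborel. (cmod (d - c))\<^sup>2 * (cmod (1 * indicator U x))\<^sup>2)"
          using sqU by (simp only: norm_L2_of norm_mult power_mult_distrib norm_one mult_1)
        also have "\<dots> = cmod (d - c) * norm (?I 1 U)"
          using sqU by (simp only: norm_L2_of integral_mult_right_zero real_sqrt_mult real_sqrt_abs abs_norm_cancel)
        finally show ?thesis .
      qed
      have "?I (Complex (a n) (b n)) U \<in> closure D" for n
      proof -
        obtain a' b' where "a n = of_rat a'" "b n = of_rat b'"
          using a(1)[of n] b(1)[of n] by (auto elim!: Rats_cases)
        then have "?I (Complex (a n) (b n)) U \<in> D"
          unfolding D_def using U by (intro image_eqI[of _ _ "[(a', b', U)]"]) (auto simp: q_def)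
        then show ?thesis using closure_subset by blast
      qed
      moreover have "(\<lambda>n. ?I (Complex (a n) (b n)) U) \<longlonglongrightarrow> ?I c U"
      proof -
        have "(\<lambda>n. Complex (a n) (b n)) \<longlonglongrightarrow> c"
          using a(2) b(2) by (simp add: tendsto_complex_iff)
        then have "(\<lambda>n. cmod (Complex (a n) (b n) - c) * norm (?I 1 U)) \<longlonglongrightarrow> 0"
          by (auto intro!: tendsto_mult_left_zero tendsto_norm_zero simp: LIM_zero_iff)
        then have "(\<lambda>n. ?I (Complex (a n) (b n)) U - ?I c U) \<longlonglongrightarrow> 0"
          by (subst tendsto_norm_zero_iff[symmetric]) (simp only: eq)
        then show ?thesis by (simp add: LIM_zero_iff)
      qed
      ultimately show ?thesis by (rule closed)
    qed
    have approx: "(\<lambda>n. ?I c (A n)) \<longlonglongrightarrow> ?I c S"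
      if *: "(\<lambda>n. measure lborel (sym_diff (A n) S)) \<longlonglongrightarrow> 0"
        "\<And>n. A n \<subseteq> S \<or> S \<subseteq> A n" "S \<in> sets lborel" "\<And>n. A n \<in> sets lborel"
        "emeasure lborel S < \<infinity>" "\<And>n. emeasure lborel (A n) < \<infinity>"
      for c S and A :: "nat \<Rightarrow> 'a set"
    proof -
      have "(norm (?I c (A n) - ?I c S))\<^sup>2 = (cmod c)\<^sup>2 * measure lborel (sym_diff (A n) S)" for n
      proof (cases "A n \<subseteq> S")
        case True
        then have "sym_diff (A n) S = S - A n" by blast
        then show ?thesis
          using norm_L2_indicator_diff[OF *(3,5) True *(4), of c] by (simp add: norm_minus_commute)
      next
        case False
        then have S: "S \<subseteq> A n" using *(2)[of n] by blast
        then have "sym_diff (A n) S = A n - S" by blast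
        then show ?thesis
          using norm_L2_indicator_diff[OF *(4,6) S *(3), of c] by simp
      qed
      then have "(\<lambda>n. (norm (?I c (A n) - ?I c S))\<^sup>2) \<longlonglongrightarrow> 0"
        using tendsto_mult_right_zero[OF *(1), of "(cmod c)\<^sup>2"] by simp
      then have "(\<lambda>n. sqrt ((norm (?I c (A n) - ?I c S))\<^sup>2)) \<longlonglongrightarrow> sqrt 0"
        by (rule tendsto_real_sqrt)
      then have "(\<lambda>n. ?I c (A n) - ?I c S) \<longlonglongrightarrow> 0"
        by (simp add: tendsto_norm_zero_iff)
      then show ?thesis by (simp add: LIM_zero_iff)
    qed
    have open_in: "?I c U \<in> closure D" if U: "open U" "emeasure lborel U < \<infinity>" for c U
    proof (cases "U = {}")
      case True
      then have "U \<in> B'" by (auto simp: B'_def intro: exI[of _ "{}"])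
      then show ?thesis by (rule basic)
    next
      case False
      obtain F where F: "F \<subseteq> B" "U = \<Union>F"
        using B(2) U(1) by (auto simp: topological_basis_def)
      have "F \<noteq> {}" "countable F"
        using False F B(1) countable_subset by auto
      then obtain b :: "nat \<Rightarrow> 'a set" where b: "range b = F"
        using that[of "from_nat_into F"] range_from_nat_into[of F] by simp
      define V where "V n = (\<Union>k\<le>n. b k)" for n :: nat
      have VU: "V n \<subseteq> U" for n using b F by (auto simp: V_def)
      have Vfin: "emeasure lborel (V n) < \<infinity>" for n
        using emeasure_mono[OF VU, of lborel n] U by (auto intro: le_less_trans)
      have VB: "V n \<in> B'" for n
        using b F Vfin[of n] unfolding B'_def V_def by blast
      have Vm: "V n \<in> sets lborel" for n using B'_open[OF VB] by simp
      have "(\<Union>n. V n) = U" using b F by (auto simp: V_def)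
      moreover have "(\<lambda>n. measure lborel (V n)) \<longlonglongrightarrow> measure lborel (\<Union>n. V n)"
        using Vm U(2) \<open>(\<Union>n. V n) = U\<close>
        by (intro Lim_measure_incseq) (auto simp: incseq_def V_def intro: order_trans)
      ultimately have "(\<lambda>n. measure lborel U - measure lborel (V n)) \<longlonglongrightarrow> 0"
        by (auto intro!: tendsto_eq_intros)
      moreover have "measure lborel (sym_diff (V n) U) = measure lborel U - measure lborel (V n)" for n
      proof -
        have "sym_diff (V n) U = U - V n" using VU[of n] by blast
        then show ?thesis using VU[of n] U Vm[of n] by (simp add: measure_Diff)
      qed
      ultimately have "(\<lambda>n. measure lborel (sym_diff (V n) U)) \<longlonglongrightarrow> 0" by simp
      then have "(\<lambda>n. ?I c (V n)) \<longlonglongrightarrow> ?I c U"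
        using VU Vm U Vfin by (intro approx) auto
      with basic[OF VB] show ?thesis by (rule closed)
    qed
    have meas_in: "?I c S \<in> closure D" if S: "S \<in> sets lborel" "emeasure lborel S < \<infinity>" for c S
    proof -
      have "\<exists>T. open T \<and> S \<subseteq> T \<and> emeasure lborel (T - S) < ennreal (1 / real (Suc n))" for n
      proof -
        obtain T where T: "open T" "S \<subseteq> T" "T - S \<in> lmeasurable"
          "emeasure lebesgue (T - S) < ennreal (1 / real (Suc n))"
          using sets_lebesgue_outer_open[of S "1 / real (Suc n)"] S(1) by auto
        have "emeasure lebesgue (T - S) = emeasure lborel (T - S)"
          using T(1) S(1) by (simp add: emeasure_completion main_part_sets)
        with T show ?thesis by auto
      qed
      then obtain T where T: "open (T n)" "S \<subseteq> T n"
        "emeasure lborel (T n - S) < ennreal (1 / real (Suc n))" for n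
        by metis
      have Tfin: "emeasure lborel (T n) < \<infinity>" for n
      proof -
        have "emeasure lborel (T n) = emeasure lborel S + emeasure lborel (T n - S)"
          using T(1,2)[of n] S by (subst plus_emeasure) (auto simp: Un_absorb1)
        also have "\<dots> < \<infinity>" using S(2) T(3)[of n] by (simp add: less_top) (metis ennreal_less_top less_top order.strict_trans top.not_eq_extremum)
        finally show ?thesis .
      qed
      have "measure lborel (sym_diff (T n) S) \<le> 1 / real (Suc n)" for n
      proof -
        have "sym_diff (T n) S = T n - S" using T(2)[of n] by blast
        then show ?thesis using T(3)[of n] by (auto simp: measure_def intro!: enn2real_leI intro: less_imp_le)
      qed
      then have "(\<lambda>n. measure lborel (sym_diff (T n) S)) \<longlonglongrightarrow> 0"
        by (intro Lim_null_comparison[OF _ LIMSEQ_inverse_real_of_nat])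
          (auto simp: inverse_eq_divide intro!: always_eventually)
      then have "(\<lambda>n. ?I c (T n)) \<longlonglongrightarrow> ?I c S"
        using T(1,2) Tfin S by (intro approx) auto
      with open_in[OF T(1) Tfin] show ?thesis by (rule closed)
    qed
    have simple_in: "L2_of s \<in> closure D" if s: "simple_function lborel s" "square_integrable s" for s
    proof -
      let ?A = "\<lambda>y. s -` {y}"
      have fin: "finite (range s)" using simple_functionD(1)[OF s(1)] by simp
      have A: "?A y \<in> sets lborel" for y
        using simple_functionD(2)[OF s(1), of "{y}"] by simp
      have Afin: "emeasure lborel (?A y) < \<infinity>" if "y \<noteq> 0" for y
      proof -
        have "(\<integral>\<^sup>+x. ennreal ((cmod y)\<^sup>2) * indicator (?A y) x \<partial>lborel)
            \<le> (\<integral>\<^sup>+x. ennreal ((cmod (s x))\<^sup>2) \<partial>lborel)"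
          by (intro nn_integral_mono) (auto simp: indicator_def)
        also have "\<dots> < \<infinity>"
          using s(2) by (simp add: square_integrable_iff_nn_integral)
        finally have "ennreal ((cmod y)\<^sup>2) * emeasure lborel (?A y) < \<infinity>"
          using A by (simp add: nn_integral_cmult_indicator)
        then show ?thesis using that by (auto simp: ennreal_mult_less_top)
      qed
      have "square_integrable (\<lambda>x. \<Sum>y\<in>Y. y * indicator (?A y) x) \<and>
          L2_of (\<lambda>x. \<Sum>y\<in>Y. y * indicator (?A y) x) \<in> closure D" if "finite Y" for Y
        using that
      proof induction
        case empty
        have "L2_of (\<lambda>x. 0 * indicator {} x) \<in> closure D" by (rule meas_in) auto
        then show ?case by (simp add: square_integrable_zero)
      next
        case (insert y Y)
        have y: "square_integrable (\<lambda>x. y * indicator (?A y) x)" "?I y (?A y) \<in> closure D"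
          using square_integrable_indicator[OF A Afin] meas_in[OF A Afin]
            square_integrable_zero meas_in[of "{}" 0]
          by (cases "y = 0"; simp)+
        let ?g = "\<lambda>x. \<Sum>y\<in>Y. y * indicator (?A y) x :: complex"
        have g: "square_integrable ?g" "L2_of ?g \<in> closure D" using insert.IH by blast+
        have "(\<lambda>x. \<Sum>y\<in>insert y Y. y * indicator (?A y) x) = (\<lambda>x. y * indicator (?A y) x + ?g x)"
          using insert.hyps by (intro ext sum.insert)
        with square_integrable_add[OF y(1) g(1)] add[OF y(2) g(2)] show ?case
          unfolding L2_of_add[OF y(1) g(1)] by (simp only: simp_thms)
      qed
      from this[OF fin] have "L2_of (\<lambda>x. \<Sum>y\<in>range s. y * indicator (?A y) x) \<in> closure D" by simp
      moreover have "(\<Sum>y\<in>range s. y * indicator (?A y) x) = s x" for x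
        using fin by (subst sum.remove[of _ "s x"]) (auto simp: indicator_def intro!: sum.neutral)
      ultimately show ?thesis by simp
    qed
    have "h \<in> closure D" for h
    proof -
      define f where "f = rep_L2 h"
      have f: "square_integrable f" by (simp add: f_def square_integrable_rep_L2)
      note [measurable] = square_integrableD(2)[OF f]
      obtain F where F: "\<And>i. simple_function lborel (F i)" "\<And>x. (\<lambda>i. F i x) \<longlonglongrightarrow> f x"
        "\<And>i x. cmod (F i x) \<le> 2 * cmod (f x)"
        using borel_measurable_implies_sequence_metric[of f lborel 0] by auto
      have [measurable]: "F i \<in> borel_measurable borel" for i
        using borel_measurable_simple_function[OF F(1)] by simp
      have le: "(cmod (F i x - f x))\<^sup>2 \<le> 9 * (cmod (f x))\<^sup>2" for i x
      proof -
        have "cmod (F i x - f x) \<le> 3 * cmod (f x)"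
          using norm_triangle_ineq4[of "F i x" "f x"] F(3)[of i x] by simp
        then have "(cmod (F i x - f x))\<^sup>2 \<le> (3 * cmod (f x))\<^sup>2" by (rule power_mono) simp
        then show ?thesis by (simp add: power_mult_distrib)
      qed
      have "integrable lborel (\<lambda>x. (cmod (F i x - f x))\<^sup>2)" for i
        using le by (intro Bochner_Integration.integrable_bound[OF integrable_mult_right[OF square_integrableD(3)[OF f], of 9]])
          auto
      then have diff: "square_integrable (\<lambda>x. F i x - f x)" for i
        by (simp add: square_integrable_def)
      then have Fi: "square_integrable (F i)" for i
        using square_integrable_add[OF _ f] by fastforce
      have "(\<lambda>i. LINT x|lborel. (cmod (F i x - f x))\<^sup>2) \<longlonglongrightarrow> (LINT x::'a|lborel. 0::real)"
      proof (rule integral_dominated_convergence[where w = "\<lambda>x. 9 * (cmod (f x))\<^sup>2"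
            and s = "\<lambda>i x. (cmod (F i x - f x))\<^sup>2" and f = "\<lambda>x. 0"])
        show "AE x in lborel. (\<lambda>i. (cmod (F i x - f x))\<^sup>2) \<longlonglongrightarrow> 0"
          using F(2) by (auto intro!: tendsto_eq_intros AE_I2)
      qed (use le f in \<open>auto simp: square_integrable_def\<close>)
      then have "(\<lambda>i. sqrt (LINT x|lborel. (cmod (F i x - f x))\<^sup>2)) \<longlonglongrightarrow> sqrt 0"
        by (intro tendsto_real_sqrt) simp
      moreover have "norm (L2_of (F i) - h) = sqrt (LINT x|lborel. (cmod (F i x - f x))\<^sup>2)" for i
      proof -
        have "L2_of (F i) - h = L2_of (\<lambda>x. F i x - f x)"
          using L2_of_diff[OF Fi f] by (simp add: f_def)
        then show ?thesis by (simp only: norm_L2_of[OF diff])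
      qed
      ultimately have "(\<lambda>i. norm (L2_of (F i) - h)) \<longlonglongrightarrow> 0" by simp
      then have "(\<lambda>i. L2_of (F i)) \<longlonglongrightarrow> h"
        by (simp add: tendsto_norm_zero_iff LIM_zero_iff)
      with simple_in[OF F(1) Fi] show ?thesis by (rule closed)
    qed
    then show ?thesis by blast
  qed
  ultimately show ?thesis by blast
qed

instance L2 :: (euclidean_space) second_countable_topology
proof
  obtain D :: "'a L2 set" where D: "countable D" "closure D = UNIV"
    using L2_separable by blast
  define B where "B = (\<lambda>(d, e). ball d e) ` (D \<times> (\<rat> \<inter> {0<..}))"
  have "topological_basis B"
  proof (rule topological_basisI)
    fix U and f :: "'a L2"
    assume "open U" "f \<in> U"
    then obtain e where e: "e > 0" "ball f e \<subseteq> U" by (auto simp: open_contains_ball)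
    obtain p where p: "p \<in> \<rat>" "0 < p" "p < e / 2" using e(1) Rats_dense_in_real[of 0 "e / 2"] by auto
    obtain d where d: "d \<in> D" "dist d f < p"
      using D(2) p(2) by (metis UNIV_I closure_approachable)
    have "ball d p \<subseteq> ball f e"
    proof
      fix h assume "h \<in> ball d p"
      then show "h \<in> ball f e"
        using dist_triangle[of f h d] d(2) p(3) by (simp add: dist_commute)
    qed
    then show "\<exists>W\<in>B. f \<in> W \<and> W \<subseteq> U"
      using d p e(2) by (intro bexI[of _ "ball d p"]) (auto simp: B_def)
  qed (auto simp: B_def)
  moreover have "countable B"
    using D(1) countable_rat by (auto simp: B_def intro!: countable_image countable_SIGMA)
  ultimately show "\<exists>B::'a L2 set set. countable B \<and> open = generate_topology B"
    by (auto intro!: exI[of _ B] dest!: topological_basis_imp_subbasis)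
qed


section \<open>Operators\<close>

text \<open>The operators below are given through the representative \<open>rep_L2 f\<close>. For
  \<open>r > 0\<close> and invertible \<open>A\<close> the underlying substitutions preserve null sets and
  square integrability, so the choice of the representative does not matter.\<close>

definition translate :: "'a::euclidean_space \<Rightarrow> 'a L2 \<Rightarrow> 'a L2" where
  "translate a f = L2_of (\<lambda>x. rep_L2 f (x - a))"

definition modulate :: "'a::euclidean_space \<Rightarrow> 'a L2 \<Rightarrow> 'a L2" where
  "modulate \<xi> f = L2_of (\<lambda>x. cis (2 * pi * (\<xi> \<bullet> x)) * rep_L2 f x)"

definition dilate :: "real \<Rightarrow> (real^'n) L2 \<Rightarrow> (real^'n) L2" where
  "dilate r f = L2_of (\<lambda>x. complex_of_real (r powr (- (real CARD('n) / 2))) * rep_L2 f (inverse r *\<^sub>R x))"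

definition rho :: "real^'n^'n \<Rightarrow> (real^'n) L2 \<Rightarrow> (real^'n) L2" where
  "rho A f = L2_of (\<lambda>x. rep_L2 f (matrix_inv A *v x))"

section \<open>Fourier transform\<close>

definition fourier :: "('a::euclidean_space \<Rightarrow> complex) \<Rightarrow> 'a \<Rightarrow> complex" where
  "fourier f \<xi> = (LINT x|lborel. f x * cis (- (2 * pi * (x \<bullet> \<xi>))))"

definition inverse_fourier :: "('a::euclidean_space \<Rightarrow> complex) \<Rightarrow> 'a \<Rightarrow> complex" where
  "inverse_fourier f x = (LINT \<xi>|lborel. f \<xi> * cis (2 * pi * (x \<bullet> \<xi>)))"

text \<open>Plancherel: the integral formula on \<open>L\<^sup>1 \<inter> L\<^sup>2\<close> has a unique continuous extension
  to \<open>L\<^sup>2\<close>, and this extension is bijective.\<close>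

definition fourier_L2 :: "'a::euclidean_space L2 \<Rightarrow> 'a L2" where
  "fourier_L2 = (THE U. continuous_on UNIV U \<and>
     (\<forall>f. integrable lborel f \<and> square_integrable f \<longrightarrow>
        square_integrable (fourier f) \<and> U (L2_of f) = L2_of (fourier f)))"

definition inverse_fourier_L2 :: "'a::euclidean_space L2 \<Rightarrow> 'a L2" where
  "inverse_fourier_L2 = inv fourier_L2"

section \<open>Smooth functions\<close>

definition partial_deriv :: "'n \<Rightarrow> (real^'n \<Rightarrow> 'b::real_normed_vector) \<Rightarrow> real^'n \<Rightarrow> 'b" where
  "partial_deriv i f x = vector_derivative (\<lambda>t. f (x + t *\<^sub>R axis i 1)) (at 0)"

definition partial_derivs :: "'n list \<Rightarrow> (real^'n \<Rightarrow> 'b::real_normed_vector) \<Rightarrow> real^'n \<Rightarrow> 'b" where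
  "partial_derivs js f = foldr partial_deriv js f"

text \<open>Intended for open \<open>S\<close>. Differentiability of all iterated partial derivatives makes all of
  them continuous, so this is \<open>C\<^sup>\<infinity>(S)\<close>.\<close>

definition smooth_on :: "(real^'n) set \<Rightarrow> (real^'n \<Rightarrow> 'b::real_normed_vector) \<Rightarrow> bool" where
  "smooth_on S f \<longleftrightarrow> (\<forall>js. partial_derivs js f differentiable_on S)"

definition schwartz :: "(real^'n \<Rightarrow> 'b::real_normed_vector) \<Rightarrow> bool" where
  "schwartz f \<longleftrightarrow> smooth_on UNIV f \<and>
     (\<forall>js k. bounded (range (\<lambda>x. norm x ^ k *\<^sub>R partial_derivs js f x)))"

section \<open>Haar measure on the special orthogonal group\<close>

definition SO :: "(real^'n^'n) set" where
  "SO = {A. orthogonal_matrix A \<and> det A = 1}"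

definition normalized_haar_SO :: "(real^'n^'n) measure \<Rightarrow> bool" where
  "normalized_haar_SO \<mu> \<longleftrightarrow>
     space \<mu> = SO \<and> sets \<mu> = sets (restrict_space borel SO) \<and> emeasure \<mu> (space \<mu>) = 1 \<and>
     (\<forall>A\<in>SO. \<forall>X\<in>sets \<mu>. emeasure \<mu> ((\<lambda>B. A ** B) ` X) = emeasure \<mu> X)"

section \<open>Cubes\<close>

definition cube :: "real^'n \<Rightarrow> real \<Rightarrow> (real^'n) set" where
  "cube x r = {y. infnorm (x - y) \<le> r}"

text \<open>Sequences of non-degenerate cubes \<open>Q\<^sub>N = cube (x N) (r N)\<close> with
  \<open>2 Q\<^sub>N \<subseteq> Q\<^bsub>N+1\<^esub>\<close>.\<close>

definition cube_sequence :: "(nat \<Rightarrow> real^'n) \<Rightarrow> (nat \<Rightarrow> real) \<Rightarrow> bool" where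
  "cube_sequence x r \<longleftrightarrow>
     (\<forall>N. r N > 0 \<and> cube (x N) (2 * r N) \<subseteq> cube (x (Suc N)) (r (Suc N)))"

text \<open>The pair \<open>(\<nu>, m)\<close> encodes the dyadic cube \<open>Q\<^bsub>\<nu>m\<^esub>\<close>.\<close>

type_synonym 'n dyadic = "int \<times> (int^'n)"

fun dyadic_cube :: "'n dyadic \<Rightarrow> (real^'n) set" where
  "dyadic_cube (\<nu>, m) =
     {x. \<forall>j. x $ j \<in> {2 powi (- \<nu>) * of_int (m $ j) ..< 2 powi (- \<nu>) * (of_int (m $ j) + 1)}}"

fun dyadic_center :: "'n dyadic \<Rightarrow> real^'n" where
  "dyadic_center (\<nu>, m) = (\<chi> j. 2 powi (- \<nu>) * (of_int (m $ j) + 1 / 2))"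

fun dyadic_length :: "'n dyadic \<Rightarrow> real" where
  "dyadic_length (\<nu>, m) = 2 powi (- \<nu>)"

definition children :: "'n::finite dyadic \<Rightarrow> 'n dyadic set" where
  "children Q = {Q'. fst Q' = fst Q + 1 \<and> dyadic_cube Q' \<subseteq> dyadic_cube Q}"

text \<open>The labelling of the children by \<open>1, \<dots>, 2\<^sup>n\<close>, increasing for the lexicographic order
  of the centers; the order of the coordinates is the linear order on \<open>'n\<close>. The labelling is unique
  on \<open>{1..2\<^sup>n}\<close>; its values elsewhere are irrelevant.\<close>

definition child :: "'n::{finite,linorder} dyadic \<Rightarrow> nat \<Rightarrow> 'n dyadic" where
  "child Q = (SOME q. bij_betw q {1..2 ^ CARD('n)} (children Q) \<and>
     (\<forall>i\<in>{1..2 ^ CARD('n)}. \<forall>j\<in>{1..2 ^ CARD('n)}. i < j \<longrightarrow>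
        less_fun (($) (dyadic_center (q i))) (($) (dyadic_center (q j)))))"

section \<open>Tiles and the model operators\<close>

text \<open>A tile \<open>I \<times> \<omega>\<close> is encoded by the pair \<open>(I, \<omega>)\<close>.\<close>

definition tiles :: "('n::finite dyadic \<times> 'n dyadic) set" where
  "tiles = {(I, \<omega>). fst \<omega> = - fst I}"

definition wave_packet ::
  "(real^'n::{finite,linorder} \<Rightarrow> real) \<Rightarrow> 'n dyadic \<times> 'n dyadic \<Rightarrow> (real^'n::{finite,linorder}) L2" where
  "wave_packet \<Phi> s =
     modulate (dyadic_center (child (snd s) 1))
       (translate (dyadic_center (fst s))
         (dilate (dyadic_length (fst s))
           (L2_of (inverse_fourier (\<lambda>\<xi>. complex_of_real (\<Phi> \<xi>))))))"

definition model_op ::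
  "(real^'n::{finite,linorder} \<Rightarrow> real) \<Rightarrow> real^'n::{finite,linorder} \<Rightarrow> int \<Rightarrow> (real^'n::{finite,linorder}) L2 \<Rightarrow> (real^'n::{finite,linorder}) L2" where
  "model_op \<Phi> \<eta> l f =
     (\<Sum>\<^sub>\<infinity>s\<in>{s \<in> tiles. \<eta> \<in> dyadic_cube (child (snd s) (2 ^ CARD('n))) \<and>
           measure lborel (dyadic_cube (fst s)) = 2 powi (l * int CARD('n))}.
        cinner_L2 f (wave_packet \<Phi> s) *\<^sub>C wave_packet \<Phi> s)"

definition dyadic_sum :: "(real^'n \<Rightarrow> complex) \<Rightarrow> real^'n \<Rightarrow> complex" where
  "dyadic_sum m \<xi> = (\<Sum>\<^sub>\<infinity>l\<in>UNIV. m ((2 powi (l::int)) *\<^sub>R \<xi>))"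

end

theory Submission
  imports Defs "HOL-Probability.Characteristic_Functions"
begin

text \<open>On the Fourier side, for fixed \<open>l\<close> and \<open>\<eta>\<close> the packets are the exponentials of a Fourier series on a cube,
  damped by a translate of \<open>\<Phi>\<close>. Hence \<open>A\<^bsub>\<eta>,l\<^esub>\<close> is a contraction, which makes every average a Bochner integral,
  and the spectrum of \<open>M\<^bsub>-\<eta>\<^esub> A\<^bsub>\<eta>,l\<^esub> M\<^bsub>\<eta>\<^esub> f\<close> lies in \<open>2\<^bsup>-l\<^esup> [-17/20, -3/20]\<^sup>n\<close>. So \<open>m\<close> vanishes off that box
  (with \<open>l = 0\<close>), at most five of the terms \<open>m (2\<^sup>l \<xi>)\<close> are nonzero for each \<open>\<xi>\<close>, and the series over \<open>l\<close>
  converges to the Fourier multiplier \<open>M (2\<^bsup>-\<kappa>\<^esup> A \<xi>)\<close>. Testing against \<open>L\<^sup>2\<close> functions and Fubini's theorem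
  reduce the claim to the identity that defines \<open>\<alpha>\<close>.\<close>

section \<open>The Hilbert space \<open>L\<^sup>2\<close>\<close>

text \<open>The multiplier is known through L^2 limits of averages, so its support cannot be read
  off pointwise. Vanishing off the box is therefore stated as annihilation by a bounded linear
  operator, which passes through frame sums, Bochner integrals and limits. A test function whose
  Fourier transform is a Gaussian, hence without zeros, turns this into \<open>m = 0\<close> almost
  everywhere off the box, and continuity away from the origin removes the exceptional set. The box
  stays away from the origin, and this makes the rest uniform: \<open>m\<close>, set to 0 at the
  origin, is continuous and bounded by some \<open>C\<close>, and \<open>5 * C\<close> dominates
  every partial sum of the series over \<open>l\<close>. \<open>fourier_L2\<close> is a definite
  description, so it can be used once an extension of the integral formula is constructed and shown
  to be unique. Plancherel's identity and inversion are proved for this purpose, and identities on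
  L^2 are checked on the intersection with L^1 and extended by density.\<close>

lemma scaleC_L2_add_right: "c *\<^sub>C (f + g) = c *\<^sub>C f + c *\<^sub>C (g :: 'a::euclidean_space L2)"
  by transfer (auto simp: distrib_left intro: square_integrable_add square_integrable_mult)

lemma scaleC_L2_add_left: "(c + d) *\<^sub>C f = c *\<^sub>C f + d *\<^sub>C (f :: 'a::euclidean_space L2)"
  by transfer (auto simp: distrib_right intro: square_integrable_add square_integrable_mult)

lemma scaleC_scaleC_L2: "c *\<^sub>C d *\<^sub>C f = (c * d) *\<^sub>C (f :: 'a::euclidean_space L2)"
  by transfer (auto simp: mult.assoc intro: square_integrable_mult)

lemma scaleC_L2_of_real: "complex_of_real r *\<^sub>C f = r *\<^sub>R (f :: 'a::euclidean_space L2)"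
  by transfer (auto intro: square_integrable_mult)

lemma scaleC_L2_zero [simp]: "c *\<^sub>C 0 = (0 :: 'a::euclidean_space L2)"
  by transfer (auto intro: square_integrable_zero)

lemma scaleC_L2_zero_left [simp]: "0 *\<^sub>C f = (0 :: 'a::euclidean_space L2)"
  using scaleC_L2_of_real[of 0 f] by simp

lemma cinner_L2_scaleC_left: "cinner_L2 (c *\<^sub>C f) g = c * cinner_L2 f g"
  by transfer (simp add: mult.assoc)

lemma cinner_L2_scaleC_right: "cinner_L2 f (c *\<^sub>C g) = cnj c * cinner_L2 f g"
  by (subst (1 2) cinner_L2_commute) (simp add: cinner_L2_scaleC_left)

lemma cinner_L2_add_right: "cinner_L2 f (g + h) = cinner_L2 f g + cinner_L2 f h"
  by (subst (1 2 3) cinner_L2_commute) (simp add: cinner_L2_add_left)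

lemma cinner_L2_zero_left [simp]: "cinner_L2 0 f = 0"
  using cinner_L2_scaleC_left[of 0 0 f] by simp

lemma cinner_L2_zero_right [simp]: "cinner_L2 f 0 = 0"
  by (subst cinner_L2_commute) simp

lemma cinner_L2_diff_right: "cinner_L2 f (g - h) = cinner_L2 f g - cinner_L2 f h"
  using cinner_L2_add_right[of f "g - h" h] by (simp add: algebra_simps)

lemma cinner_L2_sum_left: "cinner_L2 (\<Sum>i\<in>I. f i) g = (\<Sum>i\<in>I. cinner_L2 (f i) g)"
  by (induction I rule: infinite_finite_induct) (simp_all add: cinner_L2_add_left)

lemma cinner_L2_sum_right: "cinner_L2 g (\<Sum>i\<in>I. f i) = (\<Sum>i\<in>I. cinner_L2 g (f i))"
  by (induction I rule: infinite_finite_induct) (simp_all add: cinner_L2_add_right)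

lemma cinner_L2_same: "cinner_L2 f f = complex_of_real ((norm f)\<^sup>2)"
proof -
  have "Im (cinner_L2 f f) = 0"
    using arg_cong[OF cinner_L2_commute[of f f], of Im] by simp
  then show ?thesis
    by (simp add: complex_eq_iff power2_norm_eq_inner inner_L2_def)
qed

text \<open>Since \<open>cnj \<i> = - \<i>\<close>, the imaginary part is the real inner product
  with \<open>\<i> *\<^sub>C g\<close>. Polarization and continuity of \<open>inner\<close> thus
  carry over to \<open>cinner_L2\<close>.\<close>

lemma cinner_L2_inner: "cinner_L2 f g = Complex (inner f g) (inner f (\<i> *\<^sub>C g))"
  by (simp add: complex_eq_iff inner_L2_def cinner_L2_scaleC_right)

lemma norm_scaleC_L2: "norm (c *\<^sub>C f) = cmod c * norm (f :: 'a::euclidean_space L2)"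
proof -
  have "complex_of_real ((norm (c *\<^sub>C f))\<^sup>2) = complex_of_real ((cmod c * norm f)\<^sup>2)"
    unfolding cinner_L2_same[symmetric] cinner_L2_scaleC_left cinner_L2_scaleC_right
    by (simp add: cinner_L2_same power_mult_distrib complex_norm_square[symmetric] mult.assoc[symmetric] mult.commute[of _ c])
  then have "(norm (c *\<^sub>C f))\<^sup>2 = (cmod c * norm f)\<^sup>2"
    by (simp only: of_real_eq_iff)
  then show ?thesis by (simp add: power2_eq_iff_nonneg)
qed

text \<open>A unimodular factor \<open>u\<close> makes the complex inner product real and
  nonnegative without changing \<open>norm f\<close>; the real Cauchy-Schwarz inequality then bounds
  the whole modulus and not just the real part.\<close>

lemma norm_cinner_L2_le: "cmod (cinner_L2 f g) \<le> norm f * norm g"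
proof (cases "cinner_L2 f g = 0")
  case False
  define u where "u = cnj (sgn (cinner_L2 f g))"
  have u: "cmod u = 1" using False by (simp add: u_def norm_sgn)
  have "cmod (cinner_L2 f g) = Re (u * cinner_L2 f g)"
  proof -
    have "u * cinner_L2 f g = complex_of_real (cmod (cinner_L2 f g))"
      using False complex_norm_square[of "cinner_L2 f g"]
      by (simp add: u_def sgn_eq power2_eq_square field_simps)
    then show ?thesis by simp
  qed
  also have "\<dots> = inner (u *\<^sub>C f) g" by (simp add: inner_L2_def cinner_L2_scaleC_left)
  also have "\<dots> \<le> norm (u *\<^sub>C f) * norm g" by (rule norm_cauchy_schwarz)
  finally show ?thesis by (simp add: norm_scaleC_L2 u)
qed simp

lemma cinner_L2_of:
  assumes "square_integrable f" "square_integrable g"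
  shows "cinner_L2 (L2_of f) (L2_of g) = (LINT x|lborel. f x * cnj (g x))"
  using assms by (simp add: L2_of_def cinner_L2.abs_eq)

lemma L2_eqI:
  assumes "\<And>h. inner f h = inner g h"
  shows "f = (g :: 'a::euclidean_space L2)"
proof -
  have "inner (f - g) (f - g) = 0" using assms[of "f - g"] by (simp only: inner_diff_left)
  then show ?thesis by simp
qed

lemma L2_of_zero: "L2_of (\<lambda>x. 0) = 0"
  using L2_of_diff[OF square_integrable_zero square_integrable_zero] by simp

lemma L2_of_cong_AE:
  assumes "square_integrable f" "square_integrable g" "AE x in lborel. f x = g x"
  shows "L2_of f = L2_of g"
  using assms by (simp add: L2_of_eq_iff)

lemma square_integrable_bound:
  assumes "square_integrable w" "g \<in> borel_measurable borel" "AE x in lborel. cmod (g x) \<le> cmod (w x)"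
  shows "square_integrable g"
proof -
  have "integrable lborel (\<lambda>x. (cmod (g x))\<^sup>2)"
    by (rule Bochner_Integration.integrable_bound[OF square_integrableD(3)[OF assms(1)]])
      (use assms in \<open>auto elim!: eventually_mono simp: power_mono\<close>)
  then show ?thesis using assms by (simp add: square_integrable_def)
qed

text \<open>The difference is at most \<open>2 * cmod (w x)\<close>, which gives the integrable
  majorant \<open>4 * (cmod (w x))\<^sup>2\<close> for its square. Truncation, translation,
  modulation, the tail of the series over \<open>l\<close> and the dependence on the rotation are
  all handled by this form of dominated convergence.\<close>

lemma tendsto_L2_of_dominated:
  fixes g :: "nat \<Rightarrow> 'a::euclidean_space \<Rightarrow> complex"
  assumes w: "square_integrable w"
    and g [measurable]: "\<And>j. g j \<in> borel_measurable borel" "g' \<in> borel_measurable borel"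
    and bound: "\<And>j. AE x in lborel. cmod (g j x) \<le> cmod (w x)"
    and lim: "AE x in lborel. (\<lambda>j. g j x) \<longlonglongrightarrow> g' x"
  shows "square_integrable g'" "(\<lambda>j. L2_of (g j)) \<longlonglongrightarrow> L2_of g'"
proof -
  note [measurable] = square_integrableD(2)[OF w]
  have sg: "square_integrable (g j)" for j
    by (rule square_integrable_bound[OF w _ bound]) simp
  have bound': "AE x in lborel. cmod (g' x) \<le> cmod (w x)"
  proof -
    have "AE x in lborel. \<forall>j. cmod (g j x) \<le> cmod (w x)"
      using bound by (simp add: AE_all_countable)
    with lim show ?thesis
    proof eventually_elim
      case (elim x)
      show ?case
        by (rule LIMSEQ_le_const2[OF tendsto_norm[OF elim(1)]]) (use elim in auto)
    qed
  qed
  show sg': "square_integrable g'"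
    by (rule square_integrable_bound[OF w _ bound']) simp
  have "(\<lambda>i. LINT x|lborel. (cmod (g i x - g' x))\<^sup>2) \<longlonglongrightarrow> (LINT x::'a|lborel. 0::real)"
  proof (rule integral_dominated_convergence[where w = "\<lambda>x. 4 * (cmod (w x))\<^sup>2"
        and s = "\<lambda>i x. (cmod (g i x - g' x))\<^sup>2" and f = "\<lambda>x. 0"])
    show "AE x in lborel. (\<lambda>i. (cmod (g i x - g' x))\<^sup>2) \<longlonglongrightarrow> 0"
      using lim by eventually_elim (auto intro!: tendsto_eq_intros)
    fix i
    show "AE x in lborel. norm ((cmod (g i x - g' x))\<^sup>2) \<le> 4 * (cmod (w x))\<^sup>2"
      using bound[of i] bound'
    proof eventually_elim
      case (elim x)
      have "cmod (g i x - g' x) \<le> 2 * cmod (w x)"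
        using norm_triangle_ineq4[of "g i x" "g' x"] elim by simp
      then have "(cmod (g i x - g' x))\<^sup>2 \<le> (2 * cmod (w x))\<^sup>2" by (rule power_mono) simp
      then show ?case by (simp add: power_mult_distrib)
    qed
  qed (use w in \<open>auto simp: square_integrable_def\<close>)
  then have "(\<lambda>i. sqrt (LINT x|lborel. (cmod (g i x - g' x))\<^sup>2)) \<longlonglongrightarrow> sqrt 0"
    by (intro tendsto_real_sqrt) simp
  moreover have "norm (L2_of (g i) - L2_of g') = sqrt (LINT x|lborel. (cmod (g i x - g' x))\<^sup>2)" for i
    by (simp only: L2_of_diff[OF sg sg'] norm_L2_of[OF square_integrable_diff[OF sg sg']])
  ultimately have "(\<lambda>i. norm (L2_of (g i) - L2_of g')) \<longlonglongrightarrow> 0" by simp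
  then show "(\<lambda>j. L2_of (g j)) \<longlonglongrightarrow> L2_of g'"
    by (simp add: tendsto_norm_zero_iff LIM_zero_iff)
qed

section \<open>Complex linear maps and isometries\<close>

definition L2_linear :: "('a::euclidean_space L2 \<Rightarrow> 'b::euclidean_space L2) \<Rightarrow> bool" where
  "L2_linear T \<longleftrightarrow> (\<forall>f g. T (f + g) = T f + T g) \<and> (\<forall>c f. T (c *\<^sub>C f) = c *\<^sub>C T f)"

lemma L2_linearD:
  assumes "L2_linear T"
  shows "T (f + g) = T f + T g" "T (c *\<^sub>C f) = c *\<^sub>C T f" "T (r *\<^sub>R f) = r *\<^sub>R T f" "T 0 = 0"
    "T (f - g) = T f - T g"
proof -
  show 1: "T (f + g) = T f + T g" "T (c *\<^sub>C f) = c *\<^sub>C T f" for f g c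
    using assms by (auto simp: L2_linear_def)
  show "T (r *\<^sub>R f) = r *\<^sub>R T f" using 1(2)[of "of_real r" f] by (simp add: scaleC_L2_of_real)
  show "T 0 = 0" using 1(2)[of 0 0] by simp
  show "T (f - g) = T f - T g" using 1(1)[of "f - g" g] by (simp add: algebra_simps)
qed

lemma L2_linear_sum: "L2_linear T \<Longrightarrow> T (\<Sum>i\<in>I. f i) = (\<Sum>i\<in>I. T (f i))"
  by (induction I rule: infinite_finite_induct) (simp_all add: L2_linearD)

lemma L2_linear_comp: "L2_linear S \<Longrightarrow> L2_linear T \<Longrightarrow> L2_linear (\<lambda>f. S (T f))"
  by (simp add: L2_linear_def)

lemma L2_linear_bounded:
  assumes "L2_linear T" "\<And>f. norm (T f) \<le> norm f * C"
  shows "bounded_linear T"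
  by (rule bounded_linear_intro[where K = C]) (simp_all add: L2_linearD[OF assms(1)] assms(2))

lemma bounded_linear_scaleC_L2: "bounded_linear (\<lambda>f::'a::euclidean_space L2. c *\<^sub>C f)"
  by (rule L2_linear_bounded[of _ "cmod c"])
    (auto simp: L2_linear_def scaleC_L2_add_right scaleC_scaleC_L2 norm_scaleC_L2 mult.commute)

definition L2_isometry :: "('a::euclidean_space L2 \<Rightarrow> 'b::euclidean_space L2) \<Rightarrow> bool" where
  "L2_isometry T \<longleftrightarrow> L2_linear T \<and> (\<forall>f. norm (T f) = norm f)"

lemma L2_isometryD:
  assumes "L2_isometry T"
  shows "L2_linear T" "norm (T f) = norm f" "bounded_linear T" "continuous_on A T"
proof -
  show 1: "L2_linear T" "norm (T f) = norm f" for f using assms by (auto simp: L2_isometry_def)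
  show "bounded_linear T" by (rule L2_linear_bounded[of _ 1]) (use 1 in auto)
  then show "continuous_on A T" by (rule linear_continuous_on)
qed

lemma L2_isometry_comp: "L2_isometry S \<Longrightarrow> L2_isometry T \<Longrightarrow> L2_isometry (\<lambda>f. S (T f))"
  by (simp add: L2_isometry_def L2_linear_comp)

text \<open>Polarization recovers \<open>inner\<close> from the norm, and complex homogeneity at
  \<open>\<i> *\<^sub>C g\<close> adds the imaginary part.\<close>

lemma L2_isometry_cinner:
  assumes "L2_isometry T"
  shows "cinner_L2 (T f) (T g) = cinner_L2 f g"
proof -
  note lin = L2_linearD[OF L2_isometryD(1)[OF assms]] and iso = L2_isometryD(2)[OF assms]
  have "inner (T f) (T g) = inner f g" for f g
    using iso[of "f + g"] iso[of f] iso[of g]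
    by (simp add: dot_norm lin(1)[symmetric])
  then show ?thesis by (simp add: cinner_L2_inner lin(2)[symmetric])
qed

lemma L2_isometry_inj: "L2_isometry T \<Longrightarrow> inj T"
proof (rule injI)
  fix f g assume T: "L2_isometry T" and "T f = T g"
  then have "norm (T (f - g)) = 0" by (simp add: L2_linearD[OF L2_isometryD(1)[OF T]])
  then show "f = g" by (simp add: L2_isometryD(2)[OF T])
qed

section \<open>Weighted substitutions\<close>

text \<open>The common form of translations, modulations, dilations, rotations and the reflection.
  The integral condition is the change of variables for nonnegative functions with Jacobian
  \<open>(cmod (w x))\<^sup>2\<close>; a weight without zeros lets null sets pull back to null
  sets.\<close>

definition isometric_subst :: "('a::euclidean_space \<Rightarrow> complex) \<Rightarrow> ('a \<Rightarrow> 'a) \<Rightarrow> bool" where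
  "isometric_subst w g \<longleftrightarrow> w \<in> borel_measurable borel \<and> g \<in> borel_measurable borel \<and> (\<forall>x. w x \<noteq> 0) \<and>
     (\<forall>F\<in>borel_measurable borel.
        (\<integral>\<^sup>+x. ennreal ((cmod (w x))\<^sup>2) * F (g x) \<partial>lborel) = (\<integral>\<^sup>+x. F x \<partial>lborel))"

definition subst_op :: "('a::euclidean_space \<Rightarrow> complex) \<Rightarrow> ('a \<Rightarrow> 'a) \<Rightarrow> 'a L2 \<Rightarrow> 'a L2" where
  "subst_op w g f = L2_of (\<lambda>x. w x * rep_L2 f (g x))"

context
  fixes w :: "'a::euclidean_space \<Rightarrow> complex" and g
  assumes wg: "isometric_subst w g"
begin

lemma isometric_substD:
  shows "w \<in> borel_measurable borel" "g \<in> borel_measurable borel" "w x \<noteq> 0"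
    "F \<in> borel_measurable borel \<Longrightarrow>
      (\<integral>\<^sup>+x. ennreal ((cmod (w x))\<^sup>2) * F (g x) \<partial>lborel) = (\<integral>\<^sup>+x. F x \<partial>lborel)"
  using wg by (auto simp: isometric_subst_def)

text \<open>For a null set \<open>N\<close>, the integral of the positive weight
  \<open>(cmod (w x))\<^sup>2\<close> over the preimage of \<open>N\<close> is the measure of
  \<open>N\<close>, that is 0. Hence \<open>subst_op\<close> does not depend on the
  representative.\<close>

lemma AE_subst:
  assumes "AE x in lborel. P x"
  shows "AE x in lborel. P (g x)"
proof -
  note [measurable] = isometric_substD(1,2)
  obtain N where N: "{x. \<not> P x} \<subseteq> N" "N \<in> sets borel" "emeasure lborel N = 0"
    using assms by (auto elim!: AE_E)
  note [measurable] = N(2)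
  have "(\<integral>\<^sup>+x. ennreal ((cmod (w x))\<^sup>2) * indicator N (g x) \<partial>lborel) = 0"
    using N by (subst isometric_substD(4)) auto
  then have "AE x in lborel. ennreal ((cmod (w x))\<^sup>2) * indicator N (g x) = 0"
    by (subst (asm) nn_integral_0_iff_AE) auto
  then show ?thesis
  proof eventually_elim
    case (elim x)
    then have "g x \<notin> N" using isometric_substD(3)[of x] by (auto simp: indicator_def split: if_splits)
    then show ?case using N(1) by auto
  qed
qed

lemma nn_integral_subst:
  assumes "square_integrable f"
  shows "(\<integral>\<^sup>+x. ennreal ((cmod (w x * f (g x)))\<^sup>2) \<partial>lborel) = (\<integral>\<^sup>+x. ennreal ((cmod (f x))\<^sup>2) \<partial>lborel)"
proof -
  note [measurable] = square_integrableD(2)[OF assms]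
  show ?thesis
    by (subst isometric_substD(4)[symmetric]) (simp_all add: norm_mult power_mult_distrib ennreal_mult)
qed

lemma square_integrable_subst:
  assumes "square_integrable f"
  shows "square_integrable (\<lambda>x. w x * f (g x))"
proof -
  note [measurable] = square_integrableD(2)[OF assms] isometric_substD(1,2)
  have "(\<lambda>x. w x * f (g x)) \<in> borel_measurable borel" by measurable
  then show ?thesis
    using assms nn_integral_subst[OF assms] by (simp add: square_integrable_iff_nn_integral)
qed

lemma subst_op_L2_of:
  assumes "square_integrable f"
  shows "subst_op w g (L2_of f) = L2_of (\<lambda>x. w x * f (g x))"
  unfolding subst_op_def
  using AE_subst[OF rep_L2_of[OF assms]]
  by (intro L2_of_cong_AE square_integrable_subst assms square_integrable_rep_L2)
     (auto elim: eventually_mono)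

lemma L2_isometry_subst_op: "L2_isometry (subst_op w g)"
proof -
  have "subst_op w g (L2_of u + L2_of v) = subst_op w g (L2_of u) + subst_op w g (L2_of v)"
    if "square_integrable u" "square_integrable v" for u v
    by (simp only: L2_of_add that subst_op_L2_of square_integrable_subst square_integrable_add distrib_left)
  from this[OF square_integrable_rep_L2 square_integrable_rep_L2]
  have add: "subst_op w g (f + h) = subst_op w g f + subst_op w g h" for f h
    by simp
  have "subst_op w g (c *\<^sub>C L2_of u) = c *\<^sub>C subst_op w g (L2_of u)"
    if "square_integrable u" for u c
    by (simp only: L2_of_mult that subst_op_L2_of square_integrable_subst square_integrable_mult mult.left_commute)
  from this[OF square_integrable_rep_L2]
  have scale: "subst_op w g (c *\<^sub>C f) = c *\<^sub>C subst_op w g f" for f c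
    by simp
  have "norm (subst_op w g (L2_of u)) = norm (L2_of u)" if "square_integrable u" for u
  proof -
    have "norm (L2_of v) = sqrt (enn2real (\<integral>\<^sup>+x. ennreal ((cmod (v x))\<^sup>2) \<partial>lborel))"
      if "square_integrable v" for v :: "'a \<Rightarrow> complex"
      using that by (subst norm_L2_of) (auto simp: integral_eq_nn_integral square_integrable_def)
    then show ?thesis
      using that by (simp add: subst_op_L2_of square_integrable_subst nn_integral_subst)
  qed
  from this[OF square_integrable_rep_L2]
  have "norm (subst_op w g f) = norm f" for f by simp
  with add scale show ?thesis by (simp add: L2_isometry_def L2_linear_def)
qed

end

lemma isometric_subst_translate: "isometric_subst (\<lambda>x. 1) (\<lambda>x. x - a)"
proof -
  have "(\<integral>\<^sup>+x. F (x - a) \<partial>lborel) = (\<integral>\<^sup>+x. F x \<partial>lborel)"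
    if [measurable]: "F \<in> borel_measurable borel" for F :: "'a \<Rightarrow> ennreal"
    by (subst (2) lborel_distr_plus[of "-a", symmetric]) (simp add: nn_integral_distr)
  then show ?thesis by (simp add: isometric_subst_def)
qed

lemma isometric_subst_modulate: "isometric_subst (\<lambda>x. cis (2 * pi * (\<xi> \<bullet> x))) (\<lambda>x. x)"
proof -
  have "(\<lambda>x. cis (2 * pi * (\<xi> \<bullet> x))) \<in> borel_measurable borel"
    by (intro borel_measurable_continuous_onI continuous_intros)
  then show ?thesis by (simp add: isometric_subst_def)
qed

lemma nn_integral_lborel_scale:
  fixes F :: "'a::euclidean_space \<Rightarrow> ennreal"
  assumes [measurable]: "F \<in> borel_measurable borel" and "c \<noteq> 0"
  shows "ennreal (\<bar>c\<bar> ^ DIM('a)) * (\<integral>\<^sup>+x. F (c *\<^sub>R x) \<partial>lborel) = (\<integral>\<^sup>+x. F x \<partial>lborel)"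
  using assms by (subst (2) lborel_affine[of c 0])
    (auto simp: nn_integral_density nn_integral_distr nn_integral_cmult)

lemma isometric_subst_dilate:
  assumes "r > 0"
  shows "isometric_subst (\<lambda>x::real^'n. complex_of_real (r powr (- (real CARD('n) / 2)))) (\<lambda>x. inverse r *\<^sub>R x)"
proof -
  have sq: "(cmod (complex_of_real (r powr (- (real CARD('n) / 2)))))\<^sup>2 = \<bar>inverse r\<bar> ^ DIM(real^'n)"
  proof -
    have "(cmod (complex_of_real (r powr (- (real CARD('n) / 2)))))\<^sup>2 = r powr (- real CARD('n))"
      by (simp only: norm_of_real power2_abs) (simp add: power2_eq_square flip: powr_add)
    then show ?thesis using assms by (simp add: powr_minus powr_realpow power_inverse)
  qed
  have "(\<integral>\<^sup>+x. ennreal (\<bar>inverse r\<bar> ^ DIM(real^'n)) * F (inverse r *\<^sub>R x) \<partial>lborel) = (\<integral>\<^sup>+x. F x \<partial>lborel)"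
    if [measurable]: "F \<in> borel_measurable borel" for F :: "real^'n \<Rightarrow> ennreal"
    using assms nn_integral_lborel_scale[OF that, of "inverse r"] by (simp add: nn_integral_cmult)
  then show ?thesis using assms unfolding isometric_subst_def sq by auto
qed

lemma nn_integral_lborel_translate:
  fixes F :: "'a::euclidean_space \<Rightarrow> ennreal"
  assumes [measurable]: "F \<in> borel_measurable borel"
  shows "(\<integral>\<^sup>+x. F (a + x) \<partial>lborel) = (\<integral>\<^sup>+x. F x \<partial>lborel)"
  by (subst (2) lborel_distr_plus[of a, symmetric]) (simp add: nn_integral_distr)

text \<open>\<open>Change_Of_Vars\<close> needs a well-ordered index type. Integrating \<open>F (A x) b (y - A x)\<close>, with \<open>b\<close> the
  indicator of a ball, over \<open>x\<close> and \<open>y\<close> in both orders needs translation invariance only.\<close>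

lemma nn_integral_lborel_orthogonal:
  fixes A :: "real^'n^'n" and F :: "real^'n \<Rightarrow> ennreal"
  assumes A: "orthogonal_matrix A" and F [measurable]: "F \<in> borel_measurable borel"
  shows "(\<integral>\<^sup>+x. F (A *v x) \<partial>lborel) = (\<integral>\<^sup>+x. F x \<partial>lborel)"
proof -
  have [measurable]: "(\<lambda>x. A *v x) \<in> borel_measurable borel"
    by (intro borel_measurable_continuous_onI matrix_vector_mult_linear_continuous_on)
  have nrm: "norm (A *v x) = norm x" for x
    using orthogonal_transformation_norm[of "(*v) A" x] A
    by (simp add: orthogonal_transformation_matrix matrix_of_matrix_vector_mul)
  have inv: "A *v (transpose A *v y) = y" for y
    using A by (simp add: orthogonal_matrix_def matrix_vector_mul_assoc del: transpose_matrix_vector)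
  define b :: "real^'n \<Rightarrow> ennreal" where "b = indicator (ball 0 1)"
  have [measurable]: "b \<in> borel_measurable borel"
    unfolding b_def by (rule borel_measurable_indicator) simp
  define V where "V = (\<integral>\<^sup>+x. b x \<partial>lborel)"
  have "V = emeasure lborel (ball (0::real^'n) 1)" by (simp add: V_def b_def)
  moreover have "emeasure lborel (ball (0::real^'n) 1) \<noteq> 0"
    using content_ball_pos[of 1 "0::real^'n"] by (auto simp: measure_def)
  ultimately have V: "V \<noteq> 0" "V \<noteq> \<infinity>"
    using emeasure_lborel_ball_finite[of "0::real^'n" 1] by auto
  have "(\<integral>\<^sup>+x. F (A *v x) \<partial>lborel) * V = (\<integral>\<^sup>+x. F (A *v x) * (\<integral>\<^sup>+y. b (- (A *v x) + y) \<partial>lborel) \<partial>lborel)"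
    by (subst nn_integral_lborel_translate) (simp_all add: V_def nn_integral_multc)
  also have "\<dots> = (\<integral>\<^sup>+x. (\<integral>\<^sup>+y. F (A *v x) * b (- (A *v x) + y) \<partial>lborel) \<partial>lborel)"
    by (intro nn_integral_cong nn_integral_cmult[symmetric]) simp
  also have "\<dots> = (\<integral>\<^sup>+y. (\<integral>\<^sup>+x. F (A *v x) * b (- (A *v x) + y) \<partial>lborel) \<partial>lborel)"
    by (rule lborel_pair.Fubini') simp
  \<comment> \<open>Shifting \<open>x\<close> by the preimage \<open>transpose A *v y\<close> of
    \<open>y\<close> turns \<open>A *v x\<close> into \<open>y + A *v x\<close>, so \<open>b\<close>
    is left with \<open>- (A *v x)\<close>, which has the norm of \<open>x\<close>.\<close>
  also have "\<dots> = (\<integral>\<^sup>+y. (\<integral>\<^sup>+x. F (A *v (transpose A *v y + x)) * b (- (A *v (transpose A *v y + x)) + y) \<partial>lborel) \<partial>lborel)"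
    by (intro nn_integral_cong nn_integral_lborel_translate[symmetric]) simp
  also have "\<dots> = (\<integral>\<^sup>+y. (\<integral>\<^sup>+x. F (A *v x + y) * b x \<partial>lborel) \<partial>lborel)"
    by (intro nn_integral_cong)
      (simp add: matrix_vector_right_distrib inv b_def indicator_def nrm add.commute del: transpose_matrix_vector)
  also have "\<dots> = (\<integral>\<^sup>+x. (\<integral>\<^sup>+y. F (A *v x + y) * b x \<partial>lborel) \<partial>lborel)"
    by (rule lborel_pair.Fubini') simp
  also have "\<dots> = (\<integral>\<^sup>+x. (\<integral>\<^sup>+y. F y \<partial>lborel) * b x \<partial>lborel)"
    by (simp add: nn_integral_multc nn_integral_lborel_translate)
  also have "\<dots> = (\<integral>\<^sup>+y. F y \<partial>lborel) * V"
    by (simp add: nn_integral_cmult V_def)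
  finally show ?thesis
    using V by (simp add: mult.commute[of _ V] ennreal_mult_cancel_left)
qed

lemma isometric_subst_orthogonal:
  assumes "orthogonal_matrix (A :: real^'n^'n)"
  shows "isometric_subst (\<lambda>x. 1) (\<lambda>x. A *v x)"
proof -
  have m[measurable]: "(\<lambda>x. A *v x) \<in> borel_measurable borel"
    by (intro borel_measurable_continuous_onI matrix_vector_mult_linear_continuous_on)
  show ?thesis by (simp add: isometric_subst_def nn_integral_lborel_orthogonal[OF assms])
qed

section \<open>Plancherel on \<open>L\<^sup>1 \<inter> L\<^sup>2\<close>\<close>

lemma translate_eq_subst: "translate a = subst_op (\<lambda>x. 1) (\<lambda>x. x - a)"
  by (simp add: fun_eq_iff translate_def subst_op_def)

lemma modulate_eq_subst: "modulate \<xi> = subst_op (\<lambda>x. cis (2 * pi * (\<xi> \<bullet> x))) (\<lambda>x. x)"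
  by (simp add: fun_eq_iff modulate_def subst_op_def)

lemma dilate_eq_subst:
  "dilate r = subst_op (\<lambda>x::real^'n. complex_of_real (r powr (- (real CARD('n) / 2)))) (\<lambda>x. inverse r *\<^sub>R x)"
  by (simp add: fun_eq_iff dilate_def subst_op_def)

lemma rho_eq_subst: "rho A = subst_op (\<lambda>x. 1) (\<lambda>x. matrix_inv A *v x)"
  by (simp add: fun_eq_iff rho_def subst_op_def)

lemma L2_isometry_translate: "L2_isometry (translate a)"
  unfolding translate_eq_subst by (intro L2_isometry_subst_op isometric_subst_translate)

lemma L2_isometry_modulate: "L2_isometry (modulate \<xi>)"
  unfolding modulate_eq_subst by (intro L2_isometry_subst_op isometric_subst_modulate)

lemma L2_isometry_dilate: "r > 0 \<Longrightarrow> L2_isometry (dilate r)"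
  unfolding dilate_eq_subst by (intro L2_isometry_subst_op isometric_subst_dilate)

lemma L2_of_translate: "square_integrable f \<Longrightarrow> translate a (L2_of f) = L2_of (\<lambda>x. f (x - a))"
  unfolding translate_eq_subst by (subst subst_op_L2_of[OF isometric_subst_translate]) auto

lemma square_integrable_translate: "square_integrable f \<Longrightarrow> square_integrable (\<lambda>x. f (x - a))"
  using square_integrable_subst[OF isometric_subst_translate] by fastforce

lemma square_integrable_bounded_support:
  fixes f :: "'a::euclidean_space \<Rightarrow> complex"
  assumes [measurable]: "f \<in> borel_measurable borel"
    and "\<And>x. cmod (f x) \<le> C" "\<And>x. norm x > R \<Longrightarrow> f x = 0"
  shows "square_integrable f"
proof -
  have C: "C \<ge> 0" using assms(2)[of 0] norm_ge_zero order_trans by blast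
  have "square_integrable (\<lambda>x::'a. complex_of_real C * indicator (cball 0 R) x)"
    using emeasure_lborel_cball_finite[of "0::'a" R] by (intro square_integrable_indicator) auto
  then show ?thesis
    by (rule square_integrable_bound) (use assms C in \<open>auto simp: indicator_def not_le\<close>)
qed

section \<open>Density of continuous functions of bounded support, and strong continuity of
  translations\<close>

definition compactly_supported_L2 :: "'a::euclidean_space L2 set" where
  "compactly_supported_L2 = {L2_of g |g. continuous_on UNIV g \<and> (\<exists>R. \<forall>x. norm x > R \<longrightarrow> g x = 0)}"

lemma square_integrable_continuous_support:
  fixes g :: "'a::euclidean_space \<Rightarrow> complex"
  assumes "continuous_on UNIV g" "\<And>x. norm x > R \<Longrightarrow> g x = 0"
  obtains C where "\<And>x. cmod (g x) \<le> C" "square_integrable g"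
proof -
  have "compact (g ` cball 0 R)"
    by (intro compact_continuous_image continuous_on_subset[OF assms(1)]) auto
  then obtain C where C: "\<And>x. norm x \<le> R \<Longrightarrow> cmod (g x) \<le> C"
    using compact_imp_bounded by (force simp: bounded_iff)
  have "cmod (g x) \<le> max C 0" for x
    using C[of x] assms(2)[of x] by (cases "norm x \<le> R") auto
  moreover have "g \<in> borel_measurable borel" by (rule borel_measurable_continuous_onI[OF assms(1)])
  ultimately show ?thesis
    using that square_integrable_bounded_support[of g] assms(2) by blast
qed

text \<open>A bounded \<open>f\<close> of bounded support is an almost everywhere limit of
  continuous functions; clamping their values and cutting them off gives a common majorant without
  disturbing the limit. Truncation in space and in size reduces the general case to this
  one.\<close>

lemma closure_compactly_supported_L2: "closure compactly_supported_L2 = (UNIV :: 'a::euclidean_space L2 set)"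
proof -
  have step1: "L2_of f \<in> closure compactly_supported_L2"
    if f [measurable]: "f \<in> borel_measurable borel" and R: "R \<ge> 1" "\<And>x. cmod (f x) \<le> R" "\<And>x. norm x > R \<Longrightarrow> f x = 0"
    for f :: "'a \<Rightarrow> complex" and R
  proof -
    have "f measurable_on UNIV"
      using f by (subst measurable_on_iff_borel_measurable)
        (auto simp: lebesgue_on_UNIV_eq intro!: measurable_completion)
    then obtain N g where N: "negligible N" and g: "\<And>n. continuous_on UNIV (g n)"
      "\<And>x. x \<notin> N \<Longrightarrow> (\<lambda>n. g n x) \<longlonglongrightarrow> f x"
      by (auto simp: measurable_on_def)
    \<comment> \<open>The radial retraction onto the disc of radius \<open>R\<close>: continuous,
      bounded by \<open>R\<close>, and the identity at the values of \<open>f\<close>.\<close>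
    define clamp where "clamp w = w / complex_of_real (max 1 (cmod w / R))" for w
    define \<theta> where "\<theta> x = complex_of_real (max 0 (min 1 (R + 1 - norm x)))" for x :: 'a
    have clamp_cont: "isCont clamp w" for w
      unfolding clamp_def using R by (intro continuous_intros) auto
    have clamp_le: "cmod (clamp w) \<le> R" for w
      using R by (simp add: clamp_def norm_divide divide_simps max_def)
    have clamp_id: "clamp w = w" if "cmod w \<le> R" for w
      using R that by (simp add: clamp_def max_def divide_simps)
    have \<theta>: "cmod (\<theta> x) \<le> 1" "norm x \<le> R \<Longrightarrow> \<theta> x = 1" "norm x > R + 1 \<Longrightarrow> \<theta> x = 0" "continuous_on UNIV \<theta>" for x
      unfolding \<theta>_def by (auto intro!: continuous_intros)
    define \<psi> where "\<psi> n x = \<theta> x * clamp (g n x)" for n x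
    have cont: "continuous_on UNIV (\<psi> n)" for n
      unfolding \<psi>_def using clamp_cont
      by (intro continuous_on_mult \<theta>(4) continuous_on_compose2[OF _ g(1), of UNIV clamp])
        (auto simp: continuous_on_eq_continuous_at)
    have supp: "\<psi> n x = 0" if "norm x > R + 1" for n x using \<theta>(3) that by (simp add: \<psi>_def)
    have bnd: "cmod (\<psi> n x) \<le> R" for n x
      unfolding \<psi>_def norm_mult using mult_mono[OF \<theta>(1) clamp_le] R by simp
    have dom: "square_integrable (\<lambda>x::'a. complex_of_real R * indicator (cball 0 (R+1)) x)"
      using emeasure_lborel_cball_finite[of "0::'a" "R+1"] by (intro square_integrable_indicator) auto
    have lim: "AE x in lborel. (\<lambda>n. \<psi> n x) \<longlonglongrightarrow> f x"
    proof -
      have "AE x in lebesgue. x \<notin> N"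
        using N by (intro AE_not_in) (simp add: negligible_iff_null_sets)
      then have "AE x in lborel. x \<notin> N" by (simp add: AE_completion_iff)
      then show ?thesis
      proof eventually_elim
        case (elim x)
        have "(\<lambda>n. \<psi> n x) \<longlonglongrightarrow> \<theta> x * clamp (f x)"
          unfolding \<psi>_def by (intro tendsto_intros isCont_tendsto_compose[OF clamp_cont] g elim)
        also have "\<theta> x * clamp (f x) = f x"
          using \<theta>(2)[of x] R(2)[of x] R(3)[of x] clamp_id[of "f x"] R(1) by (cases "norm x \<le> R") auto
        finally show ?case .
      qed
    qed
    have meas: "\<psi> n \<in> borel_measurable borel" for n
      by (rule borel_measurable_continuous_onI[OF cont])
    have bound: "AE x in lborel. cmod (\<psi> n x) \<le> cmod (complex_of_real R * indicator (cball 0 (R+1)) x)" for n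
      using bnd supp R(1) by (auto simp: indicator_def not_le intro!: AE_I2)
    have "(\<lambda>n. L2_of (\<psi> n)) \<longlonglongrightarrow> L2_of f"
      by (rule tendsto_L2_of_dominated(2)[OF dom meas f bound lim])
    moreover have "L2_of (\<psi> n) \<in> compactly_supported_L2" for n
      unfolding compactly_supported_L2_def using cont supp by blast
    ultimately show ?thesis
      unfolding closure_sequential by (intro exI[of _ "\<lambda>n. L2_of (\<psi> n)"] conjI allI)
  qed
  have "h \<in> closure compactly_supported_L2" for h :: "'a L2"
  proof -
    define f where "f = rep_L2 h"
    have f: "square_integrable f" by (simp add: f_def square_integrable_rep_L2)
    note [measurable] = square_integrableD(2)[OF f]
    \<comment> \<open>The radius \<open>real n + 1\<close> meets the condition
      \<open>R \<ge> 1\<close> of \<open>step1\<close> also for \<open>n = 0\<close>.\<close>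
    define u where "u n x = (if norm x \<le> real n + 1 \<and> cmod (f x) \<le> real n + 1 then f x else 0)" for n x
    have [measurable]: "u n \<in> borel_measurable borel" for n unfolding u_def by measurable
    have cl: "L2_of (u n) \<in> closure compactly_supported_L2" for n
      by (rule step1[of _ "real n + 1"]) (auto simp: u_def)
    have "(\<lambda>n. L2_of (u n)) \<longlonglongrightarrow> L2_of f"
    proof (rule tendsto_L2_of_dominated(2)[OF f])
      have "(\<lambda>n. u n x) \<longlonglongrightarrow> f x" for x
      proof (rule tendsto_eventually)
        obtain n0 :: nat where n0: "real n0 \<ge> norm x + cmod (f x)" using real_arch_simple by blast
        then show "\<forall>\<^sub>F n in sequentially. u n x = f x"
          unfolding eventually_sequentially
        proof (intro exI[of _ n0] allI impI)
          fix n assume "n0 \<le> n"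
          then have "norm x + cmod (f x) \<le> real n" using n0 by simp
          then show "u n x = f x"
            using norm_ge_zero[of x] norm_ge_zero[of "f x"] unfolding u_def by (intro if_P conjI) linarith+
        qed
      qed
      then show "AE x in lborel. (\<lambda>n. u n x) \<longlonglongrightarrow> f x" by simp
    qed (auto simp: u_def)
    then have "L2_of f \<in> closure compactly_supported_L2"
      by (rule closed_sequentially[OF closed_closure cl])
    then show ?thesis by (simp add: f_def)
  qed
  then show ?thesis by blast
qed

text \<open>Linear isometries share the Lipschitz constant 1, so convergence on \<open>C\<close>
  spreads to the closure by a three-epsilon argument.\<close>

lemma isometry_tendsto_closure:
  fixes T :: "nat \<Rightarrow> 'a::euclidean_space L2 \<Rightarrow> 'a L2"
  assumes T: "\<And>n. L2_isometry (T n)" and C: "\<And>g. g \<in> C \<Longrightarrow> (\<lambda>n. T n g) \<longlonglongrightarrow> g" and f: "f \<in> closure C"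
  shows "(\<lambda>n. T n f) \<longlonglongrightarrow> f"
proof (rule metric_LIMSEQ_I)
  fix r :: real assume "r > 0"
  then obtain g where g: "g \<in> C" "dist g f < r / 3"
    using f by (auto simp: closure_approachable dest: spec[of _ "r / 3"])
  obtain N where N: "\<And>n. n \<ge> N \<Longrightarrow> dist (T n g) g < r / 3"
    using metric_LIMSEQ_D[OF C[OF g(1)], of "r / 3"] \<open>r > 0\<close> by auto
  have "dist (T n f) f < r" if "n \<ge> N" for n
  proof -
    have "dist (T n f) (T n g) = dist f g"
      by (metis L2_isometryD(1,2)[OF T] L2_linearD(5) dist_norm)
    then show ?thesis
      using N[OF that] g(2) dist_triangle[of "T n f" f "T n g"] dist_triangle[of "T n g" f g]
      by (simp add: dist_commute)
  qed
  then show "\<exists>no. \<forall>n\<ge>no. dist (T n f) f < r" by blast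
qed

text \<open>Translates of a continuous function of bounded support converge pointwise under one
  majorant, because a convergent \<open>z\<close> is bounded; density does the rest. This gives the
  continuity of the autocorrelation at the origin.\<close>

lemma tendsto_translate_L2:
  fixes f :: "'a::euclidean_space L2"
  assumes z: "z \<longlonglongrightarrow> 0"
  shows "(\<lambda>n. translate (z n) f) \<longlonglongrightarrow> f"
proof (rule isometry_tendsto_closure[OF L2_isometry_translate, of compactly_supported_L2])
  fix h :: "'a L2" assume "h \<in> compactly_supported_L2"
  then obtain g R where g: "h = L2_of g" "continuous_on UNIV g" "\<And>x. norm x > R \<Longrightarrow> g x = 0"
    by (auto simp: compactly_supported_L2_def)
  obtain C where C: "\<And>x. cmod (g x) \<le> C" "square_integrable g"
    using square_integrable_continuous_support[OF g(2,3)] by metis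
  have C0: "C \<ge> 0" using C(1)[of 0] norm_ge_zero order_trans by blast
  obtain B where B: "\<And>n. norm (z n) \<le> B"
    using convergent_imp_bounded[OF z] by (auto simp: bounded_iff)
  have gm [measurable]: "g \<in> borel_measurable borel" by (rule borel_measurable_continuous_onI[OF g(2)])
  have "(\<lambda>n. L2_of (\<lambda>x. g (x - z n))) \<longlonglongrightarrow> L2_of g"
  proof (rule tendsto_L2_of_dominated(2))
    show "square_integrable (\<lambda>x::'a. complex_of_real C * indicator (cball 0 (R + B)) x)"
      using emeasure_lborel_cball_finite[of "0::'a" "R + B"] by (intro square_integrable_indicator) auto
    fix j
    have "g (x - z j) = 0" if "norm x > R + B" for x
    proof (rule g(3))
      show "norm (x - z j) > R" using that B[of j] norm_triangle_ineq2[of x "z j"] by linarith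
    qed
    then show "AE x in lborel. cmod (g (x - z j)) \<le> cmod (complex_of_real C * indicator (cball 0 (R + B)) x)"
      using C C0 by (auto simp: indicator_def not_le intro!: AE_I2)
  next
    have "(\<lambda>n. g (x - z n)) \<longlonglongrightarrow> g x" for x
      using g(2) by (intro isCont_tendsto_compose[of _ g]) (auto simp: continuous_on_eq_continuous_at intro!: tendsto_eq_intros z)
    then show "AE x in lborel. (\<lambda>n. g (x - z n)) \<longlonglongrightarrow> g x" by simp
  qed (auto)
  then show "(\<lambda>n. translate (z n) h) \<longlonglongrightarrow> h" by (simp add: g(1) L2_of_translate C(2))
qed (simp add: closure_compactly_supported_L2)

section \<open>The Fourier integral and the autocorrelation\<close>

lemma borel_measurable_cis [measurable (raw)]:
  "f \<in> borel_measurable M \<Longrightarrow> (\<lambda>x. cis (f x)) \<in> borel_measurable M"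
  by (intro borel_measurable_continuous_on[of cis] continuous_intros)

lemma integrable_fourier_integrand:
  fixes f :: "'a::euclidean_space \<Rightarrow> complex"
  assumes "integrable lborel f"
  shows "integrable lborel (\<lambda>x. f x * cis (- (2 * pi * (x \<bullet> \<xi>))))"
  by (rule Bochner_Integration.integrable_bound[OF assms])
    (use borel_measurable_integrable[OF assms] in \<open>auto simp: norm_mult\<close>)

lemma borel_measurable_fourier [measurable]:
  fixes f :: "'a::euclidean_space \<Rightarrow> complex"
  assumes [measurable]: "f \<in> borel_measurable borel"
  shows "fourier f \<in> borel_measurable borel"
  unfolding fourier_def[abs_def] by (rule lborel.borel_measurable_lebesgue_integral) measurable

lemma norm_fourier_le:
  fixes f :: "'a::euclidean_space \<Rightarrow> complex"
  shows "cmod (fourier f \<xi>) \<le> (LINT x|lborel. cmod (f x))"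
  unfolding fourier_def by (rule order_trans[OF integral_norm_bound]) (simp add: norm_mult)

lemma integrable_lborel_product:
  fixes f :: "'a::euclidean_space \<Rightarrow> complex" and g :: "'b::euclidean_space \<Rightarrow> complex"
  assumes f: "integrable lborel f" and g: "integrable lborel g"
    and k [measurable]: "case_prod k \<in> borel_measurable (borel \<Otimes>\<^sub>M borel)" and "\<And>x y. cmod (k x y) = 1"
  shows "integrable (lborel \<Otimes>\<^sub>M lborel) (\<lambda>(x, y). f x * g y * k x y)"
proof -
  note [measurable] = borel_measurable_integrable[OF f, simplified] borel_measurable_integrable[OF g, simplified]
  have k' [measurable]: "(\<lambda>y. k x y) \<in> borel_measurable borel" for x
    using measurable_Pair2[OF k, of x] by simp
  show ?thesis
  proof (rule lborel_pair.Fubini_integrable)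
    have "(\<lambda>x. LINT y|lborel. cmod (case (x, y) of (x, y) \<Rightarrow> f x * g y * k x y))
        = (\<lambda>x. cmod (f x) * (LINT y|lborel. cmod (g y)))"
      by (simp add: norm_mult assms(4))
    then show "integrable lborel (\<lambda>x. LINT y|lborel. cmod (case (x, y) of (x, y) \<Rightarrow> f x * g y * k x y))"
      using f by simp
    have "integrable lborel (\<lambda>y. f x * g y * k x y)" for x
      by (rule Bochner_Integration.integrable_bound[of _ "\<lambda>y. f x * g y"])
        (use g in \<open>auto simp: norm_mult assms(4)\<close>)
    then show "AE x in lborel. integrable lborel (\<lambda>y. case (x, y) of (x, y) \<Rightarrow> f x * g y * k x y)" by simp
  qed measurable
qed

text \<open>The kernel \<open>cis (- (2 * pi * (x \<bullet> y)))\<close> is symmetric in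
  \<open>x\<close> and \<open>y\<close>, so Fubini's theorem moves the transform from one factor to
  the other.\<close>

lemma fourier_multiplication_formula:
  fixes f g :: "'a::euclidean_space \<Rightarrow> complex"
  assumes f: "integrable lborel f" and g: "integrable lborel g"
  shows "(LINT \<xi>|lborel. fourier f \<xi> * g \<xi>) = (LINT x|lborel. f x * fourier g x)"
proof -
  have "integrable (lborel \<Otimes>\<^sub>M lborel) (\<lambda>(x, y). f x * g y * cis (- (2 * pi * (x \<bullet> y))))"
    by (rule integrable_lborel_product[OF f g]) auto
  from lborel_pair.Fubini_integral[OF this]
  have "(LINT y|lborel. LINT x|lborel. f x * g y * cis (- (2 * pi * (x \<bullet> y))))
      = (LINT x|lborel. LINT y|lborel. f x * g y * cis (- (2 * pi * (x \<bullet> y))))" by simp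
  moreover have "fourier f y * g y = (LINT x|lborel. f x * g y * cis (- (2 * pi * (x \<bullet> y))))" for y
    unfolding fourier_def by (subst integral_mult_left_zero[symmetric]) (simp add: mult_ac)
  moreover have "f x * fourier g x = (LINT y|lborel. f x * g y * cis (- (2 * pi * (x \<bullet> y))))" for x
    unfolding fourier_def by (subst integral_mult_right_zero[symmetric]) (simp add: mult_ac inner_commute[of x])
  ultimately show ?thesis by simp
qed

lemma distr_lborel_reflect: "distr lborel borel (\<lambda>z. x - z) = (lborel :: 'a::euclidean_space measure)"
  using lborel_affine[of "-1::real" x] by (simp add: density_1)

text \<open>\<open>h\<close> is the convolution of \<open>f\<close> with the function
  \<open>cnj (f (- x))\<close> of \<open>x\<close>. Under Fubini's theorem, replacing
  \<open>z\<close> by \<open>x - z\<close> splits the exponential into one factor for each function,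
  and these give \<open>fourier f \<xi>\<close> and its conjugate.\<close>

lemma fourier_autocorrelation:
  fixes f :: "'a::euclidean_space \<Rightarrow> complex"
  assumes f: "integrable lborel f"
  defines "h \<equiv> \<lambda>z. LINT x|lborel. f x * cnj (f (x - z))"
  shows "integrable lborel h" "fourier h \<xi> = complex_of_real ((cmod (fourier f \<xi>))\<^sup>2)"
proof -
  note [measurable] = borel_measurable_integrable[OF f, simplified]
  define k where "k \<xi> = (\<lambda>(x, z). f x * cnj (f (x - z)) * cis (- (2 * pi * (z \<bullet> \<xi>))))" for \<xi>
  have sub: "(LINT z|lborel. u (x - z)) = (LINT z|lborel. u z)"
    if [measurable]: "u \<in> borel_measurable borel" for x :: 'a and u :: "'a \<Rightarrow> 'c::{banach,second_countable_topology}"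
    by (subst (2) distr_lborel_reflect[of x, symmetric]) (simp add: integral_distr)
  have cis_diff: "cis (- (2 * pi * ((x - z) \<bullet> \<xi>))) = cis (- (2 * pi * (x \<bullet> \<xi>))) * cnj (cis (- (2 * pi * (z \<bullet> \<xi>))))" for x z
    by (simp add: cis_cnj cis_mult inner_diff_left algebra_simps)
  have intz: "integrable lborel (\<lambda>z. f (x - z))" for x
    using f by (subst integrable_distr_eq[of _ _ borel f, symmetric]) (auto simp: distr_lborel_reflect)
  have int: "integrable (lborel \<Otimes>\<^sub>M lborel) (k \<xi>)" for \<xi>
  proof (rule lborel_pair.Fubini_integrable)
    have "(LINT z|lborel. cmod (k \<xi> (x, z))) = cmod (f x) * (LINT z|lborel. cmod (f z))" for x
      using sub[of "\<lambda>z. cmod (f z)" x] by (simp add: k_def norm_mult)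
    then show "integrable lborel (\<lambda>x. LINT z|lborel. cmod (k \<xi> (x, z)))"
      using f by simp
    have "integrable lborel (\<lambda>z. k \<xi> (x, z))" for x
      by (rule Bochner_Integration.integrable_bound[of _ "\<lambda>z. f x * f (x - z)"])
        (use intz in \<open>auto simp: k_def norm_mult\<close>)
    then show "AE x in lborel. integrable lborel (\<lambda>z. k \<xi> (x, z))" by simp
  qed (simp add: k_def)
  \<comment> \<open>At frequency 0 the exponential is 1, so \<open>k 0\<close> is the integrand of
    \<open>h\<close>.\<close>
  have "integrable lborel (\<lambda>z. LINT x|lborel. k 0 (x, z))"
    by (rule lborel_pair.integrable_snd) (simp add: int)
  then show "integrable lborel h" by (simp add: k_def h_def)
  have "fourier h \<xi> = (LINT z|lborel. LINT x|lborel. k \<xi> (x, z))"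
    unfolding fourier_def h_def k_def by (subst integral_mult_left_zero[symmetric]) simp
  also have "\<dots> = (LINT x|lborel. LINT z|lborel. k \<xi> (x, z))"
    using lborel_pair.Fubini_integral[of "\<lambda>x z. k \<xi> (x, z)"] int[of \<xi>] by simp
  also have "\<dots> = (LINT x|lborel. f x * cis (- (2 * pi * (x \<bullet> \<xi>))) * cnj (fourier f \<xi>))"
  proof (rule Bochner_Integration.integral_cong[OF refl])
    fix x
    have "(LINT z|lborel. k \<xi> (x, z)) = (LINT z|lborel. f x * (cnj (f (x - z)) * cis (- (2 * pi * ((x - (x - z)) \<bullet> \<xi>)))))"
      by (simp add: k_def mult.assoc)
    also have "\<dots> = (LINT z|lborel. f x * (cnj (f z) * cis (- (2 * pi * ((x - z) \<bullet> \<xi>)))))"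
      by (rule sub[of "\<lambda>y. f x * (cnj (f y) * cis (- (2 * pi * ((x - y) \<bullet> \<xi>))))"]) simp
    also have "\<dots> = (LINT z|lborel. f x * cis (- (2 * pi * (x \<bullet> \<xi>))) * cnj (f z * cis (- (2 * pi * (z \<bullet> \<xi>)))))"
      unfolding cis_diff complex_cnj_mult by (simp only: mult_ac)
    also have "\<dots> = f x * cis (- (2 * pi * (x \<bullet> \<xi>))) * cnj (fourier f \<xi>)"
      by (simp only: integral_mult_right_zero Bochner_Integration.integral_cnj fourier_def)
    finally show "(LINT z|lborel. k \<xi> (x, z)) = f x * cis (- (2 * pi * (x \<bullet> \<xi>))) * cnj (fourier f \<xi>)" .
  qed
  also have "\<dots> = fourier f \<xi> * cnj (fourier f \<xi>)"
    by (simp only: integral_mult_left_zero fourier_def[of f \<xi>, symmetric])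
  finally show "fourier h \<xi> = complex_of_real ((cmod (fourier f \<xi>))\<^sup>2)"
    by (simp only: complex_norm_square)
qed

text \<open>Lebesgue measure is the image of a product of one-dimensional copies along
  \<open>Basis\<close>, so integrals of separated functions factor. Both the Gaussians and the
  exponentials on a cube are computed this way.\<close>

lemma lborel_integral_prod_Basis:
  fixes f :: "'a::euclidean_space \<Rightarrow> real \<Rightarrow> 'c::{real_normed_field,banach,second_countable_topology}"
  assumes "\<And>b. b \<in> Basis \<Longrightarrow> integrable lborel (f b)"
  shows "(LINT x|lborel. (\<Prod>b\<in>Basis. f b (x \<bullet> b))) = (\<Prod>b\<in>Basis. integral\<^sup>L lborel (f b))" (is "?L = ?R")
    "integrable lborel (\<lambda>x. \<Prod>b\<in>Basis. f b (x \<bullet> b))"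
proof -
  interpret product_sigma_finite "\<lambda>_::'a. lborel :: real measure" ..
  have m: "(\<lambda>x. f b (x \<bullet> b)) \<in> borel_measurable borel" if "b \<in> Basis" for b
    using borel_measurable_integrable[OF assms[OF that]]
    by (intro measurable_compose[of "\<lambda>x. x \<bullet> b" borel borel "f b"]) auto
  have m' [measurable]: "(\<lambda>x. \<Prod>b\<in>Basis. f b (x \<bullet> b)) \<in> borel_measurable borel"
    by (intro borel_measurable_prod m)
  have [measurable]: "(\<lambda>g. \<Sum>b\<in>Basis. g b *\<^sub>R (b::'a)) \<in> (\<Pi>\<^sub>M b\<in>Basis. lborel) \<rightarrow>\<^sub>M borel"
    by measurable
  have eq: "(\<Sum>b\<in>Basis. g b *\<^sub>R b) \<bullet> c = g c" if "c \<in> (Basis :: 'a set)" for g c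
    using that by simp
  have "?L = (LINT g|(\<Pi>\<^sub>M b\<in>Basis. lborel). (\<Prod>b\<in>Basis. f b ((\<Sum>b\<in>Basis. g b *\<^sub>R b) \<bullet> b)))"
    by (subst lborel_eq) (rule integral_distr; measurable)
  also have "\<dots> = (LINT g|(\<Pi>\<^sub>M b\<in>Basis. lborel). (\<Prod>b\<in>Basis. f b (g b)))"
    by (simp only: eq cong: prod.cong)
  also have "\<dots> = ?R" by (rule product_integral_prod) (use assms in auto)
  finally show "?L = ?R" .
  have "integrable (\<Pi>\<^sub>M b\<in>Basis. lborel) (\<lambda>g. \<Prod>b\<in>Basis. f b (g b))"
    by (rule product_integrable_prod) (use assms in auto)
  then have "integrable (\<Pi>\<^sub>M b\<in>Basis. lborel) (\<lambda>g. \<Prod>b\<in>Basis. f b ((\<Sum>b\<in>Basis. g b *\<^sub>R b) \<bullet> b))"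
    by (simp only: eq cong: prod.cong)
  then show "integrable lborel (\<lambda>x. \<Prod>b\<in>Basis. f b (x \<bullet> b))"
    by (subst lborel_eq) (subst integrable_distr_eq; measurable)
qed

section \<open>Gaussians and Plancherel's identity\<close>

text \<open>The Gaussian with exponent \<open>- (e * norm x)\<^sup>2 / 2\<close>, written as a
  product over coordinates so that its integrals factor.\<close>

definition gauss_window :: "real \<Rightarrow> 'a::euclidean_space \<Rightarrow> real" where
  "gauss_window e x = (\<Prod>b\<in>Basis. exp (- (e * (x \<bullet> b))\<^sup>2 / 2))"

text \<open>The Fourier transform of \<open>gauss_window 1\<close>; the standard deviation
  \<open>1 / (2 * pi)\<close> comes from the factor \<open>2 * pi\<close> in the exponent of
  \<open>fourier\<close>.\<close>

definition gauss_kernel :: "'a::euclidean_space \<Rightarrow> real" where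
  "gauss_kernel x = (\<Prod>b\<in>Basis. normal_density 0 (1 / (2 * pi)) (x \<bullet> b))"

text \<open>In the variable \<open>e * t\<close> the integral is a multiple of the characteristic
  function of the standard normal law at \<open>- (2 * pi * s / e)\<close>.\<close>

lemma fourier_gauss_1:
  assumes "e > 0"
  shows "integrable lborel (\<lambda>t. complex_of_real (exp (- (e * t)\<^sup>2 / 2)) * cis (- (2 * pi * (t * s))))"
    "(LINT t|lborel. complex_of_real (exp (- (e * t)\<^sup>2 / 2)) * cis (- (2 * pi * (t * s))))
      = complex_of_real (normal_density 0 (1 / (2 * pi)) (s / e) / e)"
proof -
  define u where "u x = complex_of_real (exp (- x\<^sup>2 / 2)) * cis (- (2 * pi * (x * s / e)))" for x
  have u: "u x = complex_of_real (sqrt (2 * pi)) * (std_normal_density x *\<^sub>R iexp ((- (2 * pi * s / e)) * x))" for x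
    by (simp add: u_def std_normal_density_def cis_conv_exp scaleR_conv_of_real mult_ac)
  have uint: "integrable lborel u"
  proof -
    have [measurable]: "u \<in> borel_measurable borel" unfolding u_def by measurable
    have "integrable lborel (\<lambda>x. complex_of_real (sqrt (2 * pi) * std_normal_density x))"
      by simp
    then show ?thesis
      by (rule Bochner_Integration.integrable_bound) (auto simp: u_def norm_mult std_normal_density_def)
  qed
  have "(LINT x|lborel. u x) = complex_of_real (sqrt (2 * pi)) * char std_normal_distribution (- (2 * pi * s / e))"
    unfolding u char_def integral_mult_right_zero
    by (subst integral_density) (auto intro: borel_measurable_continuous_onI continuous_intros)
  also have "\<dots> = complex_of_real (normal_density 0 (1 / (2 * pi)) (s / e))"
    unfolding char_std_normal_distribution
    by (simp add: normal_density_def power_divide power_mult_distrib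
        real_sqrt_divide real_sqrt_mult field_simps power2_eq_square flip: of_real_mult)
  finally have uI: "(LINT x|lborel. u x) = complex_of_real (normal_density 0 (1 / (2 * pi)) (s / e))" .
  have eq: "complex_of_real (exp (- (e * t)\<^sup>2 / 2)) * cis (- (2 * pi * (t * s))) = u (0 + e * t)" for t
    using assms by (simp add: u_def)
  show "integrable lborel (\<lambda>t. complex_of_real (exp (- (e * t)\<^sup>2 / 2)) * cis (- (2 * pi * (t * s))))"
    unfolding eq using uint assms by (subst lborel_integrable_real_affine_iff) auto
  show "(LINT t|lborel. complex_of_real (exp (- (e * t)\<^sup>2 / 2)) * cis (- (2 * pi * (t * s))))
      = complex_of_real (normal_density 0 (1 / (2 * pi)) (s / e) / e)"
    unfolding eq using uI assms lborel_integral_real_affine[of e u 0]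
    by (simp add: scaleR_conv_of_real field_simps)
qed

lemma fourier_gauss_window:
  assumes "e > 0"
  shows "integrable lborel (\<lambda>x::'a::euclidean_space. complex_of_real (gauss_window e x))"
    "fourier (\<lambda>x::'a. complex_of_real (gauss_window e x)) \<xi>
      = complex_of_real (gauss_kernel ((1 / e) *\<^sub>R \<xi>) / e ^ DIM('a))"
proof -
  have cis_prod: "cis (- (2 * pi * (x \<bullet> \<xi>))) = (\<Prod>b\<in>Basis. cis (- (2 * pi * ((x \<bullet> b) * (\<xi> \<bullet> b)))))" for x \<xi> :: 'a
    by (subst euclidean_inner[of x \<xi>]) (simp add: sum_distrib_left cis_conv_exp exp_sum sum_negf[symmetric])
  have eq: "complex_of_real (gauss_window e x) * cis (- (2 * pi * (x \<bullet> \<xi>)))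
      = (\<Prod>b\<in>Basis. complex_of_real (exp (- (e * (x \<bullet> b))\<^sup>2 / 2)) * cis (- (2 * pi * ((x \<bullet> b) * (\<xi> \<bullet> b)))))" for x \<xi> :: 'a
    unfolding cis_prod gauss_window_def by (simp add: prod.distrib)
  note L = lborel_integral_prod_Basis[where f = "\<lambda>b t. complex_of_real (exp (- (e * t)\<^sup>2 / 2)) * cis (- (2 * pi * (t * (\<xi> \<bullet> b))))" for \<xi> :: 'a,
    OF fourier_gauss_1(1)[OF assms]]
  show "integrable lborel (\<lambda>x::'a. complex_of_real (gauss_window e x))"
    using L(2)[of 0] unfolding eq[symmetric] by simp
  show "fourier (\<lambda>x::'a. complex_of_real (gauss_window e x)) \<xi>
      = complex_of_real (gauss_kernel ((1 / e) *\<^sub>R \<xi>) / e ^ DIM('a))"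
    unfolding fourier_def eq L(1) fourier_gauss_1(2)[OF assms]
    by (simp add: gauss_kernel_def prod_dividef flip: of_real_prod)
qed

lemma gauss_kernel:
  "integrable lborel (gauss_kernel :: 'a::euclidean_space \<Rightarrow> real)"
  "(LINT x::'a|lborel. gauss_kernel x) = 1"
  using lborel_integral_prod_Basis[where f = "\<lambda>b::'a. normal_density 0 (1 / (2 * pi))"]
  by (simp_all add: gauss_kernel_def[abs_def])

lemma gauss_kernel_nonneg: "gauss_kernel x \<ge> 0"
  by (simp add: gauss_kernel_def prod_nonneg)

lemma lborel_integral_scale:
  fixes g :: "'a::euclidean_space \<Rightarrow> 'c::{banach,second_countable_topology}"
  assumes [measurable]: "g \<in> borel_measurable borel" and "c > 0"
  shows "c ^ DIM('a) *\<^sub>R (LINT x|lborel. g (c *\<^sub>R x)) = (LINT x|lborel. g x)"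
  using assms(2) by (subst (2) lborel_affine[of c 0]) (auto simp: integral_density integral_distr)

text \<open>The autocorrelation of \<open>f\<close> has Fourier transform \<open>|\<F> f|\<^sup>2\<close>; testing it against Gaussians that
  flatten out gives its value \<open>\<parallel>f\<parallel>\<^sup>2\<close> at the origin.\<close>

lemma plancherel_L1:
  fixes f :: "'a::euclidean_space \<Rightarrow> complex"
  assumes f: "integrable lborel f" "square_integrable f"
  shows "square_integrable (fourier f)" "norm (L2_of (fourier f)) = norm (L2_of f)"
proof -
  note [measurable] = square_integrableD(2)[OF f(2)]
  define h where "h z = (LINT x|lborel. f x * cnj (f (x - z)))" for z
  have h: "integrable lborel h" "fourier h \<xi> = complex_of_real ((cmod (fourier f \<xi>))\<^sup>2)" for \<xi>
    unfolding h_def[abs_def] using fourier_autocorrelation[OF f(1)] by auto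
  note [measurable] = borel_measurable_integrable[OF h(1), simplified] borel_measurable_integrable[OF gauss_kernel(1), simplified]
  have hc: "h z = cinner_L2 (L2_of f) (translate z (L2_of f))" for z
    by (simp add: L2_of_translate f(2) cinner_L2_of square_integrable_translate h_def)
  have h0: "h 0 = complex_of_real ((norm (L2_of f))\<^sup>2)"
    using cinner_L2_same[of "L2_of f"] by (simp add: hc L2_of_translate f(2))
  have h_le: "cmod (h z) \<le> (norm (L2_of f))\<^sup>2" for z
    unfolding hc using norm_cinner_L2_le[of "L2_of f" "translate z (L2_of f)"]
    by (simp add: L2_isometryD(2)[OF L2_isometry_translate] power2_eq_square)
  have h_lim: "(\<lambda>n. h (z n)) \<longlonglongrightarrow> h 0" if "z \<longlonglongrightarrow> 0" for z
  proof -
    have "(\<lambda>n. norm (L2_of f) * norm (translate (z n) (L2_of f) - L2_of f)) \<longlonglongrightarrow> 0"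
      using tendsto_translate_L2[OF that, of "L2_of f"]
      by (auto intro!: tendsto_mult_right_zero tendsto_norm_zero simp: LIM_zero_iff)
    moreover have bound: "norm (h (z n) - h 0) \<le> norm (L2_of f) * norm (translate (z n) (L2_of f) - L2_of f)" for n
    proof -
      have "h (z n) - h 0 = cinner_L2 (L2_of f) (translate (z n) (L2_of f) - L2_of f)"
        by (simp add: hc cinner_L2_diff_right L2_of_translate f(2))
      then show ?thesis by (simp add: norm_cinner_L2_le)
    qed
    ultimately have "(\<lambda>n. h (z n) - h 0) \<longlonglongrightarrow> 0"
      by (intro Lim_null_comparison[OF always_eventually[OF allI[OF bound]]])
    then show ?thesis by (simp add: LIM_zero_iff)
  qed
  define e where "e n = 1 / real (Suc n)" for n
  have e: "e n > 0" for n by (simp add: e_def)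
  have key: "(LINT \<xi>|lborel. complex_of_real ((cmod (fourier f \<xi>))\<^sup>2 * gauss_window (e n) \<xi>))
      = (LINT x|lborel. h (e n *\<^sub>R x) * complex_of_real (gauss_kernel x))" for n
  proof -
    have "(LINT \<xi>|lborel. complex_of_real ((cmod (fourier f \<xi>))\<^sup>2 * gauss_window (e n) \<xi>))
        = (LINT x|lborel. h x * complex_of_real (gauss_kernel ((1 / e n) *\<^sub>R x) / e n ^ DIM('a)))"
      using fourier_multiplication_formula[OF h(1) fourier_gauss_window(1)[OF e]]
      unfolding fourier_gauss_window(2)[OF e] h(2) by simp
    also have "\<dots> = (1 / e n) ^ DIM('a) *\<^sub>R (LINT x|lborel. h (e n *\<^sub>R ((1 / e n) *\<^sub>R x)) * complex_of_real (gauss_kernel ((1 / e n) *\<^sub>R x)))"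
    proof -
      have "e n *\<^sub>R ((1 / e n) *\<^sub>R x) = x" for x :: 'a using e[of n] by simp
      moreover have "h x * complex_of_real (gauss_kernel ((1 / e n) *\<^sub>R x) / e n ^ DIM('a))
          = (1 / e n) ^ DIM('a) *\<^sub>R (h x * complex_of_real (gauss_kernel ((1 / e n) *\<^sub>R x)))" for x
        by (simp add: scaleR_conv_of_real power_divide)
      ultimately show ?thesis by (simp only: Bochner_Integration.integral_scaleR_right)
    qed
    also have "\<dots> = (LINT x|lborel. h (e n *\<^sub>R x) * complex_of_real (gauss_kernel x))"
      using e[of n] by (intro lborel_integral_scale[of "\<lambda>x. h (e n *\<^sub>R x) * complex_of_real (gauss_kernel x)"]) auto
    finally show ?thesis .
  qed
  have e_lim: "(\<lambda>n. e n) \<longlonglongrightarrow> 0"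
    by (rule Lim_transform_eventually[OF LIMSEQ_inverse_real_of_nat]) (simp add: e_def inverse_eq_divide)
  have "(\<lambda>n. LINT x|lborel. h (e n *\<^sub>R x) * complex_of_real (gauss_kernel x))
      \<longlonglongrightarrow> (LINT x|lborel. h 0 * complex_of_real (gauss_kernel (x::'a)))"
  proof (rule integral_dominated_convergence[where w = "\<lambda>x. (norm (L2_of f))\<^sup>2 * gauss_kernel x"])
    have "(\<lambda>n. h (e n *\<^sub>R x)) \<longlonglongrightarrow> h 0" for x
      by (rule h_lim) (use tendsto_scaleR[OF e_lim tendsto_const, of x] in simp)
    then show "AE x in lborel. (\<lambda>n. h (e n *\<^sub>R x) * complex_of_real (gauss_kernel x)) \<longlonglongrightarrow> h 0 * complex_of_real (gauss_kernel x)"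
      by (auto intro!: tendsto_intros)
    show "AE x in lborel. norm (h (e n *\<^sub>R x) * complex_of_real (gauss_kernel x)) \<le> (norm (L2_of f))\<^sup>2 * gauss_kernel x" for n
      by (auto simp: norm_mult gauss_kernel_nonneg intro!: mult_right_mono h_le)
  qed (auto simp: gauss_kernel(1))
  also have "(LINT x|lborel. h 0 * complex_of_real (gauss_kernel (x::'a))) = h 0"
    using gauss_kernel(2)[where 'a = 'a] integral_complex_of_real[of lborel "gauss_kernel :: 'a \<Rightarrow> real"] by simp
  finally have "(\<lambda>n. complex_of_real (LINT \<xi>|lborel. (cmod (fourier f \<xi>))\<^sup>2 * gauss_window (e n) \<xi>)) \<longlonglongrightarrow> complex_of_real ((norm (L2_of f))\<^sup>2)"
    unfolding key[symmetric] integral_complex_of_real h0 .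
  then have lim: "(\<lambda>n. LINT \<xi>|lborel. (cmod (fourier f \<xi>))\<^sup>2 * gauss_window (e n) \<xi>) \<longlonglongrightarrow> (norm (L2_of f))\<^sup>2"
    by (simp only: tendsto_of_real_iff)
  \<comment> \<open>Integrability of \<open>(cmod (fourier f \<xi>))\<^sup>2\<close> is still open
    here. As the windows increase to 1, monotone convergence yields it together with the value of
    the integral.\<close>
  have "has_bochner_integral lborel (\<lambda>\<xi>. (cmod (fourier f \<xi>))\<^sup>2) ((norm (L2_of f))\<^sup>2)"
  proof (rule has_bochner_integral_monotone_convergence[OF _ _ _ lim])
    fix n
    have w: "integrable lborel (gauss_window (e n) :: 'a \<Rightarrow> real)"
      using fourier_gauss_window(1)[OF e[of n]] by (simp only: complex_of_real_integrable_eq)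
    note [measurable] = borel_measurable_integrable[OF w, simplified]
    show "integrable lborel (\<lambda>\<xi>. (cmod (fourier f \<xi>))\<^sup>2 * gauss_window (e n) \<xi>)"
    proof (rule Bochner_Integration.integrable_bound[OF integrable_mult_right[OF w, of "(LINT x|lborel. cmod (f x))\<^sup>2"]])
      show "AE x in lborel. norm ((cmod (fourier f x))\<^sup>2 * gauss_window (e n) x) \<le> norm ((LINT x|lborel. cmod (f x))\<^sup>2 * gauss_window (e n) x)"
        by (auto intro!: AE_I2 mult_right_mono power_mono norm_fourier_le simp: abs_mult)
    qed measurable
  next
    have "(\<lambda>n. (cmod (fourier f x))\<^sup>2 * gauss_window (e n) x) \<longlonglongrightarrow> (cmod (fourier f x))\<^sup>2 * (\<Prod>b\<in>(Basis::'a set). exp (- (0 * (x \<bullet> b))\<^sup>2 / 2))" for x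
      unfolding gauss_window_def by (intro tendsto_intros e_lim) simp_all
    then show "AE x in lborel. (\<lambda>n. (cmod (fourier f x))\<^sup>2 * gauss_window (e n) x) \<longlonglongrightarrow> (cmod (fourier f x))\<^sup>2"
      by simp
    have "mono (\<lambda>n. (cmod (fourier f x))\<^sup>2 * gauss_window (e n) x)" for x
    proof (intro monoI mult_left_mono)
      fix m n :: nat assume "m \<le> n"
      then have "e n \<le> e m" by (simp add: e_def divide_simps)
      then have "(e n * (x \<bullet> b))\<^sup>2 \<le> (e m * (x \<bullet> b))\<^sup>2" for b
        using e[of n] e[of m] by (auto simp: power_mult_distrib intro!: mult_right_mono power_mono)
      then show "gauss_window (e m) x \<le> gauss_window (e n) x"
        unfolding gauss_window_def by (intro prod_mono) (auto simp: divide_right_mono)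
    qed auto
    then show "AE x in lborel. mono (\<lambda>n. (cmod (fourier f x))\<^sup>2 * gauss_window (e n) x)" by simp
  qed auto
  then have "integrable lborel (\<lambda>\<xi>. (cmod (fourier f \<xi>))\<^sup>2)" "(LINT \<xi>|lborel. (cmod (fourier f \<xi>))\<^sup>2) = (norm (L2_of f))\<^sup>2"
    by (auto simp: has_bochner_integral_iff)
  then show s: "square_integrable (fourier f)" "norm (L2_of (fourier f)) = norm (L2_of f)"
    by (simp_all add: square_integrable_def norm_L2_of)
qed

section \<open>The Fourier transform on \<open>L\<^sup>2\<close>\<close>

definition L1L2 :: "('a::euclidean_space \<Rightarrow> complex) \<Rightarrow> bool" where
  "L1L2 f \<longleftrightarrow> integrable lborel f \<and> square_integrable f"

text \<open>The indicator of a set of finite measure is itself square integrable, and a product of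
  two square-integrable functions is integrable.\<close>

lemma integrable_bounded_measure_support:
  fixes f :: "'a::euclidean_space \<Rightarrow> complex"
  assumes f: "square_integrable f" and S: "S \<in> sets borel" "emeasure lborel S < \<infinity>"
  shows "L1L2 (\<lambda>x. indicator S x * f x)"
proof -
  have i: "square_integrable (\<lambda>x. 1 * indicator S x)"
    using S by (intro square_integrable_indicator) auto
  have "integrable lborel (\<lambda>x. (1 * indicator S x) * cnj (cnj (f x)))"
  proof (rule square_integrable_inner[OF i])
    show "square_integrable (\<lambda>x. cnj (f x))"
      by (rule square_integrable_bound[OF f]) (use square_integrableD(2)[OF f] in auto)
  qed
  moreover have "square_integrable (\<lambda>x. indicator S x * f x)"
    using S square_integrableD(2)[OF f] by (intro square_integrable_bound[OF f]) (auto simp: indicator_def)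
  ultimately show ?thesis by (simp add: L1L2_def)
qed

definition truncate_ball :: "nat \<Rightarrow> 'a::euclidean_space L2 \<Rightarrow> 'a \<Rightarrow> complex" where
  "truncate_ball n f x = indicator (cball 0 (real n)) x * rep_L2 f x"

lemma L1L2_truncate_ball: "L1L2 (truncate_ball n f)"
  unfolding truncate_ball_def[abs_def]
  by (intro integrable_bounded_measure_support square_integrable_rep_L2 emeasure_lborel_cball_finite) auto

lemma tendsto_truncate_ball: "(\<lambda>n. L2_of (truncate_ball n f)) \<longlonglongrightarrow> f"
proof -
  have "(\<lambda>n. L2_of (truncate_ball n f)) \<longlonglongrightarrow> L2_of (rep_L2 f)"
  proof (rule tendsto_L2_of_dominated(2)[OF square_integrable_rep_L2[of f]])
    have "(\<lambda>n. truncate_ball n f x) \<longlonglongrightarrow> rep_L2 f x" for x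
    proof (rule tendsto_eventually)
      obtain n0 :: nat where n0: "real n0 \<ge> norm x" using real_arch_simple by blast
      show "\<forall>\<^sub>F n in sequentially. truncate_ball n f x = rep_L2 f x"
        unfolding eventually_sequentially
        by (intro exI[of _ n0]) (use n0 in \<open>auto simp: truncate_ball_def\<close>)
    qed
    then show "AE x in lborel. (\<lambda>n. truncate_ball n f x) \<longlonglongrightarrow> rep_L2 f x" by simp
    show "truncate_ball n f \<in> borel_measurable borel" for n
      using L1L2_truncate_ball[of n f] by (auto simp: L1L2_def square_integrable_def)
  qed (use square_integrable_rep_L2[of f] in \<open>auto simp: truncate_ball_def indicator_def square_integrable_def\<close>)
  then show ?thesis by simp
qed

text \<open>Truncations to balls lie in the intersection of L^1 and L^2 and converge to the given
  element. Identities between continuous maps are thereby reduced to the integral formula.\<close>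

lemma L1L2_dense_eqI:
  assumes "continuous_on UNIV S" "continuous_on UNIV T"
    and "\<And>f. L1L2 f \<Longrightarrow> S (L2_of f) = T (L2_of f)"
  shows "S = (T :: 'a::euclidean_space L2 \<Rightarrow> 'b::t2_space)"
proof
  fix f
  have "(\<lambda>n. S (L2_of (truncate_ball n f))) \<longlonglongrightarrow> S f"
    by (rule continuous_on_tendsto_compose[OF assms(1) tendsto_truncate_ball]) auto
  moreover have "(\<lambda>n. T (L2_of (truncate_ball n f))) \<longlonglongrightarrow> T f"
    by (rule continuous_on_tendsto_compose[OF assms(2) tendsto_truncate_ball]) auto
  ultimately show "S f = T f"
    using assms(3)[OF L1L2_truncate_ball] by (auto intro: LIMSEQ_unique)
qed

lemma L1L2_add: "L1L2 f \<Longrightarrow> L1L2 g \<Longrightarrow> L1L2 (\<lambda>x. f x + g x)"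
  by (simp add: L1L2_def square_integrable_add)

lemma L1L2_mult: "L1L2 f \<Longrightarrow> L1L2 (\<lambda>x. c * f x)"
  by (simp add: L1L2_def square_integrable_mult)

lemma L1L2_diff: "L1L2 f \<Longrightarrow> L1L2 g \<Longrightarrow> L1L2 (\<lambda>x. f x - g x)"
  by (simp add: L1L2_def square_integrable_diff)

lemma fourier_add: "L1L2 f \<Longrightarrow> L1L2 g \<Longrightarrow> fourier (\<lambda>x. f x + g x) = (\<lambda>\<xi>. fourier f \<xi> + fourier g \<xi>)"
  unfolding fourier_def L1L2_def fun_eq_iff
  by (simp only: distrib_right Bochner_Integration.integral_add integrable_fourier_integrand) simp

lemma fourier_diff: "L1L2 f \<Longrightarrow> L1L2 g \<Longrightarrow> fourier (\<lambda>x. f x - g x) = (\<lambda>\<xi>. fourier f \<xi> - fourier g \<xi>)"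
  unfolding fourier_def L1L2_def fun_eq_iff
  by (simp only: left_diff_distrib Bochner_Integration.integral_diff integrable_fourier_integrand) simp

lemma fourier_mult: "fourier (\<lambda>x. c * f x) = (\<lambda>\<xi>. c * fourier f \<xi>)"
  unfolding fourier_def fun_eq_iff by (simp only: mult.assoc integral_mult_right_zero) simp

text \<open>An explicit extension of the integral formula, the witness for the definite description
  in \<open>fourier_L2\<close>.\<close>

definition plancherel :: "'a::euclidean_space L2 \<Rightarrow> 'a L2" where
  "plancherel f = lim (\<lambda>n. L2_of (fourier (truncate_ball n f)))"

text \<open>Applied to differences, Plancherel's identity makes the integral formula distance
  preserving. The transforms of truncations are therefore a Cauchy sequence, and for
  \<open>f\<close> in L^1 the limit is \<open>fourier f\<close>.\<close>

lemma plancherel_L1L2: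
  fixes f :: "'a::euclidean_space \<Rightarrow> complex" and g :: "'a L2"
  assumes "L1L2 f"
  shows "square_integrable (fourier f)" "plancherel (L2_of f) = L2_of (fourier f)"
    and tendsto_plancherel: "(\<lambda>n. L2_of (fourier (truncate_ball n g))) \<longlonglongrightarrow> plancherel g"
proof -
  have sq: "square_integrable (fourier f)" if "L1L2 f" for f :: "'a \<Rightarrow> complex"
    using that plancherel_L1 by (auto simp: L1L2_def)
  then show "square_integrable (fourier f)" using assms .
  have dist: "dist (L2_of (fourier u)) (L2_of (fourier v)) = dist (L2_of u) (L2_of v)"
    if "L1L2 u" "L1L2 v" for u v :: "'a \<Rightarrow> complex"
    using plancherel_L1(2)[of "\<lambda>x. u x - v x"] L1L2_diff[OF that] that
    by (simp add: dist_norm L2_of_diff sq fourier_diff) (simp add: L1L2_def L2_of_diff)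
  have "Cauchy (\<lambda>n. L2_of (fourier (truncate_ball n g)))" for g :: "'a L2"
    using LIMSEQ_imp_Cauchy[OF tendsto_truncate_ball[of g]]
    unfolding Cauchy_def by (simp add: dist L1L2_truncate_ball)
  then have lim: "(\<lambda>n. L2_of (fourier (truncate_ball n g))) \<longlonglongrightarrow> plancherel g" for g :: "'a L2"
    unfolding plancherel_def by (simp add: Cauchy_convergent_iff convergent_LIMSEQ_iff)
  then show "(\<lambda>n. L2_of (fourier (truncate_ball n g))) \<longlonglongrightarrow> plancherel g" .
  have "(\<lambda>n. dist (L2_of (truncate_ball n (L2_of f))) (L2_of f)) \<longlonglongrightarrow> 0"
    using tendsto_truncate_ball[of "L2_of f"] by (subst (asm) tendsto_dist_iff)
  then have "(\<lambda>n. dist (L2_of (fourier (truncate_ball n (L2_of f)))) (L2_of (fourier f))) \<longlonglongrightarrow> 0"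
    by (simp only: dist L1L2_truncate_ball assms)
  then have "(\<lambda>n. L2_of (fourier (truncate_ball n (L2_of f)))) \<longlonglongrightarrow> L2_of (fourier f)"
    by (subst tendsto_dist_iff)
  then show "plancherel (L2_of f) = L2_of (fourier f)"
    using lim[of "L2_of f"] by (metis LIMSEQ_unique)
qed

lemma L2_isometry_plancherel: "L2_isometry (plancherel :: 'a::euclidean_space L2 \<Rightarrow> _)"
proof -
  have z: "L1L2 (\<lambda>x::'a. 0)" by (simp add: L1L2_def square_integrable_zero)
  note lim = tendsto_plancherel[OF z]
  note tr = L1L2_truncate_ball
  have trs: "square_integrable (truncate_ball n (f::'a L2))" for n f
    using tr[of n f] by (simp add: L1L2_def)
  have sq: "square_integrable (fourier (truncate_ball n (f::'a L2)))" for n f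
    by (rule plancherel_L1L2(1)[OF tr])
  \<comment> \<open>Representatives are additive only almost everywhere, so additivity is shown for
    the truncations as classes and reaches their transforms through
    \<open>plancherel\<close>.\<close>
  have add_aux: "L2_of (fourier (truncate_ball n (f + g))) = L2_of (fourier (truncate_ball n f)) + L2_of (fourier (truncate_ball n g))"
    for n and f g :: "'a L2"
  proof -
    have "L2_of (rep_L2 (f + g)) = L2_of (\<lambda>x. rep_L2 f x + rep_L2 g x)"
      using L2_of_add[OF square_integrable_rep_L2[of f] square_integrable_rep_L2[of g]] by simp
    then have "AE x in lborel. rep_L2 (f + g) x = rep_L2 f x + rep_L2 g x"
      by (subst (asm) L2_of_eq_iff) (auto intro: square_integrable_add square_integrable_rep_L2)
    then have "AE x in lborel. truncate_ball n (f + g) x = truncate_ball n f x + truncate_ball n g x"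
      by eventually_elim (simp add: truncate_ball_def distrib_left)
    then have "L2_of (truncate_ball n (f + g)) = L2_of (\<lambda>x. truncate_ball n f x + truncate_ball n g x)"
      by (intro L2_of_cong_AE square_integrable_add trs)
    then have "plancherel (L2_of (truncate_ball n (f + g))) = plancherel (L2_of (\<lambda>x. truncate_ball n f x + truncate_ball n g x))"
      by simp
    then show ?thesis
      by (simp add: plancherel_L1L2(2) tr L1L2_add fourier_add L2_of_add sq)
  qed
  have mult_aux: "L2_of (fourier (truncate_ball n (c *\<^sub>C f))) = c *\<^sub>C L2_of (fourier (truncate_ball n f))"
    for n c and f :: "'a L2"
  proof -
    have "L2_of (rep_L2 (c *\<^sub>C f)) = L2_of (\<lambda>x. c * rep_L2 f x)"
      using L2_of_mult[OF square_integrable_rep_L2[of f]] by simp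
    then have "AE x in lborel. rep_L2 (c *\<^sub>C f) x = c * rep_L2 f x"
      by (subst (asm) L2_of_eq_iff) (auto intro: square_integrable_mult square_integrable_rep_L2)
    then have "AE x in lborel. truncate_ball n (c *\<^sub>C f) x = c * truncate_ball n f x"
      by eventually_elim (simp add: truncate_ball_def)
    then have "L2_of (truncate_ball n (c *\<^sub>C f)) = L2_of (\<lambda>x. c * truncate_ball n f x)"
      by (intro L2_of_cong_AE square_integrable_mult trs)
    then have "plancherel (L2_of (truncate_ball n (c *\<^sub>C f))) = plancherel (L2_of (\<lambda>x. c * truncate_ball n f x))"
      by simp
    then show ?thesis
      by (simp add: plancherel_L1L2(2) tr L1L2_mult fourier_mult L2_of_mult sq)
  qed
  have norm: "norm (plancherel f) = norm f" for f :: "'a L2"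
  proof -
    have "norm (L2_of (fourier (truncate_ball n f))) = norm (L2_of (truncate_ball n f))" for n
      using plancherel_L1(2)[of "truncate_ball n f"] tr[of n f] by (simp add: L1L2_def)
    then show ?thesis
      using tendsto_norm[OF lim[of f]] tendsto_norm[OF tendsto_truncate_ball[of f]] by (auto intro: LIMSEQ_unique)
  qed
  have add: "plancherel (f + g) = plancherel f + plancherel g" for f g :: "'a L2"
    using lim[of "f + g"] tendsto_add[OF lim[of f] lim[of g]] unfolding add_aux by (rule LIMSEQ_unique)
  have mult: "plancherel (c *\<^sub>C f) = c *\<^sub>C plancherel f" for c and f :: "'a L2"
  proof -
    from bounded_linear.tendsto[OF bounded_linear_scaleC_L2 lim[of f]] lim[of "c *\<^sub>C f"] show ?thesis
      unfolding mult_aux by (metis LIMSEQ_unique)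
  qed
  show ?thesis unfolding L2_isometry_def L2_linear_def using add mult norm by blast
qed

text \<open>Any other continuous extension agrees with \<open>plancherel\<close> on the dense
  intersection of L^1 and L^2, where both are the integral formula.\<close>

lemma fourier_L2_eq_plancherel: "fourier_L2 = plancherel"
  unfolding fourier_L2_def
proof (rule the_equality)
  show "continuous_on UNIV plancherel \<and> (\<forall>f. integrable lborel f \<and> square_integrable f \<longrightarrow>
        square_integrable (fourier f) \<and> plancherel (L2_of f) = L2_of (fourier f))"
    by (simp add: plancherel_L1L2(1,2) L2_isometryD(4)[OF L2_isometry_plancherel] L1L2_def)
next
  fix U :: "'a L2 \<Rightarrow> 'a L2"
  assume U: "continuous_on UNIV U \<and> (\<forall>f. integrable lborel f \<and> square_integrable f \<longrightarrow>
        square_integrable (fourier f) \<and> U (L2_of f) = L2_of (fourier f))"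
  show "U = plancherel"
  proof (rule L1L2_dense_eqI)
    fix f :: "'a \<Rightarrow> complex" assume f: "L1L2 f"
    then show "U (L2_of f) = plancherel (L2_of f)"
      using U by (subst plancherel_L1L2(2)) (auto simp: L1L2_def)
  qed (use U in \<open>auto intro: L2_isometryD(4)[OF L2_isometry_plancherel]\<close>)
qed

lemma L2_isometry_fourier_L2: "L2_isometry fourier_L2"
  by (simp add: fourier_L2_eq_plancherel L2_isometry_plancherel)

lemma fourier_L2_of:
  "L1L2 f \<Longrightarrow> square_integrable (fourier f)"
  "L1L2 f \<Longrightarrow> fourier_L2 (L2_of f) = L2_of (fourier f)"
  by (simp_all add: fourier_L2_eq_plancherel plancherel_L1L2)

lemma fourier_L2_intertwine:
  fixes S T :: "'a::euclidean_space L2 \<Rightarrow> 'a L2"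
  assumes S: "L2_isometry S" and T: "L2_isometry T"
    and "\<And>f. L1L2 f \<Longrightarrow> fourier_L2 (S (L2_of f)) = T (L2_of (fourier f))"
  shows "fourier_L2 (S f) = T (fourier_L2 f)"
proof -
  have "(\<lambda>f. fourier_L2 (S f)) = (\<lambda>f. T (fourier_L2 f))"
  proof (rule L1L2_dense_eqI)
    show "continuous_on UNIV (\<lambda>f. fourier_L2 (S f))"
      by (rule L2_isometryD(4)[OF L2_isometry_comp[OF L2_isometry_fourier_L2 S]])
    show "continuous_on UNIV (\<lambda>f. T (fourier_L2 f))"
      by (rule L2_isometryD(4)[OF L2_isometry_comp[OF T L2_isometry_fourier_L2]])
    fix f :: "'a \<Rightarrow> complex" assume "L1L2 f"
    then show "fourier_L2 (S (L2_of f)) = T (fourier_L2 (L2_of f))"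
      by (simp only: assms(3) fourier_L2_of(2))
  qed
  then show ?thesis by metis
qed

section \<open>Covariance under translations, modulations, dilations and rotations\<close>

text \<open>The change of variables for nonnegative functions says that Lebesgue measure is the
  image under \<open>g\<close> of the measure with density \<open>(cmod (w x))\<^sup>2\<close>; in
  this form it applies to complex integrands.\<close>

lemma isometric_subst_integral:
  fixes h :: "'a::euclidean_space \<Rightarrow> complex"
  assumes wg: "isometric_subst w g" and h: "integrable lborel h"
  shows "integrable lborel (\<lambda>x. (cmod (w x))\<^sup>2 *\<^sub>R h (g x))"
    "(LINT x|lborel. (cmod (w x))\<^sup>2 *\<^sub>R h (g x)) = (LINT x|lborel. h x)"
proof -
  note [measurable] = isometric_substD(1,2)[OF wg] borel_measurable_integrable[OF h, simplified]
  have eq: "distr (density lborel (\<lambda>x. ennreal ((cmod (w x))\<^sup>2))) borel g = lborel"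
  proof (rule measure_eqI)
    fix A assume "A \<in> sets (distr (density lborel (\<lambda>x. ennreal ((cmod (w x))\<^sup>2))) borel g)"
    then have A [measurable]: "A \<in> sets borel" by simp
    have "emeasure (distr (density lborel (\<lambda>x. ennreal ((cmod (w x))\<^sup>2))) borel g) A
        = (\<integral>\<^sup>+x. ennreal ((cmod (w x))\<^sup>2) * indicator A (g x) \<partial>lborel)"
      using measurable_sets[of g borel borel A]
      by (simp add: emeasure_distr emeasure_density) (rule nn_integral_cong, auto simp: indicator_def)
    then show "emeasure (distr (density lborel (\<lambda>x. ennreal ((cmod (w x))\<^sup>2))) borel g) A = emeasure lborel A"
      by (simp add: isometric_substD(4)[OF wg])
  qed simp
  show "(LINT x|lborel. (cmod (w x))\<^sup>2 *\<^sub>R h (g x)) = (LINT x|lborel. h x)"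
    by (subst (2) eq[symmetric]) (simp add: integral_distr integral_density)
  have "integrable (distr (density lborel (\<lambda>x. ennreal ((cmod (w x))\<^sup>2))) borel g) h"
    using h by (simp add: eq)
  then show "integrable lborel (\<lambda>x. (cmod (w x))\<^sup>2 *\<^sub>R h (g x))"
    by (simp add: integrable_distr_eq integrable_density)
qed

text \<open>The substitution rule carries \<open>(cmod (w x))\<^sup>2\<close>, whereas integrability
  concerns the first power of \<open>w x\<close>; a constant modulus \<open>c\<close> lets the
  surplus factor be divided out.\<close>

lemma L1L2_subst:
  assumes wg: "isometric_subst w g" and f: "L1L2 f" and w: "\<And>x. cmod (w x) = c"
  shows "L1L2 (\<lambda>x. w x * f (g x))"
proof -
  note [measurable] = isometric_substD(1,2)[OF wg]
  have [measurable]: "f \<in> borel_measurable borel" using f by (auto simp: L1L2_def square_integrable_def)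
  have c: "c \<noteq> 0" using isometric_substD(3)[OF wg] w by (metis norm_eq_zero)
  have "integrable lborel (\<lambda>x. c\<^sup>2 *\<^sub>R f (g x))"
    using isometric_subst_integral(1)[OF wg] f by (simp add: L1L2_def w)
  from integrable_scaleR_right[OF this, of "inverse (c\<^sup>2)"] have "integrable lborel (\<lambda>x. f (g x))"
    using c by simp
  then have "integrable lborel (\<lambda>x. complex_of_real c * f (g x))" by simp
  then have "integrable lborel (\<lambda>x. w x * f (g x))"
    by (rule Bochner_Integration.integrable_bound)
      (use w in \<open>auto simp: norm_mult intro!: AE_I2 mult_right_mono\<close>)
  then show ?thesis using f square_integrable_subst[OF wg] by (simp add: L1L2_def)
qed

lemma L2_of_modulate:
  assumes "square_integrable f"
  shows "modulate a (L2_of f) = L2_of (\<lambda>x. cis (2 * pi * (a \<bullet> x)) * f x)"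
  unfolding modulate_eq_subst by (rule subst_op_L2_of[OF isometric_subst_modulate assms])

lemma fourier_L2_translate: "fourier_L2 (translate a f) = modulate (- a) (fourier_L2 f)"
proof (rule fourier_L2_intertwine[OF L2_isometry_translate L2_isometry_modulate])
  fix f :: "'a \<Rightarrow> complex" assume f: "L1L2 f"
  have t: "L1L2 (\<lambda>x. f (x - a))"
    using L1L2_subst[OF isometric_subst_translate f, where c = 1] by simp
  have "fourier (\<lambda>x. f (x - a)) \<xi> = cis (2 * pi * (- a \<bullet> \<xi>)) * fourier f \<xi>" for \<xi>
  proof -
    have "fourier f \<xi> = (LINT x|lborel. f (x - a) * cis (- (2 * pi * ((x - a) \<bullet> \<xi>))))"
      using isometric_subst_integral(2)[OF isometric_subst_translate, of "\<lambda>x. f x * cis (- (2 * pi * (x \<bullet> \<xi>)))" a]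
        f by (simp add: L1L2_def fourier_def integrable_fourier_integrand)
    also have "\<dots> = (LINT x|lborel. cis (2 * pi * (a \<bullet> \<xi>)) * (f (x - a) * cis (- (2 * pi * (x \<bullet> \<xi>)))))"
      by (intro Bochner_Integration.integral_cong) (auto simp: cis_mult inner_diff_left algebra_simps)
    also have "\<dots> = cis (2 * pi * (a \<bullet> \<xi>)) * fourier (\<lambda>x. f (x - a)) \<xi>"
      by (simp add: fourier_def)
    finally show ?thesis by (simp add: cis_mult flip: mult.assoc)
  qed
  then have "fourier (\<lambda>x. f (x - a)) = (\<lambda>\<xi>. cis (2 * pi * (- a \<bullet> \<xi>)) * fourier f \<xi>)" by blast
  then show "fourier_L2 (translate a (L2_of f)) = modulate (- a) (L2_of (fourier f))"
    using f fourier_L2_of[OF t] fourier_L2_of[OF f]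
    by (simp add: L2_of_translate L1L2_def L2_of_modulate)
qed

lemma fourier_L2_modulate: "fourier_L2 (modulate a f) = translate a (fourier_L2 f)"
proof (rule fourier_L2_intertwine[OF L2_isometry_modulate L2_isometry_translate])
  fix f :: "'a \<Rightarrow> complex" assume f: "L1L2 f"
  have t: "L1L2 (\<lambda>x. cis (2 * pi * (a \<bullet> x)) * f x)"
    using L1L2_subst[OF isometric_subst_modulate f, where c = 1] by simp
  have "fourier (\<lambda>x. cis (2 * pi * (a \<bullet> x)) * f x) = (\<lambda>\<xi>. fourier f (\<xi> - a))"
    unfolding fourier_def fun_eq_iff
    by (intro allI Bochner_Integration.integral_cong)
      (auto simp: cis_mult inner_diff_right inner_commute algebra_simps)
  then show "fourier_L2 (modulate a (L2_of f)) = translate a (L2_of (fourier f))"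
    using f fourier_L2_of[OF t] fourier_L2_of[OF f]
    by (simp add: L2_of_translate L1L2_def L2_of_modulate)
qed

text \<open>With \<open>c\<close> the normalization of \<open>dilate r\<close>, the substitution
  costs \<open>c\<^sup>2\<close>. One factor belongs to the dilated function; the other, taken to
  the opposite side, is the normalization \<open>inverse c\<close> of the dilation by
  \<open>inverse r\<close>.\<close>

lemma fourier_L2_dilate:
  fixes f :: "(real^'n) L2"
  assumes r: "r > 0"
  shows "fourier_L2 (dilate r f) = dilate (inverse r) (fourier_L2 f)"
proof (rule fourier_L2_intertwine)
  have r': "inverse r > 0" using r by simp
  show "L2_isometry (dilate r :: (real^'n) L2 \<Rightarrow> _)" "L2_isometry (dilate (inverse r) :: (real^'n) L2 \<Rightarrow> _)"
    using r by (auto intro: L2_isometry_dilate)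
  fix f :: "real^'n \<Rightarrow> complex" assume f: "L1L2 f"
  define c where "c = r powr (- (real CARD('n) / 2))"
  have c: "c > 0" using r by (simp add: c_def)
  have c': "inverse r powr (- (real CARD('n) / 2)) = inverse c"
    using r by (simp add: c_def powr_minus inverse_powr)
  note iso = isometric_subst_dilate[OF r, where 'n = 'n, folded c_def]
  have t: "L1L2 (\<lambda>x. complex_of_real c * f (inverse r *\<^sub>R x))"
    using L1L2_subst[OF iso f, where c = c] c by simp
  have "fourier (\<lambda>x. complex_of_real c * f (inverse r *\<^sub>R x)) \<xi> = complex_of_real (inverse c) * fourier f (r *\<^sub>R \<xi>)" for \<xi>
  proof -
    have "fourier f (r *\<^sub>R \<xi>) = (LINT x|lborel. (cmod (complex_of_real c))\<^sup>2 *\<^sub>R (f (inverse r *\<^sub>R x) * cis (- (2 * pi * ((inverse r *\<^sub>R x) \<bullet> (r *\<^sub>R \<xi>))))))"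
      unfolding fourier_def
      by (rule isometric_subst_integral(2)[OF iso, of "\<lambda>x. f x * cis (- (2 * pi * (x \<bullet> (r *\<^sub>R \<xi>))))", symmetric])
        (use f in \<open>simp only: L1L2_def integrable_fourier_integrand\<close>)
    also have "\<dots> = (LINT x|lborel. complex_of_real c * (complex_of_real c * f (inverse r *\<^sub>R x) * cis (- (2 * pi * (x \<bullet> \<xi>)))))"
    proof -
      have "(inverse r *\<^sub>R x) \<bullet> (r *\<^sub>R \<xi>) = x \<bullet> \<xi>" for x using r by simp
      moreover have "(cmod (complex_of_real c))\<^sup>2 *\<^sub>R (z * u) = complex_of_real c * (complex_of_real c * z * u)" for z u
        by (simp add: scaleR_conv_of_real power2_eq_square mult.assoc)
      ultimately show ?thesis by (simp only:)
    qed
    also have "\<dots> = complex_of_real c * fourier (\<lambda>x. complex_of_real c * f (inverse r *\<^sub>R x)) \<xi>"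
      by (simp only: integral_mult_right_zero fourier_def)
    finally show ?thesis using c by (simp add: field_simps)
  qed
  then have "fourier (\<lambda>x. complex_of_real c * f (inverse r *\<^sub>R x)) = (\<lambda>\<xi>. complex_of_real (inverse c) * fourier f (r *\<^sub>R \<xi>))" by blast
  then show "fourier_L2 (dilate r (L2_of f)) = dilate (inverse r) (L2_of (fourier f))"
    using f fourier_L2_of[OF t] fourier_L2_of[OF f]
      subst_op_L2_of[OF iso, of f] subst_op_L2_of[OF isometric_subst_dilate[OF r', where 'n = 'n], of "fourier f"]
    unfolding dilate_eq_subst c_def[symmetric] c' by (simp add: L1L2_def)
qed

text \<open>\<open>matrix_inv\<close> is chosen among the two-sided inverses; the transpose is one
  of them, and an inverse is unique.\<close>

lemma matrix_inv_orthogonal: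
  assumes "orthogonal_matrix (A :: real^'n^'n)"
  shows "matrix_inv A = transpose A" "orthogonal_matrix (matrix_inv A)"
proof -
  show 1: "matrix_inv A = transpose A"
  proof -
    have A: "A ** transpose A = mat 1" "transpose A ** A = mat 1"
      using assms by (auto simp: orthogonal_matrix_def)
    then have "A ** matrix_inv A = mat 1"
      unfolding matrix_inv_def by (metis (mono_tags, lifting) someI_ex)
    then have "transpose A ** (A ** matrix_inv A) = transpose A" by simp
    then show ?thesis by (simp add: matrix_mul_assoc A)
  qed
  show "orthogonal_matrix (matrix_inv A)"
    using assms by (simp add: 1 orthogonal_matrix_transpose)
qed

lemma L2_isometry_rho: "orthogonal_matrix A \<Longrightarrow> L2_isometry (rho A)"
  unfolding rho_eq_subst by (intro L2_isometry_subst_op isometric_subst_orthogonal matrix_inv_orthogonal)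

lemma fourier_L2_rho:
  fixes f :: "(real^'n) L2"
  assumes A: "orthogonal_matrix A"
  shows "fourier_L2 (rho A f) = rho A (fourier_L2 f)"
proof (rule fourier_L2_intertwine[OF L2_isometry_rho[OF A] L2_isometry_rho[OF A]])
  fix f :: "real^'n \<Rightarrow> complex" assume f: "L1L2 f"
  define B where "B = matrix_inv A"
  have B: "orthogonal_matrix B" using matrix_inv_orthogonal[OF A] by (simp add: B_def)
  note iso = isometric_subst_orthogonal[OF B]
  have t: "L1L2 (\<lambda>x. f (B *v x))" using L1L2_subst[OF iso f, where c = 1] by simp
  have ip: "(B *v x) \<bullet> (B *v y) = x \<bullet> y" for x y
    using B orthogonal_transformation_matrix[of "(*v) B"]
    by (simp add: orthogonal_transformation_def matrix_of_matrix_vector_mul)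
  have "fourier (\<lambda>x. f (B *v x)) = (\<lambda>\<xi>. fourier f (B *v \<xi>))"
  proof
    fix \<xi>
    have "fourier f (B *v \<xi>) = (LINT x|lborel. f (B *v x) * cis (- (2 * pi * ((B *v x) \<bullet> (B *v \<xi>)))))"
      using isometric_subst_integral(2)[OF iso, of "\<lambda>x. f x * cis (- (2 * pi * (x \<bullet> (B *v \<xi>))))"]
        f by (simp add: L1L2_def fourier_def integrable_fourier_integrand)
    then show "fourier (\<lambda>x. f (B *v x)) \<xi> = fourier f (B *v \<xi>)" by (simp add: ip fourier_def)
  qed
  then show "fourier_L2 (rho A (L2_of f)) = rho A (L2_of (fourier f))"
    using f fourier_L2_of[OF t] fourier_L2_of[OF f]
    by (simp add: rho_eq_subst B_def[symmetric] subst_op_L2_of[OF iso] L1L2_def)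
qed

section \<open>Reflection, conjugation and Fourier inversion\<close>

definition reflect_L2 :: "'a::euclidean_space L2 \<Rightarrow> 'a L2" where
  "reflect_L2 = subst_op (\<lambda>x. 1) (\<lambda>x. - x)"

lemma isometric_subst_reflect: "isometric_subst (\<lambda>x. 1) (\<lambda>x. - x)"
proof -
  have "(\<integral>\<^sup>+x. F (- x) \<partial>lborel) = (\<integral>\<^sup>+x. F x \<partial>lborel)"
    if [measurable]: "F \<in> borel_measurable borel" for F :: "'a \<Rightarrow> ennreal"
    using distr_lborel_reflect[of "0::'a"] by (subst (2) distr_lborel_reflect[of 0, symmetric]) (simp add: nn_integral_distr)
  then show ?thesis by (simp add: isometric_subst_def)
qed

lemma reflect_L2_of: "square_integrable f \<Longrightarrow> reflect_L2 (L2_of f) = L2_of (\<lambda>x. f (- x))"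
  by (simp add: reflect_L2_def subst_op_L2_of[OF isometric_subst_reflect])

lemma square_integrable_reflect: "square_integrable f \<Longrightarrow> square_integrable (\<lambda>x. f (- x))"
  using square_integrable_subst[OF isometric_subst_reflect] by fastforce

lemma reflect_reflect_L2: "reflect_L2 (reflect_L2 f) = f"
proof -
  have "reflect_L2 (reflect_L2 (L2_of (rep_L2 f))) = L2_of (rep_L2 f)"
    by (subst reflect_L2_of[OF square_integrable_rep_L2])
      (simp add: reflect_L2_of square_integrable_reflect square_integrable_rep_L2 del: L2_of_rep)
  then show ?thesis by simp
qed

lemma L1L2_reflect: "L1L2 f \<Longrightarrow> L1L2 (\<lambda>x. f (- x))"
  using L1L2_subst[OF isometric_subst_reflect, where f = f and c = 1] by simp

lemma fourier_reflect: "L1L2 f \<Longrightarrow> fourier (\<lambda>x. f (- x)) \<xi> = fourier f (- \<xi>)"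
  using isometric_subst_integral(2)[OF isometric_subst_reflect, of "\<lambda>x. f x * cis (- (2 * pi * (x \<bullet> (- \<xi>))))"]
  by (simp add: L1L2_def fourier_def integrable_fourier_integrand[of f "- \<xi>", simplified])

text \<open>Unitarity and the multiplication formula together give \<open>\<F>\<^sup>2 f = f(-\<cdot>)\<close>:
  for \<open>u = cnj g(-\<cdot>)\<close> one has \<open>\<langle>f, u\<rangle> = \<langle>\<F> f, \<F> u\<rangle> = \<integral> \<F> f \<cdot> \<F> g = \<langle>f, cnj (\<F> \<F> g)\<rangle>\<close>.\<close>

definition conj_L2 :: "'a::euclidean_space L2 \<Rightarrow> 'a L2" where
  "conj_L2 f = L2_of (\<lambda>x. cnj (rep_L2 f x))"

lemma square_integrable_cnj: "square_integrable f \<Longrightarrow> square_integrable (\<lambda>x. cnj (f x))"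
  by (rule square_integrable_bound) (auto simp: square_integrable_def)

lemma conj_L2_of:
  assumes "square_integrable f"
  shows "conj_L2 (L2_of f) = L2_of (\<lambda>x. cnj (f x))"
  unfolding conj_L2_def
proof (rule L2_of_cong_AE)
  show "AE x in lborel. cnj (rep_L2 (L2_of f) x) = cnj (f x)"
    using rep_L2_of[OF assms] by eventually_elim simp
qed (intro square_integrable_cnj assms square_integrable_rep_L2)+

lemma conj_L2:
  fixes f :: "'a::euclidean_space L2"
  shows "conj_L2 (conj_L2 f) = f" "continuous_on UNIV (conj_L2 :: 'a::euclidean_space L2 \<Rightarrow> _)"
proof -
  have rep: "f = L2_of (rep_L2 f)" for f :: "'a L2" by simp
  show "conj_L2 (conj_L2 f) = f"
    by (subst (1 2) rep) (simp add: conj_L2_of square_integrable_cnj square_integrable_rep_L2 del: L2_of_rep, simp)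
  have "dist (conj_L2 (L2_of u)) (conj_L2 (L2_of v)) = dist (L2_of u) (L2_of v)"
    if "square_integrable u" "square_integrable v" for u v :: "'a \<Rightarrow> complex"
    using that
    by (simp add: dist_norm conj_L2_of L2_of_diff square_integrable_cnj norm_L2_of square_integrable_diff
        flip: complex_cnj_diff)
  from this[OF square_integrable_rep_L2 square_integrable_rep_L2]
  have "dist (conj_L2 f) (conj_L2 g) = dist f g" for f g :: "'a L2" by simp
  then show "continuous_on UNIV (conj_L2 :: 'a::euclidean_space L2 \<Rightarrow> _)"
    unfolding continuous_on_iff by auto
qed

lemma fourier_L2_reflect: "fourier_L2 (reflect_L2 f) = reflect_L2 (fourier_L2 f)"
proof (rule fourier_L2_intertwine)
  show "L2_isometry (reflect_L2 :: 'a L2 \<Rightarrow> _)" "L2_isometry (reflect_L2 :: 'a L2 \<Rightarrow> _)"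
    by (simp_all add: reflect_L2_def L2_isometry_subst_op isometric_subst_reflect)
  fix f :: "'a \<Rightarrow> complex" assume f: "L1L2 f"
  then show "fourier_L2 (reflect_L2 (L2_of f)) = reflect_L2 (L2_of (fourier f))"
    using fourier_L2_of(1)[OF f] fourier_L2_of(2)[OF L1L2_reflect[OF f]]
    by (simp add: reflect_L2_of L1L2_def fourier_reflect[OF f, abs_def] flip: fun_eq_iff)
qed

text \<open>Conjugation is antilinear and hence no \<open>L2_isometry\<close>, so the density
  argument is run for it directly, with its continuity from \<open>conj_L2\<close>.\<close>

lemma fourier_L2_conj: "fourier_L2 (conj_L2 f) = reflect_L2 (conj_L2 (fourier_L2 f))"
proof -
  have "(\<lambda>f::'a L2. fourier_L2 (conj_L2 f)) = (\<lambda>f. reflect_L2 (conj_L2 (fourier_L2 f)))"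
  proof (rule L1L2_dense_eqI)
    have R: "L2_isometry (reflect_L2 :: 'a L2 \<Rightarrow> _)"
      by (simp add: reflect_L2_def L2_isometry_subst_op isometric_subst_reflect)
    show "continuous_on UNIV (\<lambda>f::'a L2. fourier_L2 (conj_L2 f))"
      by (rule continuous_on_compose2[OF L2_isometryD(4)[OF L2_isometry_fourier_L2, of UNIV] conj_L2(2)]) auto
    show "continuous_on UNIV (\<lambda>f::'a L2. reflect_L2 (conj_L2 (fourier_L2 f)))"
      by (rule continuous_on_compose2[OF L2_isometryD(4)[OF R, of UNIV]
            continuous_on_compose2[OF conj_L2(2) L2_isometryD(4)[OF L2_isometry_fourier_L2, of UNIV]]]) auto
    fix f :: "'a \<Rightarrow> complex" assume f: "L1L2 f"
    have c: "L1L2 (\<lambda>x. cnj (f x))" using f by (simp add: L1L2_def square_integrable_cnj)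
    have "fourier (\<lambda>x. cnj (f x)) = (\<lambda>\<xi>. cnj (fourier f (- \<xi>)))"
      unfolding fourier_def fun_eq_iff Bochner_Integration.integral_cnj[symmetric] by (simp add: cis_cnj)
    then show "fourier_L2 (conj_L2 (L2_of f)) = reflect_L2 (conj_L2 (fourier_L2 (L2_of f)))"
      using f fourier_L2_of[OF f] fourier_L2_of(2)[OF c]
      by (simp add: conj_L2_of reflect_L2_of square_integrable_cnj L1L2_def)
  qed
  then show ?thesis by metis
qed

text \<open>Conjugating the second entry undoes the conjugation in \<open>cinner_L2\<close>, so on
  functions both sides are the bilinear integrals of the multiplication formula. Density is used for
  one entry at a time.\<close>

lemma fourier_L2_multiplication: "cinner_L2 (fourier_L2 f) (conj_L2 g) = cinner_L2 f (conj_L2 (fourier_L2 g))"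
proof -
  have cont: "continuous_on UNIV (\<lambda>f. cinner_L2 (S f) (T f))"
    if "continuous_on UNIV S" "continuous_on UNIV T" for S T :: "'a L2 \<Rightarrow> 'a L2"
    unfolding cinner_L2_inner Complex_eq
    by (intro continuous_intros that bounded_linear.continuous_on[OF bounded_linear_scaleC_L2])
  have F: "continuous_on UNIV (fourier_L2 :: 'a L2 \<Rightarrow> _)" by (rule L2_isometryD(4)[OF L2_isometry_fourier_L2])
  have CF: "continuous_on UNIV (\<lambda>f::'a L2. conj_L2 (fourier_L2 f))"
    by (rule continuous_on_compose2[OF conj_L2(2) F]) auto
  have basic: "cinner_L2 (fourier_L2 (L2_of f)) (conj_L2 (L2_of g)) = cinner_L2 (L2_of f) (conj_L2 (fourier_L2 (L2_of g)))"
    if f: "L1L2 f" and g: "L1L2 g" for f g :: "'a \<Rightarrow> complex"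
  proof -
    have "cinner_L2 (fourier_L2 (L2_of f)) (conj_L2 (L2_of g)) = (LINT x|lborel. fourier f x * cnj (cnj (g x)))"
      using f g fourier_L2_of[OF f] by (simp only: conj_L2_of cinner_L2_of L1L2_def square_integrable_cnj)
    also have "\<dots> = (LINT x|lborel. f x * cnj (cnj (fourier g x)))"
      using fourier_multiplication_formula[of f g] f g by (simp add: L1L2_def)
    also have "\<dots> = cinner_L2 (L2_of f) (conj_L2 (fourier_L2 (L2_of g)))"
      using f g fourier_L2_of[OF g] by (simp only: conj_L2_of cinner_L2_of L1L2_def square_integrable_cnj)
    finally show ?thesis .
  qed
  have "(\<lambda>f. cinner_L2 (fourier_L2 f) (conj_L2 (L2_of v))) = (\<lambda>f. cinner_L2 f (conj_L2 (fourier_L2 (L2_of v))))"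
    if "L1L2 v" for v :: "'a \<Rightarrow> complex"
    by (rule L1L2_dense_eqI) (intro cont F continuous_on_id continuous_on_const basic that)+
  then have "cinner_L2 (fourier_L2 f) (conj_L2 (L2_of v)) = cinner_L2 f (conj_L2 (fourier_L2 (L2_of v)))"
    if "L1L2 v" for v :: "'a \<Rightarrow> complex" using that by metis
  then have "(\<lambda>g. cinner_L2 (fourier_L2 f) (conj_L2 g)) = (\<lambda>g. cinner_L2 f (conj_L2 (fourier_L2 g)))"
    by (intro L1L2_dense_eqI cont CF conj_L2(2) continuous_on_const)
  then show ?thesis by metis
qed

lemma fourier_L2_fourier_L2: "fourier_L2 (fourier_L2 f) = reflect_L2 (f :: 'a::euclidean_space L2)"
proof -
  have rc: "reflect_L2 (conj_L2 f) = conj_L2 (reflect_L2 f)" for f :: "'a L2"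
  proof -
    have "reflect_L2 (conj_L2 (L2_of (rep_L2 f))) = conj_L2 (reflect_L2 (L2_of (rep_L2 f)))"
      by (simp add: reflect_L2_of conj_L2_of square_integrable_cnj square_integrable_reflect square_integrable_rep_L2 del: L2_of_rep)
    then show ?thesis by simp
  qed
  have "cinner_L2 h (conj_L2 (fourier_L2 (fourier_L2 f))) = cinner_L2 h (conj_L2 (reflect_L2 f))" for h
  proof -
    have "cinner_L2 h (conj_L2 (fourier_L2 (fourier_L2 f))) = cinner_L2 (fourier_L2 h) (conj_L2 (fourier_L2 f))"
      by (rule fourier_L2_multiplication[symmetric])
    also have "conj_L2 (fourier_L2 f) = fourier_L2 (conj_L2 (reflect_L2 f))"
      by (simp add: fourier_L2_conj rc[symmetric] reflect_reflect_L2 fourier_L2_reflect)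
    also have "cinner_L2 (fourier_L2 h) \<dots> = cinner_L2 h (conj_L2 (reflect_L2 f))"
      by (rule L2_isometry_cinner[OF L2_isometry_fourier_L2])
    finally show ?thesis .
  qed
  then have "inner (conj_L2 (fourier_L2 (fourier_L2 f))) h = inner (conj_L2 (reflect_L2 f)) h" for h
    by (subst (1 2) inner_commute) (simp add: inner_L2_def)
  then have "conj_L2 (fourier_L2 (fourier_L2 f)) = conj_L2 (reflect_L2 f)"
    by (rule L2_eqI)
  then show ?thesis by (metis conj_L2(1))
qed

lemma bij_fourier_L2: "bij (fourier_L2 :: 'a::euclidean_space L2 \<Rightarrow> _)"
proof (rule bijI)
  show "inj (fourier_L2 :: 'a L2 \<Rightarrow> _)" by (rule L2_isometry_inj[OF L2_isometry_fourier_L2])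
  \<comment> \<open>The square of the transform being the reflection,
    \<open>reflect_L2 (fourier_L2 f)\<close> is an explicit preimage of \<open>f\<close>.\<close>
  have "f = fourier_L2 (reflect_L2 (fourier_L2 f))" for f :: "'a L2"
    by (simp add: fourier_L2_reflect fourier_L2_fourier_L2 reflect_reflect_L2)
  then show "surj (fourier_L2 :: 'a L2 \<Rightarrow> _)" by (rule surjI[OF sym])
qed

lemma fourier_L2_inverse [simp]:
  "fourier_L2 (inverse_fourier_L2 f) = f" "inverse_fourier_L2 (fourier_L2 f) = f"
  unfolding inverse_fourier_L2_def
  by (simp_all add: bij_fourier_L2 bij_is_surj surj_f_inv_f bij_is_inj inv_f_f)

lemma L2_isometry_inverse_fourier_L2: "L2_isometry inverse_fourier_L2"
proof -
  note F = L2_linearD[OF L2_isometryD(1)[OF L2_isometry_fourier_L2]]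
  have "inverse_fourier_L2 (f + g) = inverse_fourier_L2 f + inverse_fourier_L2 g" for f g :: "'a L2"
    by (metis F(1) fourier_L2_inverse)
  moreover have "inverse_fourier_L2 (c *\<^sub>C f) = c *\<^sub>C inverse_fourier_L2 f" for c and f :: "'a L2"
    by (metis F(2) fourier_L2_inverse)
  moreover have "norm (inverse_fourier_L2 f) = norm f" for f :: "'a L2"
    by (metis L2_isometryD(2)[OF L2_isometry_fourier_L2] fourier_L2_inverse(1))
  ultimately show ?thesis by (simp add: L2_isometry_def L2_linear_def)
qed

text \<open>The formula is \<open>fourier\<close> of the reflected function, so the square of the
  transform identifies it as a preimage. This links the integral in \<open>wave_packet\<close> with
  \<open>fourier_L2\<close>.\<close>

lemma inverse_fourier:
  assumes "L1L2 f"
  shows "square_integrable (inverse_fourier f)" "fourier_L2 (L2_of (inverse_fourier f)) = L2_of f"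
proof -
  have eq: "inverse_fourier f = fourier (\<lambda>x. f (- x))"
    unfolding fun_eq_iff fourier_reflect[OF assms]
    by (simp add: inverse_fourier_def fourier_def inner_commute)
  show "square_integrable (inverse_fourier f)" unfolding eq by (rule fourier_L2_of(1)[OF L1L2_reflect[OF assms]])
  have "square_integrable f" using assms by (simp add: L1L2_def)
  then show "fourier_L2 (L2_of (inverse_fourier f)) = L2_of f"
    unfolding eq fourier_L2_of(2)[OF L1L2_reflect[OF assms], symmetric]
    by (simp add: fourier_L2_fourier_L2 reflect_L2_of square_integrable_reflect)
qed

section \<open>Dyadic cubes and frame operators\<close>

text \<open>The rank of \<open>x\<close>, the number of elements up to and including
  \<open>x\<close>, is a bijection onto \<open>{1..card A}\<close>, and \<open>q\<close> inverts it.
  This supplies the labelling that \<open>child\<close> chooses.\<close>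

lemma finite_strict_order_enumeration:
  assumes A: "finite A" and irrefl: "\<And>x. \<not> r x x" and trans: "\<And>x y z. r x y \<Longrightarrow> r y z \<Longrightarrow> r x z"
    and total: "\<And>x y. x \<in> A \<Longrightarrow> y \<in> A \<Longrightarrow> x \<noteq> y \<Longrightarrow> r x y \<or> r y x"
  shows "\<exists>q. bij_betw q {1..card A} A \<and> (\<forall>i\<in>{1..card A}. \<forall>j\<in>{1..card A}. i < j \<longrightarrow> r (q i) (q j))"
proof -
  define rank where "rank x = card {y \<in> A. r y x \<or> y = x}" for x
  have mono: "rank x < rank y" if "x \<in> A" "y \<in> A" "r x y" for x y
    unfolding rank_def
  proof (rule psubset_card_mono)
    show "{z \<in> A. r z x \<or> z = x} \<subset> {z \<in> A. r z y \<or> z = y}"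
      using that trans irrefl by blast
  qed (use A in simp)
  have inj: "inj_on rank A"
    by (rule inj_onI) (metis mono total less_irrefl)
  have "rank ` A \<subseteq> {1..card A}"
  proof
    fix k assume "k \<in> rank ` A"
    then obtain x where x: "x \<in> A" "k = rank x" by blast
    have "card {y \<in> A. r y x \<or> y = x} \<noteq> 0" using x(1) A by auto
    moreover have "card {y \<in> A. r y x \<or> y = x} \<le> card A" using A by (intro card_mono) auto
    ultimately show "k \<in> {1..card A}" by (simp add: x(2) rank_def)
  qed
  moreover have "card (rank ` A) = card {1..card A}" using inj by (simp add: card_image)
  ultimately have "rank ` A = {1..card A}" by (intro card_subset_eq) auto
  with inj have bij: "bij_betw rank A {1..card A}" by (simp add: bij_betw_def)
  define q where "q = inv_into A rank"
  have q: "bij_betw q {1..card A} A" unfolding q_def by (rule bij_betw_inv_into[OF bij])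
  have rq: "rank (q i) = i" "q i \<in> A" if "i \<in> {1..card A}" for i
    using bij q that by (auto simp: q_def bij_betw_inv_into_right bij_betw_apply)
  have "r (q i) (q j)" if "i \<in> {1..card A}" "j \<in> {1..card A}" "i < j" for i j
    using total[of "q i" "q j"] mono[of "q j" "q i"] rq[OF that(1)] rq[OF that(2)] that(3) by fastforce
  with q show ?thesis by blast
qed

text \<open>The bit \<open>e $ j\<close> tells whether the child takes the lower or the upper half
  in coordinate \<open>j\<close>.\<close>

definition child_at :: "'n::finite dyadic \<Rightarrow> bool^'n \<Rightarrow> 'n dyadic" where
  "child_at Q e = (fst Q + 1, \<chi> j. 2 * snd Q $ j + (if e $ j then 1 else 0))"

lemma two_powi_minus: "(2::real) powi (- \<nu>) = 2 * 2 powi (- (\<nu> + 1))"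
  using power_int_add[of "2::real" "- (\<nu> + 1)" 1] by (simp add: mult.commute)

lemma dyadic_child_bounds:
  fixes s t m x :: real
  assumes "0 < s" "s * (2 * m + t) \<le> x" "x < s * (2 * m + t + 1)" "0 \<le> t" "t \<le> 1"
  shows "2 * s * m \<le> x \<and> x < 2 * s * (m + 1)"
proof -
  have "s * (2 * m) \<le> s * (2 * m + t)" "s * (2 * m + t + 1) \<le> s * (2 * (m + 1))"
    using assms by (intro mult_left_mono; simp)+
  then have "s * (2 * m) \<le> x" "x < s * (2 * (m + 1))"
    using assms(2,3) by (blast intro: order_trans less_le_trans)+
  then show ?thesis by (simp only: mult_ac)
qed

lemma children_eq: "children (Q :: 'n::finite dyadic) = range (child_at Q)"
proof -
  obtain \<nu> m where Q: "Q = (\<nu>, m)" by (cases Q)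
  define s :: real where "s = 2 powi (- (\<nu> + 1))"
  have s: "s > 0" by (simp add: s_def)
  have s2: "2 powi (- \<nu>) = 2 * s" unfolding s_def by (rule two_powi_minus)
  have cube: "dyadic_cube (\<nu> + 1, k) = {x. \<forall>j. s * of_int (k $ j) \<le> x $ j \<and> x $ j < s * (of_int (k $ j) + 1)}" for k :: "int^'n"
    by (simp add: s_def)
  have cubeQ: "dyadic_cube Q = {x. \<forall>j. 2 * s * of_int (m $ j) \<le> x $ j \<and> x $ j < 2 * s * (of_int (m $ j) + 1)}"
    by (simp add: Q s2)
  show ?thesis
  proof (intro set_eqI iffI)
    fix Q' assume "Q' \<in> children Q"
    then obtain k where k: "Q' = (\<nu> + 1, k)" "dyadic_cube (\<nu> + 1, k) \<subseteq> dyadic_cube Q"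
      by (cases Q') (auto simp: children_def Q)
    \<comment> \<open>The lower corner of the child decides: since it lies in the half-open parent,
      \<open>k $ j\<close> is at least \<open>2 * m $ j\<close> and less than
      \<open>2 * m $ j + 2\<close>, which leaves two values for each coordinate.\<close>
    have "(\<chi> j. s * of_int (k $ j)) \<in> dyadic_cube (\<nu> + 1, k)"
      unfolding cube using s by simp
    with k(2) have "(\<chi> j. s * of_int (k $ j)) \<in> dyadic_cube Q" by blast
    then have "s * (2 * of_int (m $ j)) \<le> s * of_int (k $ j)" "s * of_int (k $ j) < s * (2 * (of_int (m $ j) + 1))" for j
      unfolding cubeQ by (auto simp: mult_ac)
    then have "(2 * of_int (m $ j) :: real) \<le> of_int (k $ j)" "(of_int (k $ j) :: real) < 2 * (of_int (m $ j) + 1)" for j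
      using s by auto
    then have "2 * m $ j \<le> k $ j" "k $ j < 2 * (m $ j + 1)" for j
      by (simp_all flip: of_int_le_iff[where 'a = real] of_int_less_iff[where 'a = real])
    then have "k $ j = 2 * m $ j + (if k $ j \<noteq> 2 * m $ j then 1 else 0)" for j
      by (smt (verit))
    then have "Q' = child_at Q (\<chi> j. k $ j \<noteq> 2 * m $ j)"
      by (simp add: child_at_def k(1) Q vec_eq_iff)
    then show "Q' \<in> range (child_at Q)" by blast
  next
    fix Q' assume "Q' \<in> range (child_at Q)"
    then obtain e where e: "Q' = child_at Q e" by blast
    have "dyadic_cube Q' \<subseteq> dyadic_cube Q"
      unfolding e child_at_def Q fst_conv snd_conv cube cubeQ[unfolded Q]
    proof (intro subsetI CollectI allI)
      fix x j assume x: "x \<in> {x. \<forall>j. s * of_int ((\<chi> j. 2 * m $ j + (if e $ j then 1 else 0)) $ j) \<le> x $ j \<and>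
          x $ j < s * (of_int ((\<chi> j. 2 * m $ j + (if e $ j then 1 else 0)) $ j) + 1)}"
      define t :: real where "t = (if e $ j then 1 else 0)"
      have "s * (2 * of_int (m $ j) + t) \<le> x $ j" "x $ j < s * (2 * of_int (m $ j) + t + 1)"
        using x by (auto simp: t_def split: if_splits)
      moreover have "0 \<le> t" "t \<le> 1" by (auto simp: t_def)
      ultimately show "2 * s * of_int (m $ j) \<le> x $ j \<and> x $ j < 2 * s * (of_int (m $ j) + 1)"
        by (intro dyadic_child_bounds s)
    qed
    then show "Q' \<in> children Q" by (auto simp: children_def e child_at_def)
  qed
qed

lemma inj_child_at: "inj (child_at Q)"
proof (rule injI)
  fix e e' assume "child_at Q e = child_at Q e'"
  then have "(if e $ j then 1 else 0 :: int) = (if e' $ j then 1 else 0)" for j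
    by (simp add: child_at_def vec_eq_iff)
  then show "e = e'" unfolding vec_eq_iff by (metis zero_neq_one)
qed

lemma dyadic_center_child_at:
  "dyadic_center (child_at Q e) $ j =
    2 powi (- (fst Q + 1)) * (2 * of_int (snd Q $ j) + (if e $ j then 1 else 0) + 1 / 2)"
  by (cases Q) (simp add: child_at_def)

text \<open>The label 1 gives the frequency of a packet, the label \<open>2 ^ CARD('n)\<close> the
  condition on \<open>\<eta>\<close>. The centers of these two children are extreme in every
  coordinate at once, hence also lexicographically.\<close>

lemma child_extreme:
  fixes Q :: "'n::{finite,linorder} dyadic"
  shows "child Q 1 = child_at Q (\<chi> j. False)" "child Q (2 ^ CARD('n)) = child_at Q (\<chi> j. True)"
proof -
  let ?r = "\<lambda>Q Q' :: 'n dyadic. less_fun (($) (dyadic_center Q)) (($) (dyadic_center Q'))"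
  let ?N = "2 ^ CARD('n) :: nat"
  have fin: "finite (children Q)" and card: "card (children Q) = ?N"
    by (simp_all add: children_eq card_image[OF inj_child_at])
  have pos: "(0::real) < 2 powi k" for k :: int by simp
  have "\<exists>q. bij_betw q {1..card (children Q)} (children Q) \<and>
     (\<forall>i\<in>{1..card (children Q)}. \<forall>j\<in>{1..card (children Q)}. i < j \<longrightarrow> ?r (q i) (q j))"
  proof (rule finite_strict_order_enumeration[OF fin])
    fix P P' assume "P \<in> children Q" "P' \<in> children Q" "P \<noteq> P'"
    then obtain e e' where e: "P = child_at Q e" "P' = child_at Q e'" "e \<noteq> e'"
      by (auto simp: children_eq)
    then obtain j where "e $ j \<noteq> e' $ j" by (auto simp: vec_eq_iff)
    then have "dyadic_center P $ j \<noteq> dyadic_center P' $ j"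
      unfolding e dyadic_center_child_at using pos[of "- (fst Q + 1)"] by (auto simp: algebra_simps)
    then have "($) (dyadic_center P) \<noteq> ($) (dyadic_center P')" by metis
    then show "?r P P' \<or> ?r P' P"
      using less_fun_trichotomy[of "($) (dyadic_center P)" "($) (dyadic_center P')"] by auto
  qed (auto simp: less_fun_irrefl intro: less_fun_trans)
  then have "\<exists>q. bij_betw q {1..?N} (children Q) \<and>
     (\<forall>i\<in>{1..?N}. \<forall>j\<in>{1..?N}. i < j \<longrightarrow> ?r (q i) (q j))"
    unfolding card .
  from someI_ex[OF this] have bij: "bij_betw (child Q) {1..?N} (children Q)"
    and incr: "\<And>i j. i \<in> {1..?N} \<Longrightarrow> j \<in> {1..?N} \<Longrightarrow> i < j \<Longrightarrow> ?r (child Q i) (child Q j)"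
    unfolding child_def by blast+
  have N: "1 \<in> {1..?N}" "?N \<in> {1..?N}" by auto
  have "child_at Q (\<chi> j. False) \<in> child Q ` {1..?N}"
    using bij by (simp add: bij_betw_def children_eq)
  then obtain i where i: "i \<in> {1..?N}" "child Q i = child_at Q (\<chi> j. False)" by (elim imageE) simp
  have "i = 1"
  proof (rule ccontr)
    assume "i \<noteq> 1"
    with i(1) have "1 < i" by auto
    then have "?r (child Q 1) (child_at Q (\<chi> j. False))" using incr[OF N(1) i(1)] i(2) by simp
    moreover obtain e where "child Q 1 = child_at Q e"
      using bij_betw_apply[OF bij N(1)] by (auto simp: children_eq)
    \<comment> \<open>Lexicographically smaller entails strictly smaller in some coordinate, which
      no bit of the other child allows.\<close>
    ultimately obtain k where "dyadic_center (child_at Q e) $ k < dyadic_center (child_at Q (\<chi> j. False)) $ k"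
      by (auto elim: less_funE)
    then show False
      unfolding dyadic_center_child_at using pos[of "- (fst Q + 1)"] by (auto split: if_splits)
  qed
  with i show "child Q 1 = child_at Q (\<chi> j. False)" by simp
  have "child_at Q (\<chi> j. True) \<in> child Q ` {1..?N}"
    using bij by (simp add: bij_betw_def children_eq)
  then obtain i where i: "i \<in> {1..?N}" "child Q i = child_at Q (\<chi> j. True)" by (elim imageE) simp
  have "i = ?N"
  proof (rule ccontr)
    assume "i \<noteq> ?N"
    with i(1) have "i < ?N" by auto
    then have "?r (child_at Q (\<chi> j. True)) (child Q ?N)" using incr[OF i(1) N(2)] i(2) by simp
    moreover obtain e where "child Q ?N = child_at Q e"
      using bij_betw_apply[OF bij N(2)] by (auto simp: children_eq)
    ultimately obtain k where "dyadic_center (child_at Q (\<chi> j. True)) $ k < dyadic_center (child_at Q e) $ k"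
      by (auto elim: less_funE)
    then show False
      unfolding dyadic_center_child_at using pos[of "- (fst Q + 1)"] by (auto split: if_splits)
  qed
  with i show "child Q (2 ^ CARD('n)) = child_at Q (\<chi> j. True)" by simp
qed

text \<open>The half-open cube lies between an open and a closed box of the same volume.\<close>

lemma measure_dyadic_cube:
  "measure lborel (dyadic_cube (\<nu>, m :: int^'n::finite)) = 2 powi (- \<nu> * int CARD('n))"
proof -
  define s :: real where "s = 2 powi (- \<nu>)"
  have s: "s > 0" by (simp add: s_def)
  define a b :: "real^'n" where "a = (\<chi> j. s * of_int (m $ j))" and "b = (\<chi> j. s * (of_int (m $ j) + 1))"
  have ab: "b $ j - a $ j = s" for j by (simp add: a_def b_def algebra_simps)
  have S: "dyadic_cube (\<nu>, m) = {x. \<forall>j. a $ j \<le> x $ j \<and> x $ j < b $ j}"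
    by (simp add: a_def b_def s_def)
  have [measurable]: "dyadic_cube (\<nu>, m) \<in> sets borel"
  proof -
    have "{x :: real^'n. \<forall>j. a $ j \<le> x $ j \<and> x $ j < b $ j} = (\<Inter>j. {x. a $ j \<le> x $ j} \<inter> {x. x $ j < b $ j})" by auto
    also have "\<dots> \<in> sets borel"
      by (intro sets.finite_INT sets.Int borel_closed borel_open closed_Collect_le open_Collect_less continuous_intros) auto
    finally show ?thesis by (simp only: S)
  qed
  have p: "(\<Prod>i\<in>Basis. (b - a) \<bullet> i) = s ^ CARD('n)"
  proof -
    have "(b - a) \<bullet> i = s" if "i \<in> Basis" for i :: "real^'n"
      using that ab by (auto simp: Basis_vec_def inner_axis)
    then show ?thesis by simp
  qed
  have le: "a \<bullet> i \<le> b \<bullet> i" if "i \<in> Basis" for i :: "real^'n"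
    using that s by (auto simp: Basis_vec_def inner_axis a_def b_def)
  have "emeasure lborel (box a b) \<le> emeasure lborel (dyadic_cube (\<nu>, m))"
    by (intro emeasure_mono) (auto simp: S mem_box_cart less_imp_le simp del: dyadic_cube.simps)
  moreover have "emeasure lborel (dyadic_cube (\<nu>, m)) \<le> emeasure lborel (cbox a b)"
    by (intro emeasure_mono) (auto simp: S mem_box_cart less_imp_le simp del: dyadic_cube.simps)
  ultimately have "emeasure lborel (dyadic_cube (\<nu>, m)) = ennreal (s ^ CARD('n))"
    using le by (simp add: p)
  then show ?thesis
    using s unfolding measure_def s_def power_int_mult power_int_of_nat
    by (simp del: dyadic_cube.simps)
qed

lemma two_powi_inj:
  assumes "2 powi (i * int n) = (2 powi (j * int n) :: real)" "n > 0"
  shows "i = j"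
proof -
  have "i * int n = j * int n"
    using assms(1) power_int_strict_increasing[of "i * int n" "j * int n" "2::real"]
      power_int_strict_increasing[of "j * int n" "i * int n" "2::real"] by (cases rule: linorder_cases) auto
  then show ?thesis using assms(2) by simp
qed

section \<open>Reduction of the model operators to one frequency cube\<close>

text \<open>The last child of the frequency cube \<open>(l, j)\<close>, in coordinates multiplied by
  \<open>2 powi l\<close>.\<close>

definition upper_cell :: "int \<Rightarrow> int^'n \<Rightarrow> (real^'n::finite) set" where
  "upper_cell l j = {\<eta>. \<forall>i. of_int (j $ i) + 1 / 2 \<le> 2 powi l * \<eta> $ i \<and> 2 powi l * \<eta> $ i < of_int (j $ i) + 1}"

lemma dyadic_cube_last_child:
  fixes j :: "int^'n::{finite,linorder}"
  shows "dyadic_cube (child (l, j) (2 ^ CARD('n))) = upper_cell l j"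
proof -
  define s :: real where "s = 2 powi (- (l + 1))"
  have "2 powi l * (2 * s) = 1" unfolding s_def two_powi_minus[symmetric] by (simp add: power_int_minus)
  then have s: "s = inverse (2 * 2 powi l)" by (simp add: field_simps)
  have "(0::real) < 2 powi l" by simp
  then have pos: "s > 0" by (simp add: s)
  have y: "y = s * (2 * (2 powi l * y))" for y by (simp add: s)
  have le: "s * a \<le> y \<longleftrightarrow> a \<le> 2 * (2 powi l * y)" for a y by (subst y) (use pos in simp)
  have less: "y < s * a \<longleftrightarrow> 2 * (2 powi l * y) < a" for a y by (subst (1) y) (use pos in simp)
  have eq: "(s * (2 * a + 1) \<le> y \<and> y < s * (2 * a + 1 + 1)) \<longleftrightarrow> (a + 1 / 2 \<le> 2 powi l * y \<and> 2 powi l * y < a + 1)" for a y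
    unfolding le less by (auto simp: field_simps)
  show ?thesis
    unfolding child_extreme child_at_def upper_cell_def fst_conv snd_conv dyadic_cube.simps s_def[symmetric] eq[symmetric]
    by simp
qed

text \<open>\<open>\<eta>\<close> determines the frequency cube through the integer parts of its
  scaled coordinates, so the sum over tiles runs over the spatial index \<open>k\<close>
  alone.\<close>

lemma upper_cell_unique:
  assumes "\<eta> \<in> upper_cell l j"
  shows "j = (\<chi> i. \<lfloor>2 powi l * \<eta> $ i\<rfloor>)"
proof -
  have "\<lfloor>2 powi l * \<eta> $ i\<rfloor> = j $ i" for i
    using assms by (intro floor_unique) (auto simp: upper_cell_def dest: spec[of _ i])
  then show ?thesis by (simp add: vec_eq_iff)
qed

text \<open>In scaled coordinates the first child reaches from \<open>j $ i\<close> to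
  \<open>j $ i + 1/2\<close>, with midpoint at 1/4.\<close>

lemma dyadic_center_first_child:
  fixes j :: "int^'n::{finite,linorder}"
  shows "2 powi l * dyadic_center (child (l, j) 1) $ i = of_int (j $ i) + 1 / 4"
proof -
  have "2 powi l * (2 * 2 powi (- (l + 1))) = (1 :: real)"
    unfolding two_powi_minus[symmetric] by (simp add: power_int_minus)
  then have h: "2 powi l * 2 powi (- (l + 1)) = (1 / 2 :: real)" by simp
  show ?thesis
    unfolding child_extreme dyadic_center_child_at fst_conv snd_conv mult.assoc[symmetric] h by simp
qed

text \<open>The spatial cube \<open>(- l, k)\<close> has side \<open>2 powi l\<close>, the frequency
  cube \<open>(l, j)\<close> the reciprocal side.\<close>

definition packet :: "(real^'n::{finite,linorder} \<Rightarrow> real) \<Rightarrow> int \<Rightarrow> int^'n::{finite,linorder} \<Rightarrow> int^'n::{finite,linorder} \<Rightarrow> (real^'n::{finite,linorder}) L2" where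
  "packet \<Phi> l j k = wave_packet \<Phi> ((- l, k), (l, j))"

definition frame_op :: "('i \<Rightarrow> 'a::euclidean_space L2) \<Rightarrow> 'a L2 \<Rightarrow> 'a L2" where
  "frame_op \<phi> f = (\<Sum>\<^sub>\<infinity>k. cinner_L2 f (\<phi> k) *\<^sub>C \<phi> k)"

text \<open>The volume condition fixes the spatial level as \<open>- l\<close>, and membership in
  \<open>tiles\<close> then fixes the frequency level as \<open>l\<close>.\<close>

lemma model_op_index_set:
  fixes \<eta> :: "real^'n::{finite,linorder}"
  shows "{s \<in> tiles. \<eta> \<in> dyadic_cube (child (snd s) (2 ^ CARD('n))) \<and>
           measure lborel (dyadic_cube (fst s)) = 2 powi (l * int CARD('n))} =
         {((- l, k), (l, j)) |k j. \<eta> \<in> upper_cell l j}" (is "?A = ?B")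
proof (intro set_eqI iffI)
  fix s assume s: "s \<in> ?A"
  obtain \<nu> k \<nu>' j where st: "s = ((\<nu>, k), (\<nu>', j))" by (metis surj_pair)
  have "\<nu>' = - \<nu>" using s by (simp add: st tiles_def)
  moreover have "- \<nu> = l"
    using s by (intro two_powi_inj[of _ "CARD('n)"]) (simp_all add: st measure_dyadic_cube del: dyadic_cube.simps)
  ultimately have "\<nu> = - l" "\<nu>' = l" by auto
  then show "s \<in> ?B" using s by (simp add: st dyadic_cube_last_child)
qed (auto simp: tiles_def dyadic_cube_last_child measure_dyadic_cube simp del: dyadic_cube.simps)

lemma model_op_eq_frame_op:
  fixes \<eta> :: "real^'n::{finite,linorder}"
  assumes "\<eta> \<in> upper_cell l j"
  shows "model_op \<Phi> \<eta> l f = frame_op (packet \<Phi> l j) f"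
proof -
  have "j' = j" if "\<eta> \<in> upper_cell l j'" for j'
    using upper_cell_unique[OF assms] upper_cell_unique[OF that] by simp
  then have set: "{((- l, k), (l, j')) |k j'. \<eta> \<in> upper_cell l j'} = range (\<lambda>k. ((- l, k), (l, j)))"
    using assms by blast
  have "inj (\<lambda>k. ((- l, k), (l, j)))" by (simp add: inj_def)
  then show ?thesis
    unfolding model_op_def model_op_index_set set frame_op_def packet_def
    by (subst infsum_reindex) (simp_all add: o_def)
qed

lemma model_op_eq_0:
  fixes \<eta> :: "real^'n::{finite,linorder}"
  assumes "\<And>j. \<eta> \<notin> upper_cell l j"
  shows "model_op \<Phi> \<eta> l f = 0"
  using assms by (simp add: model_op_def model_op_index_set)

section \<open>Frame operators of systems with contractive synthesis\<close>

context
  fixes \<phi> :: "'i \<Rightarrow> 'a::euclidean_space L2"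
  assumes synthesis: "\<And>S c. finite S \<Longrightarrow> (norm (\<Sum>k\<in>S. c k *\<^sub>C \<phi> k))\<^sup>2 \<le> (\<Sum>k\<in>S. (cmod (c k))\<^sup>2)"
begin

text \<open>Duality: analysis is the adjoint of synthesis. Testing \<open>f\<close> against the
  synthesis \<open>g\<close> of its own coefficients gives
  \<open>B \<le> norm f * sqrt B\<close>.\<close>

lemma bessel_finite:
  assumes "finite S"
  shows "(\<Sum>k\<in>S. (cmod (cinner_L2 f (\<phi> k)))\<^sup>2) \<le> (norm f)\<^sup>2"
proof -
  define g where "g = (\<Sum>k\<in>S. cinner_L2 f (\<phi> k) *\<^sub>C \<phi> k)"
  define B where "B = (\<Sum>k\<in>S. (cmod (cinner_L2 f (\<phi> k)))\<^sup>2)"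
  have B: "B \<ge> 0" by (simp add: B_def sum_nonneg)
  have g: "(norm g)\<^sup>2 \<le> B" unfolding g_def B_def by (rule synthesis[OF assms])
  have "cinner_L2 f g = (\<Sum>k\<in>S. cinner_L2 f (\<phi> k) * cnj (cinner_L2 f (\<phi> k)))"
    by (simp add: g_def cinner_L2_sum_right cinner_L2_scaleC_right mult.commute)
  then have fg: "cinner_L2 f g = complex_of_real B"
    by (simp only: B_def of_real_sum complex_norm_square)
  have "B = cmod (cinner_L2 f g)" using B by (simp add: fg)
  also have "\<dots> \<le> norm f * norm g" by (rule norm_cinner_L2_le)
  finally have "B\<^sup>2 \<le> (norm f)\<^sup>2 * (norm g)\<^sup>2" using B by (metis power_mono power_mult_distrib)
  also have "\<dots> \<le> (norm f)\<^sup>2 * B" by (intro mult_left_mono g) simp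
  finally have "B * B \<le> (norm f)\<^sup>2 * B" by (simp add: power2_eq_square)
  then show ?thesis unfolding B_def[symmetric] using B by (cases "B = 0") auto
qed

text \<open>Bessel's inequality makes the squared coefficients summable, and synthesis turns small
  tails of coefficients into small tails of vectors. The partial sums are thus a Cauchy net in a
  complete space.\<close>

lemma frame_summable: "(\<lambda>k. cinner_L2 f (\<phi> k) *\<^sub>C \<phi> k) summable_on UNIV"
proof -
  define c where "c k = cinner_L2 f (\<phi> k)" for k
  let ?F = "finite_subsets_at_top (UNIV :: 'i set)" and ?s = "\<lambda>k. c k *\<^sub>C \<phi> k"
  have c: "(\<lambda>k. (cmod (c k))\<^sup>2) summable_on UNIV"
    by (rule nonneg_bdd_above_summable_on) (auto intro!: bdd_aboveI2 bessel_finite simp: c_def)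
  have "\<exists>P. eventually P ?F \<and> (\<forall>F F'. P F \<and> P F' \<longrightarrow> dist (sum ?s F) (sum ?s F') < e)" if "e > 0" for e
  proof -
    \<comment> \<open>Chosen so that every sum over a finite set containing \<open>F0\<close> is
      within \<open>e / 4\<close> of the sum over \<open>F0\<close>, hence any two such sums are
      within \<open>e / 2\<close>.\<close>
    define d where "d = (e / 4)\<^sup>2"
    have "d > 0" using that by (simp add: d_def)
    then obtain F0 where F0: "finite F0" "dist (\<Sum>k\<in>F0. (cmod (c k))\<^sup>2) (\<Sum>\<^sub>\<infinity>k. (cmod (c k))\<^sup>2) \<le> d"
      using infsum_finite_approximation[OF c] by blast
    have near: "dist (sum ?s F) (sum ?s F0) \<le> e / 4" if F: "finite F" "F0 \<subseteq> F" for F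
    proof -
      have "(\<Sum>k\<in>F. (cmod (c k))\<^sup>2) \<le> (\<Sum>\<^sub>\<infinity>k. (cmod (c k))\<^sup>2)"
        using F by (intro finite_sum_le_infsum c) auto
      then have "(\<Sum>k\<in>F - F0. (cmod (c k))\<^sup>2) \<le> d"
        using F0(2) F F0(1) by (simp add: sum_diff dist_real_def)
      then have "(norm (\<Sum>k\<in>F - F0. ?s k))\<^sup>2 \<le> (e / 4)\<^sup>2"
        using synthesis[of "F - F0" c] F by (simp add: d_def)
      then have "norm (\<Sum>k\<in>F - F0. ?s k) \<le> e / 4"
        by (rule power2_le_imp_le) (use \<open>e > 0\<close> in simp)
      then show ?thesis using F F0(1) by (simp add: sum_diff dist_norm)
    qed
    show ?thesis
    proof (intro exI[of _ "\<lambda>F. finite F \<and> F0 \<subseteq> F"] conjI allI impI)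
      show "\<forall>\<^sub>F F in ?F. finite F \<and> F0 \<subseteq> F"
        unfolding eventually_finite_subsets_at_top using F0(1) by blast
      fix F F' assume "(finite F \<and> F0 \<subseteq> F) \<and> finite F' \<and> F0 \<subseteq> F'"
      then have "dist (sum ?s F) (sum ?s F0) \<le> e / 4" "dist (sum ?s F') (sum ?s F0) \<le> e / 4"
        using near by auto
      then show "dist (sum ?s F) (sum ?s F') < e"
        using dist_triangle2[of "sum ?s F" "sum ?s F'" "sum ?s F0"] \<open>e > 0\<close> by linarith
    qed
  qed
  then have "cauchy_filter (filtermap (sum ?s) ?F)"
    by (simp add: cauchy_filter_metric_filtermap)
  moreover have "complete (UNIV :: 'a L2 set)"
    by (meson Cauchy_convergent UNIV_I complete_def convergent_def)
  ultimately obtain L' where "(sum ?s \<longlongrightarrow> L') ?F"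
    using complete_uniform[where S=UNIV] by (force simp add: filterlim_def)
  then show ?thesis
    unfolding c_def using summable_on_def has_sum_def by blast
qed

lemma frame_op_tendsto: "(sum (\<lambda>k. cinner_L2 f (\<phi> k) *\<^sub>C \<phi> k) \<longlongrightarrow> frame_op \<phi> f) (finite_subsets_at_top UNIV)"
  using frame_summable[of f] unfolding frame_op_def by (simp add: has_sum_infsum flip: has_sum_def)

lemma norm_frame_op_le: "norm (frame_op \<phi> f) \<le> norm f"
proof (rule tendsto_upperbound[OF tendsto_norm[OF frame_op_tendsto]])
  have "norm (\<Sum>k\<in>S. cinner_L2 f (\<phi> k) *\<^sub>C \<phi> k) \<le> norm f" if "finite S" for S
    using order_trans[OF synthesis[OF that, of "\<lambda>k. cinner_L2 f (\<phi> k)"] bessel_finite[OF that, of f]]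
    by (rule power2_le_imp_le) simp
  then show "\<forall>\<^sub>F S in finite_subsets_at_top UNIV. norm (\<Sum>k\<in>S. cinner_L2 f (\<phi> k) *\<^sub>C \<phi> k) \<le> norm f"
    by (intro eventually_finite_subsets_at_top_weakI) auto
qed simp

lemma L2_linear_frame_op: "L2_linear (frame_op \<phi>)"
  unfolding L2_linear_def
proof (intro conjI allI)
  fix f g :: "'a L2" and c
  show "frame_op \<phi> (f + g) = frame_op \<phi> f + frame_op \<phi> g"
    unfolding frame_op_def cinner_L2_add_left scaleC_L2_add_left
    by (rule infsum_add[OF frame_summable frame_summable])
  show "frame_op \<phi> (c *\<^sub>C f) = c *\<^sub>C frame_op \<phi> f"
    unfolding frame_op_def cinner_L2_scaleC_left scaleC_scaleC_L2[symmetric]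
    using infsumI[OF has_sum_bounded_linear[OF bounded_linear_scaleC_L2 has_sum_infsum[OF frame_summable[of f]], of c]] by (simp add: o_def)
qed

end

lemma frame_op_eq_0_of_bounded_linear:
  assumes T: "bounded_linear T" "\<And>k. T (\<phi> k) = 0" "L2_linear T"
  shows "T (frame_op \<phi> f) = 0"
proof (cases "(\<lambda>k. cinner_L2 f (\<phi> k) *\<^sub>C \<phi> k) summable_on UNIV")
  case True
  have "T (frame_op \<phi> f) = (\<Sum>\<^sub>\<infinity>k. T (cinner_L2 f (\<phi> k) *\<^sub>C \<phi> k))"
    unfolding frame_op_def using infsumI[OF has_sum_bounded_linear[OF T(1) has_sum_infsum[OF True]]] by (simp add: o_def)
  then show ?thesis by (simp add: L2_linearD[OF T(3)] T(2))
next
  \<comment> \<open>Without summability \<open>frame_op\<close> is the default value 0 of the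
    infinite sum, where linearity gives the claim.\<close>
  case False
  then show ?thesis by (simp add: frame_op_def infsum_not_exists L2_linearD[OF T(3)])
qed

text \<open>For \<open>d \<noteq> 0\<close> the antiderivative takes equal values at both ends,
  because \<open>sin (pi * of_int d) = 0\<close>.\<close>

lemma integral_cis_unit_interval:
  "(LINT t|lborel. indicator {-1/2..1/2::real} t *\<^sub>R cis (2 * pi * (of_int d * t))) = (if d = 0 then 1 else 0)"
proof (cases "d = 0")
  case True
  then show ?thesis by simp
next
  case False
  define F where "F t = cis (2 * pi * (of_int d * t)) / (2 * pi * of_int d * \<i>)" for t
  have "(LINT t|lborel. indicator {-1/2..1/2::real} t *\<^sub>R cis (2 * pi * (of_int d * t))) = F (1/2) - F (-1/2)"
  proof (rule integral_FTC_atLeastAtMost)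
    fix x :: real
    have "((\<lambda>z. exp (\<i> * (complex_of_real (2 * pi * of_int d) * z)) / (2 * pi * of_int d * \<i>)) has_field_derivative
        exp (\<i> * (complex_of_real (2 * pi * of_int d) * complex_of_real x))) (at (complex_of_real x))"
      using False by (auto intro!: derivative_eq_intros)
    from has_vector_derivative_real_field[OF this]
    show "(F has_vector_derivative cis (2 * pi * (of_int d * x))) (at x within {-1/2..1/2})"
      by (simp add: F_def[abs_def] cis_conv_exp mult.assoc)
  qed (auto intro!: continuous_intros)
  also have "F (1/2) = F (-1/2)"
  proof -
    have "cis (pi * of_int d) = cis (- (pi * of_int d))"
      using sin_zero_iff_int2[of "pi * of_int d"] by (auto simp: complex_eq_iff mult.commute)
    then show ?thesis by (simp add: F_def)
  qed
  finally show ?thesis using False by simp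
qed

lemma norm_L2_of_mono:
  assumes "square_integrable f" "square_integrable g" "\<And>x. cmod (f x) \<le> cmod (g x)"
  shows "norm (L2_of f) \<le> norm (L2_of g)"
  unfolding norm_L2_of[OF assms(1)] norm_L2_of[OF assms(2)]
  using assms by (intro real_sqrt_le_mono integral_mono) (auto simp: square_integrable_def)

lemma L2_of_sum:
  assumes "\<And>k. k \<in> S \<Longrightarrow> square_integrable (f k)"
  shows "square_integrable (\<lambda>x. \<Sum>k\<in>S. f k x) \<and> (\<Sum>k\<in>S. L2_of (f k)) = L2_of (\<lambda>x. \<Sum>k\<in>S. f k x)"
  using assms
proof (induction S rule: infinite_finite_induct)
  case (insert k S)
  then show ?case by (simp add: L2_of_add square_integrable_add)
next
  case empty
  show ?case by (simp add: square_integrable_zero L2_of_zero)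
next
  case (infinite S)
  then show ?case by (simp add: square_integrable_zero L2_of_zero)
qed

section \<open>Wave packets\<close>

lemma L2_of_dilate:
  fixes f :: "real^'n \<Rightarrow> complex"
  assumes "r > 0" "square_integrable f"
  shows "dilate r (L2_of f) = L2_of (\<lambda>x. complex_of_real (r powr (- (real CARD('n) / 2))) * f (inverse r *\<^sub>R x))"
  unfolding dilate_eq_subst by (rule subst_op_L2_of[OF isometric_subst_dilate[OF assms(1)] assms(2)])

lemma square_integrable_dilate:
  fixes f :: "real^'n \<Rightarrow> complex"
  assumes "r > 0" "square_integrable f"
  shows "square_integrable (\<lambda>x. complex_of_real (r powr (- (real CARD('n) / 2))) * f (inverse r *\<^sub>R x))"
  by (rule square_integrable_subst[OF isometric_subst_dilate[OF assms(1)] assms(2)])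

lemma square_integrable_modulate:
  "square_integrable f \<Longrightarrow> square_integrable (\<lambda>x. cis (2 * pi * (a \<bullet> x)) * f x)"
  using square_integrable_subst[OF isometric_subst_modulate] by blast

text \<open>Brings the modulation inside the dilation, where its frequency \<open>v\<close> is free
  of the scale.\<close>

lemma modulate_dilate:
  fixes g :: "(real^'n) L2"
  assumes "a > 0"
  shows "modulate (- (a *\<^sub>R v)) (dilate (inverse a) g) = dilate (inverse a) (modulate (- v) g)"
proof -
  have ia: "inverse a > 0" using assms by simp
  have sq: "modulate (- (a *\<^sub>R v)) (dilate (inverse a) (L2_of f)) = dilate (inverse a) (modulate (- v) (L2_of f))"
    if f: "square_integrable f" for f :: "real^'n \<Rightarrow> complex"
    unfolding L2_of_dilate[OF ia f] L2_of_modulate[OF square_integrable_dilate[OF ia f]]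
      L2_of_modulate[OF f] L2_of_dilate[OF ia square_integrable_modulate[OF f]]
    by (simp add: mult.left_commute)
  show ?thesis using sq[OF square_integrable_rep_L2[of g]] by simp
qed

text \<open>The center of the unit cube with lower corner \<open>k\<close>; multiplied by
  \<open>2 powi l\<close> it is the center of the spatial cube \<open>(- l, k)\<close>.\<close>

definition half_shift :: "int^'n \<Rightarrow> real^'n" where
  "half_shift k = (\<chi> i. of_int (k $ i) + 1 / 2)"

definition bump :: "(real^'n::finite \<Rightarrow> real) \<Rightarrow> bool" where
  "bump \<Phi> \<longleftrightarrow> \<Phi> \<in> borel_measurable borel \<and> (\<forall>x. 0 \<le> \<Phi> x \<and> \<Phi> x \<le> indicator (cube 0 (1/10)) x)"

lemma mem_cube: "y \<in> cube x r \<longleftrightarrow> (\<forall>i. \<bar>x $ i - y $ i\<bar> \<le> r)"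
proof -
  have "{\<bar>(x - y) $ i\<bar> |i. i \<in> UNIV} = range (\<lambda>i. \<bar>(x - y) $ i\<bar>)" by auto
  then show ?thesis
    unfolding cube_def mem_Collect_eq infnorm_cart by (simp add: cSUP_le_iff)
qed

lemma cube_eq_cbox: "cube x r = cbox (x - (\<chi> i. r)) (x + (\<chi> i. r))"
  by (auto simp: set_eq_iff mem_cube mem_box_cart abs_le_iff) (smt (verit))+

lemma cube_finite_measure:
  "cube x r \<in> sets borel" "emeasure lborel (cube x r) < \<infinity>"
  unfolding cube_eq_cbox by (simp, rule emeasure_lborel_cbox_finite)

lemma L1L2_bump:
  assumes "bump \<Phi>"
  shows "L1L2 (\<lambda>\<xi>. complex_of_real (\<Phi> \<xi>))"
proof -
  have [measurable]: "\<Phi> \<in> borel_measurable borel" using assms by (simp add: bump_def)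
  have c: "cube 0 (1/10) \<in> sets borel" "emeasure lborel (cube (0::real^'n) (1/10)) < \<infinity>"
    by (rule cube_finite_measure)+
  have b: "0 \<le> \<Phi> x" "\<Phi> x \<le> indicator (cube 0 (1/10)) x" for x using assms by (auto simp: bump_def)
  have nb: "\<bar>\<Phi> x\<bar> \<le> cmod (1 * indicator (cube 0 (1/10)) x)" for x
    using b[of x] by (auto simp: indicator_def split: if_splits)
  have sq: "square_integrable (\<lambda>\<xi>. complex_of_real (\<Phi> \<xi>))"
    by (rule square_integrable_bound[OF square_integrable_indicator[of "cube 0 (1/10)" 1]])
      (use c nb in \<open>auto intro!: AE_I2\<close>)
  have "\<Phi> x = 0" if "x \<notin> cube 0 (1/10)" for x using b[of x] that by simp
  then have "(\<lambda>\<xi>. complex_of_real (\<Phi> \<xi>)) = (\<lambda>\<xi>. indicator (cube 0 (1/10)) \<xi> * complex_of_real (\<Phi> \<xi>))"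
    by (auto simp: fun_eq_iff indicator_def)
  then show ?thesis using integrable_bounded_measure_support[OF sq c] by simp
qed

text \<open>The transform exchanges translations and modulations and inverts dilations. With the
  modulation innermost, \<open>k\<close> enters through an exponential alone, and what acts on it is
  one isometry common to all \<open>k\<close>.\<close>

lemma fourier_packet:
  fixes \<Phi> :: "real^'n::{finite,linorder} \<Rightarrow> real"
  assumes "bump \<Phi>"
  shows "fourier_L2 (packet \<Phi> l j k) = translate (dyadic_center (child (l, j) 1))
    (dilate (inverse (2 powi l)) (modulate (- half_shift k) (L2_of (\<lambda>\<xi>. complex_of_real (\<Phi> \<xi>)))))"
proof -
  have a: "(0::real) < 2 powi l" by simp
  have c: "dyadic_center (- l, k) = 2 powi l *\<^sub>R half_shift k"
    by (simp add: vec_eq_iff half_shift_def)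
  show ?thesis
    unfolding packet_def wave_packet_def fst_conv snd_conv c dyadic_length.simps minus_minus
      fourier_L2_modulate fourier_L2_translate fourier_L2_dilate[OF a] inverse_fourier(2)[OF L1L2_bump[OF assms]]
      modulate_dilate[OF a] ..
qed

section \<open>Orthonormal exponentials on the unit cube\<close>

text \<open>Written through \<open>Basis\<close> so that its indicator is a product over
  coordinates.\<close>

definition unit_box :: "(real^'n) set" where
  "unit_box = {x. \<forall>b\<in>Basis. x \<bullet> b \<in> {-1/2..1/2}}"

lemma unit_box_eq: "unit_box = cube (0 :: real^'n) (1/2)"
proof -
  have "x \<bullet> b \<in> {-1/2..1/2} \<longleftrightarrow> \<bar>x \<bullet> b\<bar> \<le> 1/2" for x b :: "real^'n" by (auto simp: abs_le_iff)
  then show ?thesis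
    unfolding set_eq_iff unit_box_def mem_cube by (auto simp: Basis_vec_def inner_axis)
qed

definition exp_box :: "int^'n \<Rightarrow> real^'n \<Rightarrow> complex" where
  "exp_box k \<xi> = cis (2 * pi * (- half_shift k \<bullet> \<xi>)) * indicator unit_box \<xi>"

lemma square_integrable_exp_box: "square_integrable (exp_box k :: real^'n \<Rightarrow> complex)"
proof -
  have "square_integrable (\<lambda>x::real^'n. 1 * indicator unit_box x)"
    unfolding unit_box_eq cube_eq_cbox
    by (intro square_integrable_indicator emeasure_lborel_cbox_finite) auto
  from square_integrable_modulate[OF this, of "- half_shift k"] show ?thesis
    by (simp add: exp_box_def[abs_def])
qed

lemma cis_inner_prod: "cis (2 * pi * (x \<bullet> \<xi>)) = (\<Prod>b\<in>Basis. cis (2 * pi * ((x \<bullet> b) * (\<xi> \<bullet> b))))"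
  by (subst euclidean_inner[of x \<xi>]) (simp add: sum_distrib_left cis_conv_exp exp_sum)

text \<open>The offset 1/2 in \<open>half_shift\<close> cancels in the difference, so the
  frequencies in \<open>d\<close> are integers, and the integral factors into one-dimensional
  ones.\<close>

lemma exp_box_orthonormal:
  "cinner_L2 (L2_of (exp_box k)) (L2_of (exp_box k')) = (if k = (k' :: int^'n) then 1 else 0)"
proof -
  define d :: "real^'n" where "d = (\<chi> i. of_int (k' $ i - k $ i))"
  define D where "D b = \<lfloor>d \<bullet> b\<rfloor>" for b
  have D: "d \<bullet> b = of_int (D b)" if "b \<in> Basis" for b
    using that by (auto simp: D_def d_def Basis_vec_def inner_axis simp flip: of_int_diff)
  define F where "F b t = indicator {-1/2..1/2::real} t *\<^sub>R cis (2 * pi * (of_int (D b) * t))" for b t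
  have F: "integrable lborel (F b)" "integral\<^sup>L lborel (F b) = (if D b = 0 then 1 else 0)" for b
  proof -
    show "integrable lborel (F b)"
      unfolding F_def by (intro borel_integrable_compact continuous_intros) auto
    show "integral\<^sup>L lborel (F b) = (if D b = 0 then 1 else 0)"
      unfolding F_def by (rule integral_cis_unit_interval)
  qed
  have ind: "indicator unit_box \<xi> = (\<Prod>b\<in>Basis. complex_of_real (indicator {-1/2..1/2} (\<xi> \<bullet> b)))" for \<xi> :: "real^'n"
    by (auto simp: unit_box_def indicator_def intro!: prod_zero[symmetric])
  have eq: "exp_box k \<xi> * cnj (exp_box k' \<xi>) = (\<Prod>b\<in>Basis. F b (\<xi> \<bullet> b))" for \<xi>
  proof -
    have d: "- half_shift k \<bullet> \<xi> - (- half_shift k' \<bullet> \<xi>) = d \<bullet> \<xi>"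
    proof -
      have "d = half_shift k' - half_shift k" by (simp add: d_def half_shift_def vec_eq_iff)
      then show ?thesis by (simp add: inner_diff_left)
    qed
    have "exp_box k \<xi> * cnj (exp_box k' \<xi>)
        = cis (2 * pi * (- half_shift k \<bullet> \<xi>)) * cnj (cis (2 * pi * (- half_shift k' \<bullet> \<xi>))) * indicator unit_box \<xi>"
      by (simp add: exp_box_def indicator_def)
    also have "cis (2 * pi * (- half_shift k \<bullet> \<xi>)) * cnj (cis (2 * pi * (- half_shift k' \<bullet> \<xi>))) = cis (2 * pi * (d \<bullet> \<xi>))"
      unfolding d[symmetric] cis_cnj cis_mult by (simp add: algebra_simps)
    also have "\<dots> * indicator unit_box \<xi> = (\<Prod>b\<in>Basis. F b (\<xi> \<bullet> b))"
      unfolding cis_inner_prod ind prod.distrib[symmetric]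
      by (intro prod.cong) (auto simp: F_def D scaleR_conv_of_real mult.commute)
    finally show ?thesis .
  qed
  have "cinner_L2 (L2_of (exp_box k)) (L2_of (exp_box k')) = (\<Prod>b\<in>(Basis :: (real^'n) set). if D b = 0 then 1 else 0)"
    unfolding cinner_L2_of[OF square_integrable_exp_box square_integrable_exp_box] eq
    using lborel_integral_prod_Basis(1)[of F] F by simp
  also have "\<dots> = (if k = k' then 1 else 0)"
  proof (cases "k = k'")
    case True
    then have "d = 0" by (simp add: d_def vec_eq_iff)
    then show ?thesis using True by (simp add: D_def)
  next
    case False
    then obtain i where "k $ i \<noteq> k' $ i" by (auto simp: vec_eq_iff)
    then have "D (axis i 1) \<noteq> 0" by (simp add: D_def d_def inner_axis flip: of_int_diff)
    then show ?thesis using False by (auto intro!: prod_zero bexI[of _ "axis i 1"] simp: Basis_vec_def)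
  qed
  finally show ?thesis .
qed

lemma norm_exp_box_sum:
  assumes "finite S"
  shows "(norm (\<Sum>k\<in>S. c k *\<^sub>C L2_of (exp_box k)))\<^sup>2 = (\<Sum>k\<in>S. (cmod (c k))\<^sup>2)"
proof -
  let ?g = "\<Sum>k\<in>S. c k *\<^sub>C L2_of (exp_box k)"
  have "cinner_L2 ?g ?g = (\<Sum>k\<in>S. \<Sum>n\<in>S. cnj (c k) * (c n * (if n = k then 1 else 0)))"
    by (simp add: cinner_L2_sum_left cinner_L2_sum_right cinner_L2_scaleC_left cinner_L2_scaleC_right
        exp_box_orthonormal sum_distrib_left del: mult_cancel_left mult_eq_0_iff)
  also have "\<dots> = (\<Sum>k\<in>S. c k * cnj (c k))"
    using assms by (intro sum.cong) (simp_all add: if_distrib sum.delta mult.commute cong: if_cong)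
  finally have "complex_of_real ((norm ?g)\<^sup>2) = complex_of_real (\<Sum>k\<in>S. (cmod (c k))\<^sup>2)"
    by (simp only: cinner_L2_same of_real_sum complex_norm_square)
  then show ?thesis by (simp only: of_real_eq_iff)
qed

text \<open>The isometry \<open>V\<close> is shared by all packets and drops out of the norm. What
  remains is a trigonometric polynomial times \<open>\<Phi>\<close>; replacing \<open>\<Phi>\<close>
  by the larger indicator of \<open>unit_box\<close> can only increase the norm, and there the
  exponentials are orthonormal.\<close>

lemma packet_synthesis:
  fixes \<Phi> :: "real^'n::{finite,linorder} \<Rightarrow> real"
  assumes \<Phi>: "bump \<Phi>" and S: "finite S"
  shows "(norm (\<Sum>k\<in>S. c k *\<^sub>C packet \<Phi> l j k))\<^sup>2 \<le> (\<Sum>k\<in>S. (cmod (c k))\<^sup>2)"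
proof -
  define V :: "(real^'n::{finite,linorder}) L2 \<Rightarrow> (real^'n::{finite,linorder}) L2" where
    "V g = translate (dyadic_center (child (l, j) 1)) (dilate (inverse (2 powi l)) g)" for g
  have V: "L2_isometry V"
    unfolding V_def[abs_def] by (intro L2_isometry_comp[OF L2_isometry_translate L2_isometry_dilate]) simp
  note VL = L2_isometryD(1)[OF V] and FL = L2_isometryD(1)[OF L2_isometry_fourier_L2]
  define e where "e k \<xi> = cis (2 * pi * (- half_shift k \<bullet> \<xi>))" for k and \<xi> :: "real^'n::{finite,linorder}"
  let ?\<Phi> = "\<lambda>\<xi>. complex_of_real (\<Phi> \<xi>)"
  have sq: "square_integrable ?\<Phi>" using L1L2_bump[OF \<Phi>] by (simp add: L1L2_def)
  have sqe: "square_integrable (\<lambda>\<xi>. c k * (e k \<xi> * ?\<Phi> \<xi>))" for k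
    unfolding e_def by (intro square_integrable_mult square_integrable_modulate sq)
  have sqb: "square_integrable (\<lambda>\<xi>. c k * exp_box k \<xi>)" for k :: "int^'n::{finite,linorder}"
    by (intro square_integrable_mult square_integrable_exp_box)
  have "norm (\<Sum>k\<in>S. c k *\<^sub>C packet \<Phi> l j k) = norm (fourier_L2 (\<Sum>k\<in>S. c k *\<^sub>C packet \<Phi> l j k))"
    by (simp add: L2_isometryD(2)[OF L2_isometry_fourier_L2])
  also have "fourier_L2 (\<Sum>k\<in>S. c k *\<^sub>C packet \<Phi> l j k) = (\<Sum>k\<in>S. c k *\<^sub>C V (modulate (- half_shift k) (L2_of ?\<Phi>)))"
    by (simp add: L2_linear_sum[OF FL] L2_linearD[OF FL] fourier_packet[OF \<Phi>] V_def)
  also have "\<dots> = V (\<Sum>k\<in>S. c k *\<^sub>C modulate (- half_shift k) (L2_of ?\<Phi>))"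
    by (simp add: L2_linear_sum[OF VL] L2_linearD[OF VL])
  also have "norm \<dots> = norm (\<Sum>k\<in>S. c k *\<^sub>C modulate (- half_shift k) (L2_of ?\<Phi>))"
    by (rule L2_isometryD(2)[OF V])
  also have "(\<Sum>k\<in>S. c k *\<^sub>C modulate (- half_shift k) (L2_of ?\<Phi>)) = (\<Sum>k\<in>S. L2_of (\<lambda>\<xi>. c k * (e k \<xi> * ?\<Phi> \<xi>)))"
    unfolding L2_of_modulate[OF sq] L2_of_mult[OF square_integrable_modulate[OF sq]] e_def ..
  also have "\<dots> = L2_of (\<lambda>\<xi>. \<Sum>k\<in>S. c k * (e k \<xi> * ?\<Phi> \<xi>))"
    using L2_of_sum[of S "\<lambda>k \<xi>. c k * (e k \<xi> * ?\<Phi> \<xi>)"] sqe by blast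
  also have "norm \<dots> \<le> norm (L2_of (\<lambda>\<xi>. \<Sum>k\<in>S. c k * exp_box k \<xi>))"
  proof (rule norm_L2_of_mono)
    show "square_integrable (\<lambda>\<xi>. \<Sum>k\<in>S. c k * (e k \<xi> * ?\<Phi> \<xi>))"
      using L2_of_sum[of S "\<lambda>k \<xi>. c k * (e k \<xi> * ?\<Phi> \<xi>)"] sqe by blast
    show "square_integrable (\<lambda>\<xi>. \<Sum>k\<in>S. c k * exp_box k \<xi>)"
      using L2_of_sum[of S "\<lambda>k \<xi>. c k * exp_box k \<xi>"] sqb by blast
    fix \<xi> :: "real^'n::{finite,linorder}"
    have 1: "(\<Sum>k\<in>S. c k * (e k \<xi> * ?\<Phi> \<xi>)) = (\<Sum>k\<in>S. c k * e k \<xi>) * ?\<Phi> \<xi>"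
      by (simp add: sum_distrib_right mult.assoc)
    have 2: "(\<Sum>k\<in>S. c k * exp_box k \<xi>) = (\<Sum>k\<in>S. c k * e k \<xi>) * indicator unit_box \<xi>"
      by (simp add: sum_distrib_right mult.assoc e_def exp_box_def)
    have sub: "cube 0 (1/10) \<subseteq> (unit_box :: (real^'n::{finite,linorder}) set)"
    proof
      fix x :: "real^'n::{finite,linorder}" assume "x \<in> cube 0 (1/10)"
      then have "\<bar>0 $ i - x $ i\<bar> \<le> 1/10" for i by (simp only: mem_cube)
      then have "\<bar>0 $ i - x $ i\<bar> \<le> 1/2" for i by (rule order_trans) simp
      then show "x \<in> unit_box" unfolding unit_box_eq mem_cube by blast
    qed
    have "cmod (?\<Phi> \<xi>) \<le> cmod (indicator unit_box \<xi>)"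
    proof -
      have "0 \<le> \<Phi> \<xi>" "\<Phi> \<xi> \<le> indicator (cube 0 (1/10)) \<xi>" using \<Phi> by (auto simp: bump_def)
      with sub show ?thesis by (cases "\<xi> \<in> cube 0 (1/10)") (auto simp: indicator_def)
    qed
    then show "cmod (\<Sum>k\<in>S. c k * (e k \<xi> * ?\<Phi> \<xi>)) \<le> cmod (\<Sum>k\<in>S. c k * exp_box k \<xi>)"
      unfolding 1 2 norm_mult by (intro mult_left_mono) auto
  qed
  also have "L2_of (\<lambda>\<xi>. \<Sum>k\<in>S. c k * exp_box k \<xi>) = (\<Sum>k\<in>S. L2_of (\<lambda>\<xi>. c k * exp_box k \<xi>))"
    using L2_of_sum[of S "\<lambda>k \<xi>. c k * exp_box k \<xi>"] sqb by metis
  also have "\<dots> = (\<Sum>k\<in>S. c k *\<^sub>C L2_of (exp_box k))"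
    by (simp add: L2_of_mult square_integrable_exp_box)
  finally have "(norm (\<Sum>k\<in>S. c k *\<^sub>C packet \<Phi> l j k))\<^sup>2 \<le> (norm (\<Sum>k\<in>S. c k *\<^sub>C L2_of (exp_box k)))\<^sup>2"
    by (rule power_mono) simp
  then show ?thesis by (simp add: norm_exp_box_sum[OF S])
qed

section \<open>Dependence of the conjugated operator on the modulation\<close>

text \<open>Both entries may vary at once because modulations are isometries: the error
  \<open>g n - g0\<close> keeps its norm, and for the fixed \<open>g0\<close> dominated convergence
  applies.\<close>

lemma tendsto_modulate:
  fixes g :: "nat \<Rightarrow> 'a::euclidean_space L2"
  assumes a: "a \<longlonglongrightarrow> a0" and g: "g \<longlonglongrightarrow> g0"
  shows "(\<lambda>n. modulate (a n) (g n)) \<longlonglongrightarrow> modulate a0 g0"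
proof -
  have "(\<lambda>n. modulate (a n) g0) \<longlonglongrightarrow> modulate a0 g0"
    unfolding modulate_def
  proof (rule tendsto_L2_of_dominated(2)[OF square_integrable_rep_L2[of g0]])
    have [measurable]: "rep_L2 g0 \<in> borel_measurable borel"
      using square_integrable_rep_L2 by (auto simp: square_integrable_def)
    show "(\<lambda>x. cis (2 * pi * (a j \<bullet> x)) * rep_L2 g0 x) \<in> borel_measurable borel" for j by measurable
    show "(\<lambda>x. cis (2 * pi * (a0 \<bullet> x)) * rep_L2 g0 x) \<in> borel_measurable borel" by measurable
    have "(\<lambda>j. cis (2 * pi * (a j \<bullet> x)) * rep_L2 g0 x) \<longlonglongrightarrow> cis (2 * pi * (a0 \<bullet> x)) * rep_L2 g0 x" for x
      by (intro tendsto_intros a)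
    then show "AE x in lborel. (\<lambda>j. cis (2 * pi * (a j \<bullet> x)) * rep_L2 g0 x) \<longlonglongrightarrow> cis (2 * pi * (a0 \<bullet> x)) * rep_L2 g0 x"
      by simp
  qed (auto simp: norm_mult)
  moreover have "(\<lambda>n. modulate (a n) (g n) - modulate (a n) g0) \<longlonglongrightarrow> 0"
  proof (rule Lim_null_comparison)
    show "\<forall>\<^sub>F n in sequentially. norm (modulate (a n) (g n) - modulate (a n) g0) \<le> norm (g n - g0)"
      by (simp add: L2_linearD(5)[OF L2_isometryD(1)[OF L2_isometry_modulate], symmetric] L2_isometryD(2)[OF L2_isometry_modulate])
    show "(\<lambda>n. norm (g n - g0)) \<longlonglongrightarrow> 0"
      using g by (simp add: LIM_zero_iff tendsto_norm_zero_iff)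
  qed
  ultimately have "(\<lambda>n. (modulate (a n) (g n) - modulate (a n) g0) + modulate (a n) g0) \<longlonglongrightarrow> 0 + modulate a0 g0"
    by (intro tendsto_add)
  then show ?thesis by simp
qed

lemma upper_cell_sets: "upper_cell l j \<in> sets (borel :: (real^'n::finite) measure)"
proof -
  have "upper_cell l j = (\<Inter>i. {\<eta>. of_int (j $ i) + 1 / 2 \<le> 2 powi l * \<eta> $ i} \<inter> {\<eta>. 2 powi l * \<eta> $ i < of_int (j $ i) + 1})"
    by (auto simp: upper_cell_def)
  also have "\<dots> \<in> sets borel"
    by (intro sets.finite_INT sets.Int borel_closed borel_open closed_Collect_le open_Collect_less continuous_intros) auto
  finally show ?thesis .
qed

lemma upper_cell_cases:
  fixes \<eta> :: "real^'n::{finite,linorder}"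
  obtains j where "\<eta> \<in> upper_cell l j" "\<And>\<Phi> f. model_op \<Phi> \<eta> l f = frame_op (packet \<Phi> l j) f"
  | "\<And>j. \<eta> \<notin> upper_cell l j" "\<And>\<Phi> f. model_op \<Phi> \<eta> l f = 0"
  using model_op_eq_frame_op model_op_eq_0 by metis

lemma norm_model_op_le:
  fixes \<Phi> :: "real^'n::{finite,linorder} \<Rightarrow> real"
  assumes "bump \<Phi>"
  shows "norm (model_op \<Phi> \<eta> l f) \<le> norm f"
  by (rule upper_cell_cases[of \<eta> l]) (simp_all add: norm_frame_op_le[OF packet_synthesis[OF assms]])

text \<open>On a single cell the frame operator is fixed, so the dependence on \<open>\<eta>\<close>
  is continuous there. Countably many cells and their complement, where the operator is 0, cover the
  space.\<close>

lemma borel_measurable_conjugated_model_op: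
  fixes \<Phi> :: "real^'n::{finite,linorder} \<Rightarrow> real"
  assumes \<Phi>: "bump \<Phi>"
  shows "(\<lambda>\<eta>. modulate (- \<eta>) (model_op \<Phi> \<eta> l (modulate \<eta> f))) \<in> borel_measurable borel"
proof (rule measurable_piecewise_restrict[where C = "insert (- (\<Union>j. upper_cell l j)) (range (upper_cell l))"])
  show "countable (insert (- (\<Union>j. upper_cell l j)) (range (upper_cell l :: int^'n::{finite,linorder} \<Rightarrow> _)))" by simp
  fix \<Omega> assume "\<Omega> \<in> insert (- (\<Union>j. upper_cell l j)) (range (upper_cell l :: int^'n::{finite,linorder} \<Rightarrow> _))"
  then consider "\<Omega> = - (\<Union>j. upper_cell l j)" | j where "\<Omega> = upper_cell l j" by blast
  then show "(\<lambda>\<eta>. modulate (- \<eta>) (model_op \<Phi> \<eta> l (modulate \<eta> f))) \<in> borel_measurable (restrict_space borel \<Omega>)"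
  proof cases
    case 1
    have "(\<lambda>\<eta>. modulate (- \<eta>) (model_op \<Phi> \<eta> l (modulate \<eta> f))) \<in> borel_measurable (restrict_space borel \<Omega>)
        \<longleftrightarrow> (\<lambda>\<eta>. 0 :: (real^'n::{finite,linorder}) L2) \<in> borel_measurable (restrict_space borel \<Omega>)"
      by (rule measurable_cong)
        (auto simp: 1 space_restrict_space model_op_eq_0 L2_linearD(4)[OF L2_isometryD(1)[OF L2_isometry_modulate]])
    then show ?thesis by simp
  next
    case 2
    let ?T = "frame_op (packet \<Phi> l j)"
    have T: "bounded_linear ?T"
      using norm_frame_op_le[OF packet_synthesis[OF \<Phi>]] L2_linear_frame_op[OF packet_synthesis[OF \<Phi>]]
      by (intro L2_linear_bounded[of _ 1]) auto
    have cont: "continuous_on UNIV (\<lambda>\<eta>. modulate (- \<eta>) (?T (modulate \<eta> f)))"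
      unfolding continuous_on_sequentially o_def
      by (intro allI ballI impI tendsto_modulate tendsto_minus bounded_linear.tendsto[OF T] tendsto_const; elim conjE; assumption)
    have "(\<lambda>\<eta>. modulate (- \<eta>) (model_op \<Phi> \<eta> l (modulate \<eta> f))) \<in> borel_measurable (restrict_space borel \<Omega>)
        \<longleftrightarrow> (\<lambda>\<eta>. modulate (- \<eta>) (?T (modulate \<eta> f))) \<in> borel_measurable (restrict_space borel \<Omega>)"
      by (rule measurable_cong) (auto simp: 2 space_restrict_space model_op_eq_frame_op)
    then show ?thesis
      using borel_measurable_continuous_onI[OF cont] by (simp add: measurable_restrict_space1)
  qed
  show "\<Omega> \<inter> space borel \<in> sets borel"
    using \<open>\<Omega> \<in> _\<close> upper_cell_sets[of l] by (auto intro!: sets.countable_UN'' borel_comp)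
qed auto

lemma set_integrable_conjugated_model_op:
  fixes \<Phi> :: "real^'n::{finite,linorder} \<Rightarrow> real"
  assumes \<Phi>: "bump \<Phi>"
  shows "set_integrable lborel (cube x r) (\<lambda>\<eta>. modulate (- \<eta>) (model_op \<Phi> \<eta> l (modulate \<eta> f)))"
  unfolding set_integrable_def
proof (rule Bochner_Integration.integrable_bound[of _ "\<lambda>\<eta>. indicator (cube x r) \<eta> *\<^sub>R norm f"])
  note [measurable] = borel_measurable_conjugated_model_op[OF \<Phi>]
  have [measurable]: "cube x r \<in> sets borel" by (simp add: cube_eq_cbox)
  show "integrable lborel (\<lambda>\<eta>. indicator (cube x r) \<eta> *\<^sub>R norm f)"
    using cube_finite_measure[of x r] by (intro integrable_scaleR_left integrable_real_indicator) auto
  show "(\<lambda>\<eta>. indicator (cube x r) \<eta> *\<^sub>R modulate (- \<eta>) (model_op \<Phi> \<eta> l (modulate \<eta> f))) \<in> borel_measurable lborel"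
    by measurable
  have "norm (modulate (- \<eta>) (model_op \<Phi> \<eta> l (modulate \<eta> f))) \<le> norm f" for \<eta>
    using norm_model_op_le[OF \<Phi>, of \<eta> l "modulate \<eta> f"] by (simp add: L2_isometryD(2)[OF L2_isometry_modulate])
  then show "AE \<eta> in lborel. norm (indicator (cube x r) \<eta> *\<^sub>R modulate (- \<eta>) (model_op \<Phi> \<eta> l (modulate \<eta> f)))
      \<le> norm (indicator (cube x r) \<eta> *\<^sub>R norm f)"
    by (auto simp: indicator_def)
qed

section \<open>The support of the multiplier\<close>

definition mult_op :: "('a::euclidean_space \<Rightarrow> complex) \<Rightarrow> 'a L2 \<Rightarrow> 'a L2" where
  "mult_op h f = L2_of (\<lambda>\<xi>. h \<xi> * rep_L2 f \<xi>)"

context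
  fixes h :: "'a::euclidean_space \<Rightarrow> complex" and C :: real
  assumes h [measurable]: "h \<in> borel_measurable borel" and bound: "AE \<xi> in lborel. cmod (h \<xi>) \<le> C"
begin

text \<open>A negative bound could hold at no point, which would make the unit ball a null
  set.\<close>

lemma mult_bound_nonneg: "0 \<le> C"
proof (rule ccontr)
  assume "\<not> 0 \<le> C"
  have "AE \<xi> in lborel. \<xi> \<notin> (ball 0 1 :: 'a set)"
    using bound by eventually_elim (use \<open>\<not> 0 \<le> C\<close> norm_ge_zero order_trans in blast)
  then have "emeasure lborel (ball 0 1 :: 'a set) = 0"
    by (subst (asm) AE_iff_measurable[OF _ refl]) (auto simp: ball_def)
  then show False using content_ball_pos[of 1 "0::'a"] by (simp add: measure_def)
qed

lemma mult_pointwise_le: "AE \<xi> in lborel. cmod (h \<xi> * f \<xi>) \<le> cmod (complex_of_real C * f \<xi>)"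
  using bound by eventually_elim (auto simp: norm_mult mult_bound_nonneg intro!: mult_right_mono)

lemma square_integrable_mult_fun:
  assumes "square_integrable f"
  shows "square_integrable (\<lambda>\<xi>. h \<xi> * f \<xi>)"
  using square_integrableD(2)[OF assms]
  by (intro square_integrable_bound[OF square_integrable_mult[OF assms, of C] _ mult_pointwise_le]) auto

lemma mult_op_L2_of:
  assumes "square_integrable f"
  shows "mult_op h (L2_of f) = L2_of (\<lambda>\<xi>. h \<xi> * f \<xi>)"
  unfolding mult_op_def
proof (rule L2_of_cong_AE)
  show "AE x in lborel. h x * rep_L2 (L2_of f) x = h x * f x"
    using rep_L2_of[OF assms] by eventually_elim simp
qed (intro square_integrable_mult_fun square_integrable_rep_L2 assms)+

lemma L2_linear_mult_op: "L2_linear (mult_op h)"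
proof -
  have "mult_op h (L2_of u + L2_of v) = mult_op h (L2_of u) + mult_op h (L2_of v)"
    if "square_integrable u" "square_integrable v" for u v
    by (simp only: L2_of_add that mult_op_L2_of square_integrable_mult_fun square_integrable_add distrib_left)
  from this[OF square_integrable_rep_L2 square_integrable_rep_L2]
  have add: "mult_op h (f + g) = mult_op h f + mult_op h g" for f g by simp
  have "mult_op h (c *\<^sub>C L2_of u) = c *\<^sub>C mult_op h (L2_of u)" if "square_integrable u" for u c
    by (simp only: L2_of_mult that mult_op_L2_of square_integrable_mult_fun square_integrable_mult mult.left_commute)
  from this[OF square_integrable_rep_L2]
  have "mult_op h (c *\<^sub>C f) = c *\<^sub>C mult_op h f" for f c by simp
  with add show ?thesis by (simp add: L2_linear_def)
qed

lemma norm_mult_op_le: "norm (mult_op h f) \<le> norm f * C"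
proof -
  note s = square_integrable_rep_L2[of f]
  have "norm (mult_op h f) \<le> norm (L2_of (\<lambda>\<xi>. complex_of_real C * rep_L2 f \<xi>))"
    unfolding mult_op_def norm_L2_of[OF square_integrable_mult_fun[OF s]] norm_L2_of[OF square_integrable_mult[OF s]]
  proof (intro real_sqrt_le_mono integral_mono_AE)
    show "integrable lborel (\<lambda>x. (cmod (h x * rep_L2 f x))\<^sup>2)" "integrable lborel (\<lambda>x. (cmod (complex_of_real C * rep_L2 f x))\<^sup>2)"
      using square_integrable_mult_fun[OF s] square_integrable_mult[OF s] by (auto simp: square_integrable_def)
    show "AE x in lborel. (cmod (h x * rep_L2 f x))\<^sup>2 \<le> (cmod (complex_of_real C * rep_L2 f x))\<^sup>2"
      using mult_pointwise_le[of "rep_L2 f"] by eventually_elim (simp add: power_mono)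
  qed
  also have "\<dots> = norm f * C"
    by (simp add: L2_of_mult[OF s, symmetric] norm_scaleC_L2 mult_bound_nonneg)
  finally show ?thesis .
qed

end

text \<open>In scaled coordinates the transform of a packet is centered at
  \<open>j $ i + 1/4\<close> with half-width 1/10, while \<open>\<eta>\<close> lies between
  \<open>j $ i + 1/2\<close> and \<open>j $ i + 1\<close>. Demodulation moves the center to between
  -3/4 and -1/4; then 3/4 + 1/10 = 17/20 and 1/4 - 1/10 = 3/20.\<close>

definition support_box :: "int \<Rightarrow> (real^'n) set" where
  "support_box l = {\<xi>. \<forall>i. - 17 / 20 \<le> 2 powi l * \<xi> $ i \<and> 2 powi l * \<xi> $ i \<le> - 3 / 20}"

lemma closed_support_box: "closed (support_box l :: (real^'n) set)"
  unfolding support_box_def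
  by (intro closed_Collect_all closed_Collect_conj closed_Collect_le continuous_intros)

lemma compact_support_box_0: "compact (support_box 0 :: (real^'n) set)"
proof -
  have "support_box 0 = cbox (\<chi> i. - 17 / 20) ((\<chi> i. - 3 / 20) :: real^'n)"
    by (auto simp: support_box_def mem_box_cart)
  then show ?thesis by simp
qed

lemma indicator_compl_support_box:
  "(\<lambda>\<xi>. indicator (- support_box l) \<xi> :: complex) \<in> borel_measurable borel"
  "AE \<xi> in lborel. cmod (indicator (- support_box l) \<xi>) \<le> 1"
proof -
  show "(\<lambda>\<xi>. indicator (- support_box l) \<xi> :: complex) \<in> borel_measurable borel"
    using closed_support_box[of l] by (intro borel_measurable_indicator borel_comp borel_closed)
qed (simp add: indicator_def)

lemma packet_fourier_support:
  fixes \<Phi> :: "real^'n::{finite,linorder} \<Rightarrow> real"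
  assumes \<Phi>: "bump \<Phi>" and \<eta>: "\<eta> \<in> upper_cell l j"
  shows "mult_op (indicator (- support_box l)) (fourier_L2 (modulate (- \<eta>) (packet \<Phi> l j k))) = 0"
proof -
  define a c where "a = (2::real) powi l" and "c = dyadic_center (child (l, j) 1)"
  have a: "a > 0" "inverse a > 0" by (simp_all add: a_def)
  let ?\<Phi> = "\<lambda>\<xi>. complex_of_real (\<Phi> \<xi>)"
  define g where "g x = complex_of_real (inverse a powr (- (real CARD('n) / 2))) *
    (cis (2 * pi * (- half_shift k \<bullet> (inverse (inverse a) *\<^sub>R x))) * ?\<Phi> (inverse (inverse a) *\<^sub>R x))" for x
  have sq: "square_integrable ?\<Phi>" using L1L2_bump[OF \<Phi>] by (simp add: L1L2_def)
  note sq1 = square_integrable_modulate[OF sq, of "- half_shift k"]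
  have sq2: "square_integrable g" unfolding g_def by (rule square_integrable_dilate[OF a(2) sq1])
  note sq3 = square_integrable_translate[OF sq2, of c]
  note sq4 = square_integrable_translate[OF sq3, of "- \<eta>"]
  have "fourier_L2 (modulate (- \<eta>) (packet \<Phi> l j k)) = translate (- \<eta>) (translate c (L2_of g))"
    unfolding fourier_L2_modulate fourier_packet[OF \<Phi>] a_def[symmetric] c_def[symmetric]
      L2_of_modulate[OF sq] L2_of_dilate[OF a(2) sq1] g_def ..
  also have "\<dots> = L2_of (\<lambda>x. g (x - (- \<eta>) - c))"
    by (simp only: L2_of_translate[OF sq2] L2_of_translate[OF sq3])
  also have "mult_op (indicator (- support_box l)) \<dots> = L2_of (\<lambda>x. indicator (- support_box l) x * g (x - (- \<eta>) - c))"
    by (rule mult_op_L2_of[OF indicator_compl_support_box sq4])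
  also have "\<dots> = L2_of (\<lambda>x. 0)"
  proof -
    have "indicator (- support_box l) x * g (x - (- \<eta>) - c) = 0" for x
    proof (cases "x \<in> support_box l")
      case False
      then obtain i where i: "\<not> (- 17 / 20 \<le> a * x $ i \<and> a * x $ i \<le> - 3 / 20)"
        by (auto simp: support_box_def a_def)
      have "of_int (j $ i) + 1 / 2 \<le> a * \<eta> $ i" "a * \<eta> $ i < of_int (j $ i) + 1"
        using \<eta> by (auto simp: upper_cell_def a_def)
      moreover have "a * c $ i = of_int (j $ i) + 1 / 4"
        unfolding a_def c_def by (rule dyadic_center_first_child)
      \<comment> \<open>Otherwise \<open>a * x $ i\<close> would be within 1/10 of
        \<open>a * c $ i - a * \<eta> $ i\<close>, which is greater than -3/4 and at most
        -1/4.\<close>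
      ultimately have "\<not> \<bar>0 $ i - (a *\<^sub>R (x - (- \<eta>) - c)) $ i\<bar> \<le> 1/10"
        using i by (auto simp: abs_le_iff algebra_simps)
      then have "a *\<^sub>R (x - (- \<eta>) - c) \<notin> cube 0 (1/10)" unfolding mem_cube by blast
      then have "\<Phi> (a *\<^sub>R (x - (- \<eta>) - c)) = 0"
        using \<Phi> by (auto simp: bump_def dest!: spec[of _ "a *\<^sub>R (x - (- \<eta>) - c)"])
      then show ?thesis by (simp add: g_def)
    qed (simp add: indicator_def)
    then show ?thesis by (intro arg_cong[where f = L2_of] ext)
  qed
  also have "\<dots> = 0" by (rule L2_of_zero)
  finally show ?thesis .
qed

lemma conjugated_model_op_fourier_support:
  fixes \<Phi> :: "real^'n::{finite,linorder} \<Rightarrow> real"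
  assumes \<Phi>: "bump \<Phi>"
  shows "mult_op (indicator (- support_box l)) (fourier_L2 (modulate (- \<eta>) (model_op \<Phi> \<eta> l f))) = 0"
proof -
  let ?T = "\<lambda>f::(real^'n::{finite,linorder}) L2. mult_op (indicator (- support_box l)) (fourier_L2 (modulate (- \<eta>) f))"
  have T: "L2_linear ?T"
    by (intro L2_linear_comp[OF L2_linear_mult_op[OF indicator_compl_support_box]
          L2_linear_comp[OF L2_isometryD(1)[OF L2_isometry_fourier_L2] L2_isometryD(1)[OF L2_isometry_modulate]]])
  have bl: "bounded_linear ?T"
  proof (rule L2_linear_bounded[OF T, of 1])
    fix f :: "(real^'n::{finite,linorder}) L2"
    show "norm (?T f) \<le> norm f * 1"
      using norm_mult_op_le[OF indicator_compl_support_box, of l "fourier_L2 (modulate (- \<eta>) f)"]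
      by (simp add: L2_isometryD(2)[OF L2_isometry_fourier_L2] L2_isometryD(2)[OF L2_isometry_modulate])
  qed
  show ?thesis
  proof (rule upper_cell_cases[of \<eta> l])
    fix j assume j: "\<eta> \<in> upper_cell l j" and eq: "\<And>\<Phi> f. model_op \<Phi> \<eta> l f = frame_op (packet \<Phi> l j) f"
    show ?thesis
      unfolding eq by (rule frame_op_eq_0_of_bounded_linear[OF bl packet_fourier_support[OF \<Phi> j] T])
  next
    assume "\<And>\<Phi> f. model_op \<Phi> \<eta> l f = 0"
    then show ?thesis using L2_linearD(4)[OF T] by simp
  qed
qed

lemma L2_of_eq_0_iff: "square_integrable f \<Longrightarrow> L2_of f = 0 \<longleftrightarrow> (AE x in lborel. f x = 0)"
  using L2_of_eq_iff[OF _ square_integrable_zero, of f] by (simp add: L2_of_zero)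

text \<open>A nonzero value would persist on a ball, and balls have positive measure.\<close>

lemma continuous_AE_zero:
  fixes f :: "'a::euclidean_space \<Rightarrow> complex"
  assumes "open S" "continuous_on S f" "AE x in lborel. x \<in> S \<longrightarrow> f x = 0" "x \<in> S"
  shows "f x = 0"
proof (rule ccontr)
  assume "f x \<noteq> 0"
  have "open (S \<inter> f -` (- {0}))"
    using assms(1,2) by (metis continuous_on_open_vimage open_Compl closed_singleton Int_commute)
  then obtain e where e: "e > 0" "ball x e \<subseteq> S \<inter> f -` (- {0})"
    using \<open>f x \<noteq> 0\<close> \<open>x \<in> S\<close> by (metis ComplI IntI open_contains_ball singletonD vimageI)
  have "AE y in lborel. y \<notin> ball x e"
    using assms(3) by eventually_elim (use e in auto)
  then have "emeasure lborel (ball x e) = 0"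
    by (subst (asm) AE_iff_measurable[OF _ refl]) (auto simp: ball_def)
  then show False using content_ball_pos[OF e(1), of x] by (simp add: measure_def)
qed

text \<open>Doubling the cube of radius \<open>2 ^ N\<close> gives exactly the next one; the limit
  hypothesis on \<open>m\<close> is evaluated along this sequence.\<close>

lemma cube_sequence_exists: "cube_sequence (\<lambda>N. 0 :: real^'n) (\<lambda>N. 2 ^ N)"
  by (simp add: cube_sequence_def)

lemma square_integrable_gauss_window:
  "square_integrable (\<lambda>x::'a::euclidean_space. complex_of_real (gauss_window 1 x))"
proof -
  have "integrable lborel (\<lambda>x::'a. complex_of_real (gauss_window 1 x))"
    by (rule fourier_gauss_window(1)) simp
  then have i: "integrable lborel (gauss_window 1 :: 'a \<Rightarrow> real)"
    by (simp only: complex_of_real_integrable_eq)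
  note [measurable] = borel_measurable_integrable[OF i, simplified]
  have b: "0 \<le> gauss_window 1 x" "gauss_window 1 x \<le> 1" for x :: 'a
    unfolding gauss_window_def by (auto intro!: prod_nonneg prod_le_1)
  have "integrable lborel (\<lambda>x::'a. (gauss_window 1 x)\<^sup>2)"
    by (rule Bochner_Integration.integrable_bound[OF i])
      (use b in \<open>auto simp: power2_eq_square intro!: mult_left_le_one_le\<close>)
  then show ?thesis by (simp add: square_integrable_def)
qed

lemma multiplier_support:
  fixes \<Phi> :: "real^'n::{finite,linorder} \<Rightarrow> real" and m :: "real^'n::{finite,linorder} \<Rightarrow> complex"
  assumes \<Phi>: "bump \<Phi>" and cont: "continuous_on (UNIV - {0}) m"
    and m_limit: "\<And>(l::int) (f::(real^'n::{finite,linorder}) L2) x r. cube_sequence x r \<Longrightarrow>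
        square_integrable (\<lambda>\<xi>. m ((2 powi l) *\<^sub>R \<xi>) * rep_L2 (fourier_L2 f) \<xi>) \<and>
        (\<lambda>N. LINT \<eta>:cube (x N) (r N)|lborel.
            (1 / measure lborel (cube (x N) (r N))) *\<^sub>R
            modulate (- \<eta>) (model_op \<Phi> \<eta> l (modulate \<eta> f)))
          \<longlonglongrightarrow> inverse_fourier_L2
            (L2_of (\<lambda>\<xi>. m ((2 powi l) *\<^sub>R \<xi>) * rep_L2 (fourier_L2 f) \<xi>))"
    and \<xi>: "\<xi> \<noteq> 0" "\<xi> \<notin> support_box 0"
  shows "m \<xi> = 0"
proof -
  let ?K = "support_box 0 :: (real^'n::{finite,linorder}) set"
  let ?T = "\<lambda>f::(real^'n::{finite,linorder}) L2. mult_op (indicator (- ?K)) (fourier_L2 f)"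
  let ?w = "\<lambda>x::real^'n::{finite,linorder}. complex_of_real (gauss_window 1 x)"
  define f where "f = inverse_fourier_L2 (L2_of ?w)"
  define g where "g \<xi> = m \<xi> * rep_L2 (fourier_L2 f) \<xi>" for \<xi>
  note F = L2_isometryD(1,2)[OF L2_isometry_fourier_L2]
  have Tl: "L2_linear ?T"
    by (intro L2_linear_comp[OF L2_linear_mult_op[OF indicator_compl_support_box] F(1)])
  have T: "bounded_linear ?T"
    by (rule L2_linear_bounded[OF Tl, of 1])
      (use norm_mult_op_le[OF indicator_compl_support_box] F(2) in metis)
  have lim: "(\<lambda>N. LINT \<eta>:cube 0 (2 ^ N)|lborel. (1 / measure lborel (cube (0::real^'n::{finite,linorder}) (2 ^ N))) *\<^sub>R
            modulate (- \<eta>) (model_op \<Phi> \<eta> 0 (modulate \<eta> f))) \<longlonglongrightarrow> inverse_fourier_L2 (L2_of g)"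
    and sq: "square_integrable g"
    using m_limit[OF cube_sequence_exists, of 0 f] by (simp_all add: g_def[abs_def])
  have "?T (LINT \<eta>:cube 0 (2 ^ N)|lborel. (1 / measure lborel (cube (0::real^'n::{finite,linorder}) (2 ^ N))) *\<^sub>R
            modulate (- \<eta>) (model_op \<Phi> \<eta> 0 (modulate \<eta> f))) = 0" for N
  proof -
    let ?c = "1 / measure lborel (cube (0::real^'n::{finite,linorder}) (2 ^ N))"
    have int: "integrable lborel (\<lambda>\<eta>. indicator (cube 0 (2 ^ N)) \<eta> *\<^sub>R (?c *\<^sub>R modulate (- \<eta>) (model_op \<Phi> \<eta> 0 (modulate \<eta> f))))"
      using integrable_scaleR_right[OF set_integrable_conjugated_model_op[OF \<Phi>, of 0 "2 ^ N" 0 f, unfolded set_integrable_def], of ?c]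
      by (simp add: mult.commute)
    show ?thesis
      unfolding set_lebesgue_integral_def integral_bounded_linear[OF T int, symmetric]
      by (simp add: L2_linearD[OF Tl] conjugated_model_op_fourier_support[OF \<Phi>])
  qed
  with bounded_linear.tendsto[OF T lim] have "?T (inverse_fourier_L2 (L2_of g)) = 0"
    by (simp add: LIMSEQ_const_iff)
  then have "L2_of (\<lambda>\<xi>. indicator (- ?K) \<xi> * g \<xi>) = 0"
    by (simp add: mult_op_L2_of[OF indicator_compl_support_box sq])
  then have "AE \<xi> in lborel. indicator (- ?K) \<xi> * g \<xi> = 0"
    by (subst (asm) L2_of_eq_0_iff) (rule square_integrable_mult_fun[OF indicator_compl_support_box sq])
  moreover have "AE \<xi> in lborel. rep_L2 (fourier_L2 f) \<xi> = ?w \<xi>"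
    unfolding f_def by (simp add: rep_L2_of square_integrable_gauss_window)
  ultimately have "AE \<xi> in lborel. \<xi> \<in> - (?K \<union> {0}) \<longrightarrow> m \<xi> = 0"
  proof eventually_elim
    case (elim \<xi>)
    have "gauss_window 1 \<xi> \<noteq> 0" by (simp add: gauss_window_def)
    then show ?case using elim by (auto simp: g_def indicator_def)
  qed
  \<comment> \<open>Continuity of \<open>m\<close> is given away from the origin, so the open set
    leaves out the origin along with the box.\<close>
  moreover have "continuous_on (- (?K \<union> {0})) m"
    by (rule continuous_on_subset[OF cont]) auto
  moreover have "open (- (?K \<union> {0}))"
    by (intro open_Compl closed_Un closed_support_box) simp
  ultimately show ?thesis using \<xi> continuous_AE_zero[of "- (?K \<union> {0})" m \<xi>] by blast
qed

section \<open>The dyadic sum of the multiplier\<close>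

lemma continuous_on_matrix_vector_mult [continuous_intros]:
  fixes A :: "'a::topological_space \<Rightarrow> real^'n^'m"
  assumes "continuous_on S A" "continuous_on S x"
  shows "continuous_on S (\<lambda>p. A p *v x p)"
  unfolding matrix_vector_mult_def
  by (intro continuous_on_vec_lambda continuous_intros continuous_on_component assms)

lemma finite_dyadic_levels:
  fixes a b :: real
  assumes "a > 0"
  shows "finite {l::int. a \<le> 2 powi l \<and> 2 powi l \<le> b}"
proof -
  obtain n :: nat where n: "inverse a < 2 ^ n" using real_arch_pow[of 2 "inverse a"] by auto
  obtain k :: nat where k: "b < 2 ^ k" using real_arch_pow[of 2 b] by auto
  have "l \<in> {- int n..int k}" if "a \<le> 2 powi l" "2 powi l \<le> b" for l :: int
  proof -
    have "- int n \<le> l"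
    proof (rule ccontr)
      assume "\<not> - int n \<le> l"
      then have "2 powi l \<le> (2::real) powi (- int n)" by (intro power_int_increasing) auto
      also have "\<dots> < a" using n assms by (simp add: power_int_minus field_simps)
      finally show False using that by simp
    qed
    moreover have "l \<le> int k"
    proof (rule ccontr)
      assume "\<not> l \<le> int k"
      then have "(2::real) powi int k \<le> 2 powi l" by (intro power_int_increasing) auto
      then show False using k that by simp
    qed
    ultimately show ?thesis by simp
  qed
  then have "{l::int. a \<le> 2 powi l \<and> 2 powi l \<le> b} \<subseteq> {- int n..int k}" by blast
  then show ?thesis by (rule finite_subset) simp
qed

lemma support_box_0_component:
  assumes "(2 powi l) *\<^sub>R \<xi> \<in> support_box 0"
  shows "3 / 20 \<le> 2 powi l * \<bar>\<xi> $ i\<bar>" "2 powi l * \<bar>\<xi> $ i\<bar> \<le> 17 / 20"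
proof -
  have "- 17 / 20 \<le> 2 powi l * \<xi> $ i" "2 powi l * \<xi> $ i \<le> - 3 / 20"
    using assms by (auto simp: support_box_def dest: spec[of _ i])
  moreover have "\<bar>2 powi l * \<xi> $ i\<bar> = 2 powi l * \<bar>\<xi> $ i\<bar>" by (simp add: abs_mult)
  ultimately show "3 / 20 \<le> 2 powi l * \<bar>\<xi> $ i\<bar>" "2 powi l * \<bar>\<xi> $ i\<bar> \<le> 17 / 20"
    by linarith+
qed

definition levels :: "real^'n \<Rightarrow> int set" where
  "levels \<xi> = {l. (2 powi l) *\<^sub>R \<xi> \<in> support_box 0}"

text \<open>Levels three apart would place a ratio of at least 8 within the range from 3/20 to 17/20
  of one coordinate, whose end points have ratio 17/3.\<close>

lemma levels_le:
  assumes "k \<in> levels \<xi>" "l \<in> levels (\<xi> :: real^'n)"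
  shows "k \<le> l + 2"
proof (rule ccontr)
  assume "\<not> k \<le> l + 2"
  then have "2 powi (l + 3) \<le> (2::real) powi k" by (intro power_int_increasing) auto
  then have kl: "8 * 2 powi l \<le> (2::real) powi k" by (simp add: power_int_add)
  \<comment> \<open>Any coordinate serves; \<open>undefined\<close> picks one.\<close>
  define t where "t = \<bar>\<xi> $ undefined\<bar>"
  have "8 * (2 powi l * t) \<le> 2 powi k * t"
    using mult_right_mono[OF kl, of t] by (simp add: t_def)
  moreover have "3 / 20 \<le> 2 powi l * t" "2 powi k * t \<le> 17 / 20"
    unfolding t_def using assms support_box_0_component by (auto simp: levels_def)
  ultimately show False by simp
qed

lemma levels_subset:
  assumes "l \<in> levels \<xi>"
  shows "levels \<xi> \<subseteq> {l - 2..l + 2}"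
  using levels_le[of _ \<xi>] assms by force

text \<open>The bound 5 counts the integers from \<open>l - 2\<close> to \<open>l + 2\<close> about
  one level \<open>l\<close>.\<close>

lemma card_levels: "finite (levels \<xi>)" "card (levels \<xi>) \<le> 5"
proof -
  have "finite (levels \<xi>) \<and> card (levels \<xi>) \<le> 5"
  proof (cases "levels \<xi> = {}")
    case False
    then obtain l where "l \<in> levels \<xi>" by blast
    from levels_subset[OF this] have s: "levels \<xi> \<subseteq> {l - 2..l + 2}" .
    from finite_subset[OF this] card_mono[OF _ s] show ?thesis by simp
  qed simp
  then show "finite (levels \<xi>)" "card (levels \<xi>) \<le> 5" by auto
qed

text \<open>The multiplier with its irrelevant value at the origin normalised to \<open>0\<close>.\<close>

locale dyadic_multiplier =
  fixes m :: "real^'n::finite \<Rightarrow> complex" and C :: real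
  assumes cont: "continuous_on UNIV m"
    and support: "\<xi> \<notin> support_box 0 \<Longrightarrow> m \<xi> = 0"
    and bound: "cmod (m \<xi>) \<le> C"
begin

lemma C_nonneg: "0 \<le> C"
  using bound[of 0] norm_ge_zero order_trans by blast

text \<open>Allowing any finite superset of the levels lets a single \<open>L\<close> serve a whole
  neighbourhood, and lets a partial sum be recognised as the full one.\<close>

lemma dyadic_sum_eq_sum:
  assumes "finite L" "levels \<xi> \<subseteq> L"
  shows "dyadic_sum m \<xi> = (\<Sum>l\<in>L. m ((2 powi l) *\<^sub>R \<xi>))"
proof -
  have "dyadic_sum m \<xi> = (\<Sum>\<^sub>\<infinity>l\<in>L. m ((2 powi l) *\<^sub>R \<xi>))"
    unfolding dyadic_sum_def using assms(2) by (intro infsum_cong_neutral) (auto simp: levels_def intro!: support)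
  then show ?thesis using assms(1) by simp
qed

lemma norm_sum_levels_le:
  assumes "finite L"
  shows "cmod (\<Sum>l\<in>L. m ((2 powi l) *\<^sub>R \<xi>)) \<le> 5 * C"
proof -
  have "(\<Sum>l\<in>L. m ((2 powi l) *\<^sub>R \<xi>)) = (\<Sum>l\<in>L \<inter> levels \<xi>. m ((2 powi l) *\<^sub>R \<xi>))"
    using assms by (intro sum.mono_neutral_right) (auto simp: levels_def intro!: support)
  also have "cmod \<dots> \<le> of_nat (card (L \<inter> levels \<xi>)) * C"
    by (rule sum_norm_bound) (rule bound)
  also have "\<dots> \<le> 5 * C"
    using card_levels[of \<xi>] card_mono[of "levels \<xi>" "L \<inter> levels \<xi>"] by (intro mult_right_mono C_nonneg) auto
  finally show ?thesis .
qed

lemma norm_dyadic_sum_le: "cmod (dyadic_sum m \<xi>) \<le> 5 * C"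
  unfolding dyadic_sum_eq_sum[OF card_levels(1) subset_refl] by (rule norm_sum_levels_le[OF card_levels(1)])

text \<open>Near a nonzero point one coordinate stays comparable to its value, which confines the
  levels of all nearby points to one finite set; the series is a finite sum of continuous functions
  there.\<close>

lemma continuous_dyadic_sum:
  assumes "\<xi> \<noteq> 0"
  shows "isCont (dyadic_sum m) \<xi>"
proof -
  obtain i where "\<xi> $ i \<noteq> 0" using assms by (auto simp: vec_eq_iff)
  define \<rho> where "\<rho> = \<bar>\<xi> $ i\<bar>"
  have \<rho>: "\<rho> > 0" using \<open>\<xi> $ i \<noteq> 0\<close> by (simp add: \<rho>_def)
  define U where "U = {\<zeta>::real^'n. \<rho> / 2 < \<bar>\<zeta> $ i\<bar> \<and> \<bar>\<zeta> $ i\<bar> < 2 * \<rho>}"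
  \<comment> \<open>The bounds are 3/20 and 17/20 divided by the extreme values
    \<open>2 * \<rho>\<close> and \<open>\<rho> / 2\<close> of the coordinate.\<close>
  define L where "L = {l::int. 3 / 40 / \<rho> \<le> 2 powi l \<and> 2 powi l \<le> 17 / 10 / \<rho>}"
  have fin: "finite L" unfolding L_def using \<rho> by (intro finite_dyadic_levels) simp
  have lev: "levels \<zeta> \<subseteq> L" if "\<zeta> \<in> U" for \<zeta>
  proof
    fix l assume "l \<in> levels \<zeta>"
    then have 1: "3 / 20 \<le> 2 powi l * \<bar>\<zeta> $ i\<bar>" "2 powi l * \<bar>\<zeta> $ i\<bar> \<le> 17 / 20"
      using support_box_0_component by (auto simp: levels_def)
    have "2 powi l * \<bar>\<zeta> $ i\<bar> \<le> 2 powi l * (2 * \<rho>)" "2 powi l * (\<rho> / 2) \<le> 2 powi l * \<bar>\<zeta> $ i\<bar>"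
      using that by (auto simp: U_def intro!: mult_left_mono)
    with 1 have "3 / 20 \<le> 2 powi l * (2 * \<rho>)" "2 powi l * (\<rho> / 2) \<le> 17 / 20" by linarith+
    then show "l \<in> L" using \<rho> by (auto simp: L_def field_simps)
  qed
  have "open U" unfolding U_def by (intro open_Collect_conj open_Collect_less continuous_intros)
  moreover have "\<xi> \<in> U" using \<rho> by (simp add: U_def \<rho>_def)
  moreover have "continuous_on U (dyadic_sum m)"
  proof (rule continuous_on_eq)
    show "continuous_on U (\<lambda>\<zeta>. \<Sum>l\<in>L. m ((2 powi l) *\<^sub>R \<zeta>))"
      by (intro continuous_on_sum continuous_on_compose2[OF cont] continuous_intros) auto
  qed (simp add: dyadic_sum_eq_sum[OF fin lev])
  ultimately show ?thesis by (simp add: continuous_on_eq_continuous_at)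
qed

lemma borel_measurable_dyadic_sum [measurable]: "dyadic_sum m \<in> borel_measurable borel"
proof -
  \<comment> \<open>The support box avoids the origin, so every term vanishes there.\<close>
  have "dyadic_sum m 0 = 0"
    by (subst dyadic_sum_eq_sum[of "{}"]) (auto simp: levels_def support_box_def)
  then have "dyadic_sum m = (\<lambda>\<xi>. indicator (- {0}) \<xi> *\<^sub>R dyadic_sum m \<xi>)"
    by (auto simp: fun_eq_iff indicator_def)
  moreover have "(\<lambda>\<xi>. indicator (- {0}) \<xi> *\<^sub>R dyadic_sum m \<xi>) \<in> borel_measurable borel"
    by (intro borel_measurable_continuous_on_indicator)
      (auto intro!: continuous_at_imp_continuous_on continuous_dyadic_sum)
  ultimately show ?thesis by simp
qed

text \<open>A shift of the summation index. In the exponent \<open>\<kappa>\<close> it is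
  periodicity with period 1, the length of the range of integration.\<close>

lemma dyadic_sum_double: "dyadic_sum m (2 *\<^sub>R \<xi>) = dyadic_sum m \<xi>"
proof -
  have "bij_betw (\<lambda>l::int. l + 1) UNIV UNIV"
    by (rule bij_betwI[of _ _ _ "\<lambda>l. l - 1"]) auto
  from infsum_reindex_bij_betw[OF this, of "\<lambda>l. m ((2 powi l) *\<^sub>R \<xi>)"]
  show ?thesis by (simp add: dyadic_sum_def power_int_add mult.commute)
qed

lemma borel_measurable_m [measurable]: "m \<in> borel_measurable borel"
  by (rule borel_measurable_continuous_onI[OF cont])

text \<open>A partial sum over \<open>S\<close> containing \<open>{- int n..int n}\<close> differs
  from the full sum only where some level exceeds \<open>n\<close> in modulus, and there by at most
  \<open>10 * C\<close>. Each point has finitely many levels and so leaves these sets eventually;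
  dominated convergence makes the error small in norm.\<close>

lemma has_sum_mult_op:
  assumes B [measurable]: "B \<in> borel_measurable borel"
  shows "((\<lambda>l. mult_op (\<lambda>\<xi>. m ((2 powi l) *\<^sub>R B \<xi>)) g) has_sum mult_op (\<lambda>\<xi>. dyadic_sum m (B \<xi>)) (g :: (real^'n) L2)) UNIV"
  unfolding has_sum_def
proof (rule tendstoI)
  fix e :: real assume "e > 0"
  let ?g = "rep_L2 g"
  have g: "square_integrable ?g" by (rule square_integrable_rep_L2)
  note [measurable] = square_integrableD(2)[OF g]
  define E where "E n = (\<Union>l\<in>{l. int n < \<bar>l\<bar>}. {\<zeta>::real^'n. (2 powi l) *\<^sub>R \<zeta> \<in> support_box 0})" for n
  have [measurable]: "E n \<in> sets borel" for n
    unfolding E_def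
    by (intro sets.countable_UN'' borel_closed closed_vimage[unfolded vimage_def, OF closed_support_box] continuous_intros) auto
  \<comment> \<open>The constant adds one bound \<open>5 * C\<close> for the partial sum and one for
    the full sum.\<close>
  define u where "u n \<xi> = complex_of_real (10 * C) * (indicator (E n) (B \<xi>) * ?g \<xi>)" for n \<xi>
  have um [measurable]: "u n \<in> borel_measurable borel" for n unfolding u_def by measurable
  have "(\<lambda>n. L2_of (u n)) \<longlonglongrightarrow> L2_of (\<lambda>\<xi>. 0)"
  proof (rule tendsto_L2_of_dominated(2)[OF square_integrable_mult[OF g, of "complex_of_real (10 * C)"]])
    have "(\<lambda>n. u n \<xi>) \<longlonglongrightarrow> 0" for \<xi>
    proof (rule tendsto_eventually)
      obtain n0 where n0: "\<And>l. l \<in> levels (B \<xi>) \<Longrightarrow> \<bar>l\<bar> \<le> int n0"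
      proof -
        have "finite ((\<lambda>l. nat \<bar>l\<bar>) ` levels (B \<xi>))" by (intro finite_imageI card_levels)
        then obtain n0 where "\<forall>k\<in>(\<lambda>l. nat \<bar>l\<bar>) ` levels (B \<xi>). k \<le> n0"
          using finite_nat_set_iff_bounded_le by blast
        then show ?thesis by (intro that[of n0]) auto
      qed
      show "\<forall>\<^sub>F n in sequentially. u n \<xi> = 0"
        unfolding eventually_sequentially
      proof (intro exI[of _ n0] allI impI)
        fix n assume "n0 \<le> n"
        then have "B \<xi> \<notin> E n" using n0 by (force simp: E_def levels_def)
        then show "u n \<xi> = 0" by (simp add: u_def)
      qed
    qed
    then show "AE \<xi> in lborel. (\<lambda>n. u n \<xi>) \<longlonglongrightarrow> 0" by simp
    show "AE \<xi> in lborel. cmod (u n \<xi>) \<le> cmod (complex_of_real (10 * C) * ?g \<xi>)" for n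
      by (auto simp: u_def norm_mult indicator_def C_nonneg intro!: AE_I2)
  qed (simp_all add: um)
  then obtain n where n: "norm (L2_of (u n)) < e"
    using \<open>e > 0\<close> unfolding L2_of_zero by (metis LIMSEQ_D diff_zero order_refl)
  have su: "square_integrable (u n)"
    by (rule square_integrable_bound[OF square_integrable_mult[OF g, of "complex_of_real (10 * C)"]])
      (auto simp: u_def norm_mult indicator_def C_nonneg intro!: AE_I2)
  have close: "dist (\<Sum>l\<in>S. mult_op (\<lambda>\<xi>. m ((2 powi l) *\<^sub>R B \<xi>)) g) (mult_op (\<lambda>\<xi>. dyadic_sum m (B \<xi>)) g) < e"
    if S: "finite S" "{- int n..int n} \<subseteq> S" for S
  proof -
    have sl: "square_integrable (\<lambda>\<xi>. m ((2 powi l) *\<^sub>R B \<xi>) * ?g \<xi>)" for l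
      by (rule square_integrable_mult_fun[where C = C]) (auto simp: bound g)
    have sM: "square_integrable (\<lambda>\<xi>. dyadic_sum m (B \<xi>) * ?g \<xi>)"
      by (rule square_integrable_mult_fun[where C = "5 * C"]) (auto simp: norm_dyadic_sum_le g)
    note sS = L2_of_sum[of S "\<lambda>l \<xi>. m ((2 powi l) *\<^sub>R B \<xi>) * ?g \<xi>", OF sl]
    have "dist (\<Sum>l\<in>S. mult_op (\<lambda>\<xi>. m ((2 powi l) *\<^sub>R B \<xi>)) g) (mult_op (\<lambda>\<xi>. dyadic_sum m (B \<xi>)) g)
        = norm (L2_of (\<lambda>\<xi>. (\<Sum>l\<in>S. m ((2 powi l) *\<^sub>R B \<xi>) * ?g \<xi>) - dyadic_sum m (B \<xi>) * ?g \<xi>))"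
      unfolding dist_norm mult_op_def using sS by (simp add: L2_of_diff sM)
    also have "\<dots> \<le> norm (L2_of (u n))"
    proof (rule norm_L2_of_mono[OF square_integrable_diff[OF _ sM] su])
      show "square_integrable (\<lambda>\<xi>. \<Sum>l\<in>S. m ((2 powi l) *\<^sub>R B \<xi>) * ?g \<xi>)" using sS by blast
      fix \<xi>
      have eq: "(\<Sum>l\<in>S. m ((2 powi l) *\<^sub>R B \<xi>) * ?g \<xi>) - dyadic_sum m (B \<xi>) * ?g \<xi>
          = ((\<Sum>l\<in>S. m ((2 powi l) *\<^sub>R B \<xi>)) - dyadic_sum m (B \<xi>)) * ?g \<xi>"
        by (simp add: sum_distrib_right left_diff_distrib)
      show "cmod ((\<Sum>l\<in>S. m ((2 powi l) *\<^sub>R B \<xi>) * ?g \<xi>) - dyadic_sum m (B \<xi>) * ?g \<xi>) \<le> cmod (u n \<xi>)"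
      proof (cases "B \<xi> \<in> E n")
        case True
        have "cmod ((\<Sum>l\<in>S. m ((2 powi l) *\<^sub>R B \<xi>)) - dyadic_sum m (B \<xi>)) \<le> 10 * C"
          using norm_triangle_ineq4[of "\<Sum>l\<in>S. m ((2 powi l) *\<^sub>R B \<xi>)" "dyadic_sum m (B \<xi>)"]
            norm_sum_levels_le[OF S(1), of "B \<xi>"] norm_dyadic_sum_le[of "B \<xi>"] by linarith
        then show ?thesis
          unfolding eq u_def norm_mult using True C_nonneg by (auto intro!: mult_right_mono)
      next
        case False
        have "levels (B \<xi>) \<subseteq> {- int n..int n}"
          using False by (force simp: E_def levels_def)
        then have "levels (B \<xi>) \<subseteq> S" using S(2) by blast
        from dyadic_sum_eq_sum[OF S(1) this] show ?thesis unfolding eq by simp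
      qed
    qed
    finally show ?thesis using n by simp
  qed
  show "\<forall>\<^sub>F S in finite_subsets_at_top UNIV. dist (\<Sum>l\<in>S. mult_op (\<lambda>\<xi>. m ((2 powi l) *\<^sub>R B \<xi>)) g) (mult_op (\<lambda>\<xi>. dyadic_sum m (B \<xi>)) g) < e"
    unfolding eventually_finite_subsets_at_top
    by (intro exI[of _ "{- int n..int n}"]) (use close in auto)
qed

end

section \<open>Averages over rotations and dilations\<close>

lemma L2_of_rho:
  fixes f :: "real^'n \<Rightarrow> complex"
  assumes "orthogonal_matrix A" "square_integrable f"
  shows "rho A (L2_of f) = L2_of (\<lambda>x. f (matrix_inv A *v x))" "square_integrable (\<lambda>x. f (matrix_inv A *v x))"
proof -
  note o = isometric_subst_orthogonal[OF matrix_inv_orthogonal(2)[OF assms(1)]]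
  show "rho A (L2_of f) = L2_of (\<lambda>x. f (matrix_inv A *v x))"
    unfolding rho_eq_subst subst_op_L2_of[OF o assms(2)] by simp
  show "square_integrable (\<lambda>x. f (matrix_inv A *v x))"
    using square_integrable_subst[OF o assms(2)] by simp
qed

lemma orthogonal_matrix_inv_mult:
  fixes A :: "real^'n^'n"
  assumes "orthogonal_matrix A"
  shows "matrix_inv A *v (A *v x) = x" "A *v (matrix_inv A *v x) = x" "matrix_inv (matrix_inv A) = A"
  using assms matrix_inv_orthogonal[OF assms] matrix_inv_orthogonal(1)[of "transpose A"]
  by (auto simp: orthogonal_matrix_def matrix_vector_mul_assoc orthogonal_matrix_transpose simp del: transpose_matrix_vector)

text \<open>Substituting forth and back composes the symbol with the linear map, while the
  normalizations of the two dilations cancel.\<close>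

lemma mult_op_conjugate:
  fixes g :: "(real^'n) L2" and h :: "real^'n \<Rightarrow> complex"
  assumes A: "orthogonal_matrix A" and h [measurable]: "h \<in> borel_measurable borel" and C: "\<And>\<xi>. cmod (h \<xi>) \<le> C"
    and s: "s > 0"
  shows "rho (matrix_inv A) (dilate (inverse s) (mult_op h (dilate s (rho A g)))) = mult_op (\<lambda>\<xi>. h (s *\<^sub>R (A *v \<xi>))) g"
proof -
  let ?g = "rep_L2 g"
  define c where "c = s powr (- (real CARD('n) / 2))"
  have c: "c > 0" using s by (simp add: c_def)
  have s': "inverse s > 0" using s by simp
  have c': "inverse s powr (- (real CARD('n) / 2)) = inverse c"
    using s by (simp add: c_def powr_minus inverse_powr)
  have h': "AE \<xi> in lborel. cmod (h \<xi>) \<le> C" using C by simp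
  have g: "square_integrable ?g" by (rule square_integrable_rep_L2)
  note r1 = L2_of_rho[OF A g]
  note d1 = L2_of_dilate[OF s r1(2), folded c_def] square_integrable_dilate[OF s r1(2), folded c_def]
  note m1 = mult_op_L2_of[OF h h' d1(2)] square_integrable_mult_fun[OF h h' d1(2)]
  note d2 = L2_of_dilate[OF s' m1(2), unfolded c'] square_integrable_dilate[OF s' m1(2), unfolded c']
  note r2 = L2_of_rho[OF matrix_inv_orthogonal(2)[OF A] d2(2)]
  have "rho (matrix_inv A) (dilate (inverse s) (mult_op h (dilate s (rho A (L2_of ?g))))) =
    L2_of (\<lambda>x. complex_of_real (inverse c) * (h (inverse (inverse s) *\<^sub>R (matrix_inv (matrix_inv A) *v x)) *
      (complex_of_real c * ?g (matrix_inv A *v (inverse s *\<^sub>R (inverse (inverse s) *\<^sub>R (matrix_inv (matrix_inv A) *v x)))))))"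
    unfolding r1(1) d1(1) m1(1) d2(1) r2(1) ..
  also have "\<dots> = L2_of (\<lambda>x. h (s *\<^sub>R (A *v x)) * ?g x)"
  proof -
    have i: "inverse s *\<^sub>R (s *\<^sub>R y) = y" for y :: "real^'n" using s by simp
    have cc: "complex_of_real (inverse c) * (u * (complex_of_real c * v)) = u * v" for u v
      using c by simp
    show ?thesis
      unfolding orthogonal_matrix_inv_mult(3)[OF A] inverse_inverse_eq i orthogonal_matrix_inv_mult(1)[OF A] cc ..
  qed
  finally show ?thesis by (simp add: mult_op_def)
qed

lemma bounded_linear_cinner_left: "bounded_linear (\<lambda>f. cinner_L2 f g)"
proof (rule bounded_linear_intro[where K = "norm g"])
  fix f h :: "'a L2" and r :: real
  show "cinner_L2 (f + h) g = cinner_L2 f g + cinner_L2 h g" by (rule cinner_L2_add_left)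
  show "cinner_L2 (r *\<^sub>R f) g = r *\<^sub>R cinner_L2 f g"
    using cinner_L2_scaleC_left[of "of_real r" f g] by (simp add: scaleC_L2_of_real scaleR_conv_of_real)
  show "norm (cinner_L2 f g) \<le> norm f * norm g" by (rule norm_cinner_L2_le)
qed

lemma cinner_mult_op:
  assumes [measurable]: "h \<in> borel_measurable borel" and "\<And>\<xi>. cmod (h \<xi>) \<le> C"
  shows "cinner_L2 (mult_op h f) g = (LINT \<xi>|lborel. h \<xi> * (rep_L2 f \<xi> * cnj (rep_L2 g \<xi>)))"
proof -
  have "cinner_L2 (mult_op h f) (L2_of (rep_L2 g)) = (LINT \<xi>|lborel. h \<xi> * rep_L2 f \<xi> * cnj (rep_L2 g \<xi>))"
    unfolding mult_op_def
    by (intro cinner_L2_of square_integrable_mult_fun[where C = C] square_integrable_rep_L2) (use assms in auto)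
  then show ?thesis by (simp add: mult.assoc)
qed

section \<open>Operators with a rotated and dilated multiplier, and their average\<close>

context dyadic_multiplier
begin

definition radial_mult :: "real^'n^'n \<Rightarrow> real \<Rightarrow> real^'n \<Rightarrow> complex" where
  "radial_mult A \<kappa> \<xi> = dyadic_sum m ((2 powr (- \<kappa>)) *\<^sub>R (A *v \<xi>))"

definition radial_op :: "(real^'n) L2 \<Rightarrow> real^'n^'n \<Rightarrow> real \<Rightarrow> (real^'n) L2" where
  "radial_op f A \<kappa> = inverse_fourier_L2 (mult_op (radial_mult A \<kappa>) (fourier_L2 f))"

lemma borel_measurable_scaled_matrix:
  "(\<lambda>\<xi>. c *\<^sub>R (A *v \<xi>)) \<in> borel_measurable (borel :: (real^'n) measure)" for A :: "real^'n^'n"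
  by (intro borel_measurable_continuous_onI continuous_intros)

lemma radial_mult:
  "radial_mult A \<kappa> \<in> borel_measurable borel" "cmod (radial_mult A \<kappa> \<xi>) \<le> 5 * C"
  using measurable_compose[OF borel_measurable_scaled_matrix borel_measurable_dyadic_sum]
  by (auto simp: radial_mult_def[abs_def] norm_dyadic_sum_le)

lemma norm_radial_op_le: "norm (radial_op f A \<kappa>) \<le> norm f * (5 * C)"
  unfolding radial_op_def L2_isometryD(2)[OF L2_isometry_inverse_fourier_L2]
  using norm_mult_op_le[of "radial_mult A \<kappa>" "5 * C" "fourier_L2 f"] radial_mult
  by (simp add: L2_isometryD(2)[OF L2_isometry_fourier_L2])

text \<open>Provides the joint measurability in rotation and dilation that Fubini's theorem
  requires. The symbols converge pointwise because \<open>dyadic_sum m\<close> is continuous away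
  from the origin, and \<open>5 * C\<close> dominates them.\<close>

lemma continuous_on_radial_op: "continuous_on (SO \<times> UNIV) (\<lambda>(A, \<kappa>). radial_op f A \<kappa>)"
proof -
  have "(\<lambda>n. radial_op f (A n) (k n)) \<longlonglongrightarrow> radial_op f B \<kappa>"
    if B: "B \<in> SO" and lim: "A \<longlonglongrightarrow> B" "k \<longlonglongrightarrow> \<kappa>" for A B k \<kappa>
  proof -
    let ?g = "rep_L2 (fourier_L2 f)"
    have g: "square_integrable ?g" by (rule square_integrable_rep_L2)
    note [measurable] = square_integrableD(2)[OF g] radial_mult(1)
    have "(\<lambda>n. L2_of (\<lambda>\<xi>. radial_mult (A n) (k n) \<xi> * ?g \<xi>)) \<longlonglongrightarrow> L2_of (\<lambda>\<xi>. radial_mult B \<kappa> \<xi> * ?g \<xi>)"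
    proof (rule tendsto_L2_of_dominated(2)[OF square_integrable_mult[OF g, of "complex_of_real (5 * C)"]])
      show "AE \<xi> in lborel. (\<lambda>n. radial_mult (A n) (k n) \<xi> * ?g \<xi>) \<longlonglongrightarrow> radial_mult B \<kappa> \<xi> * ?g \<xi>"
        using AE_lborel_singleton[of 0]
      proof eventually_elim
        case (elim \<xi>)
        \<comment> \<open>An invertible \<open>B\<close> keeps nonzero frequencies at points where
          \<open>dyadic_sum m\<close> is continuous; the origin is a null set.\<close>
        have "B *v \<xi> \<noteq> 0"
          using B elim orthogonal_matrix_inv_mult(1)[of B \<xi>] by (auto simp: SO_def)
        then have c: "isCont (dyadic_sum m) ((2 powr (- \<kappa>)) *\<^sub>R (B *v \<xi>))"
          by (intro continuous_dyadic_sum) simp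
        have conv: "(\<lambda>n. (2 powr (- k n)) *\<^sub>R (A n *v \<xi>)) \<longlonglongrightarrow> (2 powr (- \<kappa>)) *\<^sub>R (B *v \<xi>)"
          unfolding matrix_vector_mult_def
          by (intro tendsto_intros lim tendsto_vec_nth) auto
        show ?case
          unfolding radial_mult_def
          by (rule tendsto_mult[OF isCont_tendsto_compose[OF c conv] tendsto_const])
      qed
      show "AE \<xi> in lborel. cmod (radial_mult (A j) (k j) \<xi> * ?g \<xi>) \<le> cmod (complex_of_real (5 * C) * ?g \<xi>)" for j
        using C_nonneg radial_mult(2) by (auto simp: norm_mult intro!: AE_I2 mult_right_mono)
    qed measurable
    then have "(\<lambda>n. mult_op (radial_mult (A n) (k n)) (fourier_L2 f)) \<longlonglongrightarrow> mult_op (radial_mult B \<kappa>) (fourier_L2 f)"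
      by (simp only: mult_op_def)
    then show ?thesis
      unfolding radial_op_def by (rule bounded_linear.tendsto[OF L2_isometryD(3)[OF L2_isometry_inverse_fourier_L2]])
  qed
  note seq = this
  show ?thesis
    unfolding continuous_on_sequentially o_def split_beta
  proof (intro allI ballI impI, elim conjE)
    fix x and a :: "(real^'n^'n) \<times> real"
    assume "a \<in> SO \<times> UNIV" and x: "x \<longlonglongrightarrow> a"
    then show "(\<lambda>n. radial_op f (fst (x n)) (snd (x n))) \<longlonglongrightarrow> radial_op f (fst a) (snd a)"
      by (intro seq tendsto_fst[OF x] tendsto_snd[OF x]) auto
  qed
qed

text \<open>The conjugated operators produce \<open>2 powr (- \<kappa>)\<close>, whereas
  \<open>\<alpha>\<close> is defined with \<open>2 powr \<kappa>\<close>; reflecting the unit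
  interval leaves a factor 2, which the doubling invariance absorbs.\<close>

lemma set_integral_reflect_unit:
  assumes "\<xi> \<noteq> 0"
  shows "(LINT \<kappa>:{0..1}|lborel. dyadic_sum m ((2 powr \<kappa>) *\<^sub>R (A *v \<xi>))) = (LINT \<kappa>:{0..1}|lborel. radial_mult A \<kappa> \<xi>)"
proof -
  define u where "u \<kappa> = indicator {0..1::real} \<kappa> *\<^sub>R dyadic_sum m ((2 powr \<kappa>) *\<^sub>R (A *v \<xi>))" for \<kappa> :: real
  have [measurable]: "(\<lambda>\<kappa>. (2 powr \<kappa>) *\<^sub>R (A *v \<xi>)) \<in> borel_measurable borel" by measurable
  have [measurable]: "u \<in> borel_measurable borel" unfolding u_def by measurable
  have "(LINT \<kappa>|lborel. u \<kappa>) = (LINT \<kappa>|lborel. u (1 - \<kappa>))"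
    by (subst (1) distr_lborel_reflect[of "1::real", symmetric]) (simp add: integral_distr)
  moreover have "u (1 - \<kappa>) = indicator {0..1} \<kappa> *\<^sub>R radial_mult A \<kappa> \<xi>" for \<kappa>
  proof -
    have "(2 powr (1 - \<kappa>)) *\<^sub>R (A *v \<xi>) = 2 *\<^sub>R ((2 powr (- \<kappa>)) *\<^sub>R (A *v \<xi>))"
      by (simp add: powr_diff powr_minus field_simps)
    moreover have "indicator {0..1} (1 - \<kappa>) = (indicator {0..1} \<kappa> :: real)" by (auto simp: indicator_def)
    ultimately show ?thesis unfolding u_def radial_mult_def by (simp only: dyadic_sum_double)
  qed
  ultimately show ?thesis by (simp add: set_lebesgue_integral_def u_def)
qed

lemma radial_op_average:
  fixes \<mu> :: "(real^'n^'n) measure"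
  assumes space: "space \<mu> = SO" and sets: "sets \<mu> = sets (restrict_space borel SO)" and prob: "emeasure \<mu> (space \<mu>) = 1"
    and \<alpha>: "\<And>\<xi>. \<xi> \<noteq> 0 \<Longrightarrow> complex_of_real \<alpha> =
        (LINT A|\<mu>. (LINT \<kappa>:{0..1}|lborel. dyadic_sum m ((2 powr \<kappa>) *\<^sub>R (A *v \<xi>))))"
  shows "A \<in> SO \<Longrightarrow> set_integrable lborel {0..1} (radial_op f A)"
    and "integrable \<mu> (\<lambda>A. LINT \<kappa>:{0..1}|lborel. radial_op f A \<kappa>)"
    and "\<alpha> *\<^sub>R f = (LINT A|\<mu>. (LINT \<kappa>:{0..1}|lborel. radial_op f A \<kappa>))"
proof -
  interpret \<mu>: prob_space \<mu> by (rule prob_spaceI) (rule prob)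
  interpret P: pair_sigma_finite \<mu> "lborel :: real measure" ..
  interpret Q: pair_sigma_finite "\<mu> \<Otimes>\<^sub>M (lborel :: real measure)" "lborel :: (real^'n) measure" ..
  define G where "G p = indicator {0..1::real} (snd p) *\<^sub>R radial_op f (fst p) (snd p)" for p
  have id\<mu> [measurable]: "(\<lambda>A. A) \<in> measurable \<mu> borel"
    unfolding measurable_cong_sets[OF sets refl] by (intro measurable_restrict_space1) simp
  \<comment> \<open>Continuity of \<open>radial_op\<close> is relative to
    \<open>SO \<times> UNIV\<close>, while the product sigma-algebra is built from
    \<open>\<mu>\<close>; measurability of the identity links the two.\<close>
  have embed: "(\<lambda>p. p) \<in> measurable (\<mu> \<Otimes>\<^sub>M (lborel :: real measure)) (restrict_space borel (SO \<times> UNIV))"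
  proof (rule measurable_restrict_space2)
    show "(\<lambda>p. p) \<in> space (\<mu> \<Otimes>\<^sub>M (lborel :: real measure)) \<rightarrow> SO \<times> UNIV"
      by (auto simp: space_pair_measure space)
    have "(\<lambda>p. (fst p, snd p)) \<in> measurable (\<mu> \<Otimes>\<^sub>M (lborel :: real measure)) (borel \<Otimes>\<^sub>M borel)"
      by measurable
    then show "(\<lambda>p. p) \<in> borel_measurable (\<mu> \<Otimes>\<^sub>M (lborel :: real measure))"
      by (simp add: borel_prod)
  qed
  have Rm: "(\<lambda>p. radial_op f (fst p) (snd p)) \<in> borel_measurable (\<mu> \<Otimes>\<^sub>M (lborel :: real measure))"
    using measurable_compose[OF embed borel_measurable_continuous_on_restrict[OF continuous_on_radial_op]]
    by (simp add: split_beta)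
  then have Gm: "G \<in> borel_measurable (\<mu> \<Otimes>\<^sub>M (lborel :: real measure))"
    unfolding G_def by measurable
  have unit: "integrable (\<mu> \<Otimes>\<^sub>M (lborel :: real measure)) (\<lambda>p. indicator {0..1::real} (snd p) :: real)"
  proof -
    have S: "SO \<in> sets \<mu>" using space sets.top[of \<mu>] by simp
    have "emeasure (\<mu> \<Otimes>\<^sub>M (lborel :: real measure)) (SO \<times> {0..1}) = emeasure \<mu> SO * emeasure lborel {0..1::real}"
      by (rule lborel.emeasure_pair_measure_Times) (use S in auto)
    also have "\<dots> < \<infinity>" using prob by (simp add: space)
    finally have "integrable (\<mu> \<Otimes>\<^sub>M (lborel :: real measure)) (indicator (SO \<times> {0..1}) :: _ \<Rightarrow> real)"
      using S by (intro integrable_real_indicator) auto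
    then show ?thesis
      by (rule Bochner_Integration.integrable_cong[THEN iffD1, rotated 2])
        (auto simp: space_pair_measure space indicator_def)
  qed
  have Gint: "integrable (\<mu> \<Otimes>\<^sub>M (lborel :: real measure)) G"
  proof (rule Bochner_Integration.integrable_bound[OF integrable_mult_left[OF unit, of "norm f * (5 * C)"] Gm])
    show "AE p in (\<mu> \<Otimes>\<^sub>M lborel). norm (G p) \<le> norm (indicator {0..1} (snd p) * (norm f * (5 * C)))"
      using norm_radial_op_le C_nonneg by (auto simp: G_def abs_mult intro!: AE_I2 mult_left_mono)
  qed
  show "set_integrable lborel {0..1} (radial_op f A)" if "A \<in> SO" for A
    unfolding set_integrable_def
  proof (rule Bochner_Integration.integrable_bound[of _ "\<lambda>\<kappa>. indicator {0..1::real} \<kappa> *\<^sub>R (norm f * (5 * C))"])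
    have "continuous_on UNIV (\<lambda>\<kappa>::real. (A, \<kappa>))" by (intro continuous_intros)
    from continuous_on_compose2[OF continuous_on_radial_op this, of f] that
    have "continuous_on UNIV (radial_op f A)" by auto
    then have [measurable]: "radial_op f A \<in> borel_measurable borel" by (rule borel_measurable_continuous_onI)
    show "(\<lambda>\<kappa>. indicator {0..1} \<kappa> *\<^sub>R radial_op f A \<kappa>) \<in> borel_measurable lborel" by measurable
    show "AE \<kappa> in lborel. norm (indicator {0..1} \<kappa> *\<^sub>R radial_op f A \<kappa>) \<le> norm (indicator {0..1} \<kappa> *\<^sub>R (norm f * (5 * C)))"
      using norm_radial_op_le C_nonneg by (auto simp: abs_mult intro!: AE_I2 mult_left_mono)
    show "integrable lborel (\<lambda>\<kappa>. indicator {0..1::real} \<kappa> *\<^sub>R (norm f * (5 * C)))"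
      by (intro integrable_scaleR_left integrable_real_indicator) auto
  qed
  have fstG: "(LINT \<kappa>|lborel. G (A, \<kappa>)) = (LINT \<kappa>:{0..1}|lborel. radial_op f A \<kappa>)" for A
    by (simp add: G_def set_lebesgue_integral_def)
  show "integrable \<mu> (\<lambda>A. LINT \<kappa>:{0..1}|lborel. radial_op f A \<kappa>)"
    using P.integrable_fst'[OF Gint] by (simp add: fstG)
  have GI: "(LINT A|\<mu>. (LINT \<kappa>:{0..1}|lborel. radial_op f A \<kappa>)) = (LINT p|(\<mu> \<Otimes>\<^sub>M lborel). G p)"
    using P.integral_fst'[OF Gint] by (simp add: fstG)
  have meas [measurable]: "(\<lambda>z. radial_mult (fst (fst z)) (snd (fst z)) (snd z)) \<in> borel_measurable ((\<mu> \<Otimes>\<^sub>M (lborel :: real measure)) \<Otimes>\<^sub>M (lborel :: (real^'n) measure))"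
  proof -
    have cont: "continuous_on UNIV (\<lambda>z :: ((real^'n^'n) \<times> real) \<times> (real^'n). (2 powr (- snd (fst z))) *\<^sub>R (fst (fst z) *v snd z))"
      by (intro continuous_intros) auto
    have "(\<lambda>z. ((fst (fst z), snd (fst z)), snd z)) \<in> measurable ((\<mu> \<Otimes>\<^sub>M (lborel :: real measure)) \<Otimes>\<^sub>M (lborel :: (real^'n) measure)) ((borel \<Otimes>\<^sub>M borel) \<Otimes>\<^sub>M borel)"
      by measurable
    then have "(\<lambda>z. z) \<in> measurable ((\<mu> \<Otimes>\<^sub>M (lborel :: real measure)) \<Otimes>\<^sub>M (lborel :: (real^'n) measure)) borel"
      by (simp add: borel_prod)
    from measurable_compose[OF measurable_compose[OF this borel_measurable_continuous_onI[OF cont]] borel_measurable_dyadic_sum]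
    show ?thesis
      by (simp add: radial_mult_def)
  qed
  have \<alpha>': "(LINT p|(\<mu> \<Otimes>\<^sub>M lborel). indicator {0..1} (snd p) *\<^sub>R radial_mult (fst p) (snd p) \<xi>) = complex_of_real \<alpha>"
    if "\<xi> \<noteq> 0" for \<xi>
  proof -
    have [measurable]: "(\<lambda>p. radial_mult (fst p) (snd p) \<xi>) \<in> borel_measurable (\<mu> \<Otimes>\<^sub>M (lborel :: real measure))"
      using measurable_compose[OF measurable_Pair[OF measurable_ident_sets[OF refl] measurable_const[of \<xi>]] meas] by simp
    have int: "integrable (\<mu> \<Otimes>\<^sub>M (lborel :: real measure)) (\<lambda>p. indicator {0..1} (snd p) *\<^sub>R radial_mult (fst p) (snd p) \<xi>)"
      by (rule Bochner_Integration.integrable_bound[OF integrable_mult_left[OF unit, of "5 * C"]])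
        (use radial_mult(2) C_nonneg in \<open>auto simp: abs_mult intro!: AE_I2 mult_left_mono\<close>)
    have "(LINT p|(\<mu> \<Otimes>\<^sub>M lborel). indicator {0..1} (snd p) *\<^sub>R radial_mult (fst p) (snd p) \<xi>)
        = (LINT A|\<mu>. (LINT \<kappa>:{0..1}|lborel. radial_mult A \<kappa> \<xi>))"
      using P.integral_fst'[OF int] by (simp add: set_lebesgue_integral_def)
    then show "(LINT p|(\<mu> \<Otimes>\<^sub>M lborel). indicator {0..1} (snd p) *\<^sub>R radial_mult (fst p) (snd p) \<xi>) = complex_of_real \<alpha>"
      by (simp add: \<alpha>[OF that] set_integral_reflect_unit[OF that])
  qed
  have "cinner_L2 (\<alpha> *\<^sub>R f) H = cinner_L2 (LINT p|(\<mu> \<Otimes>\<^sub>M lborel). G p) H" for H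
  proof -
    \<comment> \<open>On the Fourier side the symbol is paired with this product of two
      square-integrable functions, which is integrable.\<close>
    define q where "q \<xi> = rep_L2 (fourier_L2 f) \<xi> * cnj (rep_L2 (fourier_L2 H) \<xi>)" for \<xi>
    have q: "integrable lborel q"
      unfolding q_def by (intro square_integrable_inner square_integrable_rep_L2)
    note [measurable] = borel_measurable_integrable[OF q, simplified]
    define k where "k p \<xi> = indicator {0..1::real} (snd p) *\<^sub>R radial_mult (fst p) (snd p) \<xi> * q \<xi>" for p \<xi>
    \<comment> \<open>An integrable majorant on the triple product of rotations, dilations and
      frequencies: the first two have total mass 1 under the indicator, and \<open>q\<close> is
      integrable in the third.\<close>
    have kq: "integrable ((\<mu> \<Otimes>\<^sub>M (lborel :: real measure)) \<Otimes>\<^sub>M (lborel :: (real^'n) measure))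
        (\<lambda>z. indicator {0..1::real} (snd (fst z)) * (cmod (q (snd z)) * (5 * C)))"
    proof (rule Q.Fubini_integrable)
      show "integrable (\<mu> \<Otimes>\<^sub>M lborel) (\<lambda>p. LINT \<xi>|lborel. norm (indicator {0..1::real} (snd (fst (p, \<xi>))) * (cmod (q (snd (p, \<xi>))) * (5 * C))))"
        using integrable_mult_left[OF unit, of "(LINT \<xi>|lborel. cmod (q \<xi>)) * (5 * C)"] C_nonneg
        by (simp add: abs_mult)
      show "AE p in (\<mu> \<Otimes>\<^sub>M lborel). integrable lborel (\<lambda>\<xi>. indicator {0..1::real} (snd (fst (p, \<xi>))) * (cmod (q (snd (p, \<xi>))) * (5 * C)))"
        using q by simp
    qed measurable
    have kint: "integrable ((\<mu> \<Otimes>\<^sub>M (lborel :: real measure)) \<Otimes>\<^sub>M (lborel :: (real^'n) measure)) (case_prod k)"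
      unfolding k_def split_beta
    proof (rule Bochner_Integration.integrable_bound[OF kq])
      show "AE z in ((\<mu> \<Otimes>\<^sub>M lborel) \<Otimes>\<^sub>M lborel). norm (indicator {0..1} (snd (fst z)) *\<^sub>R radial_mult (fst (fst z)) (snd (fst z)) (snd z) * q (snd z))
          \<le> norm (indicator {0..1} (snd (fst z)) * (cmod (q (snd z)) * (5 * C)))"
      proof (intro AE_I2)
        fix z :: "((real^'n^'n) \<times> real) \<times> (real^'n)"
        have "cmod (radial_mult (fst (fst z)) (snd (fst z)) (snd z)) * cmod (q (snd z)) \<le> 5 * C * cmod (q (snd z))"
          by (intro mult_right_mono radial_mult) simp
        then show "norm (indicator {0..1} (snd (fst z)) *\<^sub>R radial_mult (fst (fst z)) (snd (fst z)) (snd z) * q (snd z))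
          \<le> norm (indicator {0..1} (snd (fst z)) * (cmod (q (snd z)) * (5 * C)))"
          using C_nonneg by (auto simp: norm_mult indicator_def mult.commute)
      qed
    qed measurable
    have "cinner_L2 (LINT p|(\<mu> \<Otimes>\<^sub>M lborel). G p) H = (LINT p|(\<mu> \<Otimes>\<^sub>M lborel). cinner_L2 (G p) H)"
      by (rule integral_bounded_linear[OF bounded_linear_cinner_left Gint, symmetric])
    also have "\<dots> = (LINT p|(\<mu> \<Otimes>\<^sub>M lborel). LINT \<xi>|lborel. k p \<xi>)"
    proof (rule Bochner_Integration.integral_cong[OF refl])
      fix p
      have "cinner_L2 (radial_op f (fst p) (snd p)) H = cinner_L2 (mult_op (radial_mult (fst p) (snd p)) (fourier_L2 f)) (fourier_L2 H)"
        by (subst L2_isometry_cinner[OF L2_isometry_fourier_L2, symmetric]) (simp add: radial_op_def)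
      also have "\<dots> = (LINT \<xi>|lborel. radial_mult (fst p) (snd p) \<xi> * q \<xi>)"
        unfolding q_def by (rule cinner_mult_op[OF radial_mult])
      finally have "cinner_L2 (G p) H = indicator {0..1} (snd p) *\<^sub>R (LINT \<xi>|lborel. radial_mult (fst p) (snd p) \<xi> * q \<xi>)"
        by (simp add: G_def linear_scale[OF bounded_linear.linear[OF bounded_linear_cinner_left]])
      then show "cinner_L2 (G p) H = (LINT \<xi>|lborel. k p \<xi>)"
        by (simp add: k_def)
    qed
    also have "\<dots> = (LINT \<xi>|lborel. LINT p|(\<mu> \<Otimes>\<^sub>M lborel). k p \<xi>)"
      by (rule Q.Fubini_integral[OF kint, symmetric])
    also have "\<dots> = (LINT \<xi>|lborel. complex_of_real \<alpha> * q \<xi>)"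
    proof -
      \<comment> \<open>The identity for \<open>\<alpha>\<close> holds at every nonzero frequency,
        which is almost everywhere.\<close>
      have "AE \<xi> in lborel. (LINT p|(\<mu> \<Otimes>\<^sub>M lborel). k p \<xi>) = complex_of_real \<alpha> * q \<xi>"
        using AE_lborel_singleton[of 0]
      proof eventually_elim
        case (elim \<xi>)
        show ?case unfolding k_def by (simp only: integral_mult_left_zero \<alpha>'[OF elim])
      qed
      moreover have "(\<lambda>\<xi>. LINT p|(\<mu> \<Otimes>\<^sub>M lborel). k p \<xi>) \<in> borel_measurable lborel"
        by (rule borel_measurable_integrable[OF Q.integrable_snd[OF kint]])
      ultimately show ?thesis by (intro integral_cong_AE) auto
    qed
    also have "\<dots> = complex_of_real \<alpha> * cinner_L2 (L2_of (rep_L2 (fourier_L2 f))) (L2_of (rep_L2 (fourier_L2 H)))"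
      by (simp only: integral_mult_right_zero q_def cinner_L2_of square_integrable_rep_L2)
    also have "\<dots> = complex_of_real \<alpha> * cinner_L2 f H"
      by (simp add: L2_isometry_cinner[OF L2_isometry_fourier_L2])
    also have "\<dots> = cinner_L2 (\<alpha> *\<^sub>R f) H"
      using cinner_L2_scaleC_left[of "of_real \<alpha>" f H] by (simp add: scaleC_L2_of_real)
    finally show ?thesis ..
  qed
  then have "\<alpha> *\<^sub>R f = (LINT p|(\<mu> \<Otimes>\<^sub>M lborel). G p)"
    by (intro L2_eqI) (simp add: inner_L2_def)
  then show "\<alpha> *\<^sub>R f = (LINT A|\<mu>. (LINT \<kappa>:{0..1}|lborel. radial_op f A \<kappa>))"
    by (simp add: GI)
qed

end

text \<open>The complement of the box and the complement of the origin are open and together cover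
  the space, since the box misses the origin; the modified function is continuous on each.
  Compactness of the box gives the bound \<open>C\<close>.\<close>

lemma dyadic_multiplier_cutoff:
  fixes m :: "real^'n::finite \<Rightarrow> complex"
  assumes cont: "continuous_on (UNIV - {0}) m" and zero: "\<And>\<xi>. \<xi> \<noteq> 0 \<Longrightarrow> \<xi> \<notin> support_box 0 \<Longrightarrow> m \<xi> = 0"
  obtains C where "dyadic_multiplier (\<lambda>\<xi>. if \<xi> = 0 then 0 else m \<xi>) C"
proof -
  let ?K = "support_box 0 :: (real^'n) set"
  define m0 where "m0 \<xi> = (if \<xi> = 0 then 0 else m \<xi>)" for \<xi>
  have K0: "0 \<notin> ?K" by (simp add: support_box_def)
  have supp: "m0 \<xi> = 0" if "\<xi> \<notin> ?K" for \<xi> using zero that by (simp add: m0_def)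
  have "continuous_on (- ?K) m0"
    by (rule continuous_on_eq[of _ "\<lambda>_. 0"]) (auto simp: supp)
  moreover have "continuous_on (- {0}) m0"
    by (rule continuous_on_eq[OF continuous_on_subset[OF cont]]) (auto simp: m0_def)
  ultimately have "continuous_on (- ?K \<union> - {0}) m0"
    by (intro continuous_on_open_Un open_Compl closed_support_box) auto
  moreover have "- ?K \<union> - {0} = UNIV" using K0 by auto
  ultimately have cont0: "continuous_on UNIV m0" by simp
  have "bounded (m0 ` ?K)"
    by (intro compact_imp_bounded compact_continuous_image compact_support_box_0 continuous_on_subset[OF cont0]) auto
  then obtain C where C: "\<And>\<xi>. \<xi> \<in> ?K \<Longrightarrow> cmod (m0 \<xi>) \<le> C" by (auto simp: bounded_iff)
  have "cmod (m0 \<xi>) \<le> max C 0" for \<xi>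
    using C[of \<xi>] supp[of \<xi>] by (cases "\<xi> \<in> ?K") auto
  with cont0 supp have "dyadic_multiplier m0 (max C 0)" by unfold_locales auto
  then show ?thesis using that by (simp add: m0_def[abs_def])
qed

lemma smooth_on_imp_continuous_on: "smooth_on S f \<Longrightarrow> continuous_on S f"
  unfolding smooth_on_def partial_derivs_def
  by (rule differentiable_imp_continuous_on) (auto dest: spec[of _ "[]"])

text \<open>Conjugating by \<open>D \<rho>\<close> turns the multiplier \<open>m (2\<^sup>l \<xi>)\<close> into \<open>m (2\<^sup>l 2\<^bsup>-\<kappa>\<^esup> A \<xi>)\<close>, so the series is the
  multiplier \<open>M (2\<^bsup>-\<kappa>\<^esup> A \<xi>)\<close>. As \<open>M (2 \<xi>) = M \<xi>\<close>, replacing \<open>\<kappa>\<close> by \<open>1 - \<kappa>\<close> gives the average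
  that defines \<open>\<alpha>\<close>.\<close>

theorem corollary3p4:
  fixes \<Phi> :: "real^'n::{finite,linorder} \<Rightarrow> real"
    and m :: "real^'n::{finite,linorder} \<Rightarrow> complex"
    and \<mu> :: "(real^'n::{finite,linorder}^'n::{finite,linorder}) measure"
    and \<alpha> :: real
  assumes \<Phi>_schwartz: "schwartz \<Phi>"
    and \<Phi>_bounds: "\<And>x. indicator (cube 0 (9/100)) x \<le> \<Phi> x \<and> \<Phi> x \<le> indicator (cube 0 (1/10)) x"
    and haar: "normalized_haar_SO \<mu>"
    and m_smooth: "smooth_on (UNIV - {0}) m"
    and m_limit: "\<And>(l::int) (f::(real^'n::{finite,linorder}) L2) x r. cube_sequence x r \<Longrightarrow>
        square_integrable (\<lambda>\<xi>. m ((2 powi l) *\<^sub>R \<xi>) * rep_L2 (fourier_L2 f) \<xi>) \<and>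
        (\<lambda>N. LINT \<eta>:cube (x N) (r N)|lborel.
            (1 / measure lborel (cube (x N) (r N))) *\<^sub>R
            modulate (- \<eta>) (model_op \<Phi> \<eta> l (modulate \<eta> f)))
          \<longlonglongrightarrow> inverse_fourier_L2
            (L2_of (\<lambda>\<xi>. m ((2 powi l) *\<^sub>R \<xi>) * rep_L2 (fourier_L2 f) \<xi>))"
    and \<alpha>_pos: "\<alpha> > 0"
    and \<alpha>_eq: "\<And>\<xi>. \<xi> \<noteq> 0 \<Longrightarrow> complex_of_real \<alpha> =
        (LINT A|\<mu>. (LINT \<kappa>:{0..1}|lborel. dyadic_sum m ((2 powr \<kappa>) *\<^sub>R (A *v \<xi>))))"
  shows "\<forall>x r (f::(real^'n::{finite,linorder}) L2). cube_sequence x r \<longrightarrow>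
    (let
       integrand = (\<lambda>A \<kappa> l N \<eta>. (1 / measure lborel (cube (x N) (r N))) *\<^sub>R
         rho (matrix_inv A) (dilate (2 powr (- \<kappa>))
           (modulate (- \<eta>) (model_op \<Phi> \<eta> l (modulate \<eta>
             (dilate (2 powr \<kappa>) (rho A f)))))));
       average = (\<lambda>A \<kappa> l N. LINT \<eta>:cube (x N) (r N)|lborel. integrand A \<kappa> l N \<eta>);
       limit = (\<lambda>A \<kappa> (l::int). lim (\<lambda>N. average A \<kappa> l N));
       series = (\<lambda>A \<kappa>. \<Sum>\<^sub>\<infinity>l\<in>UNIV. limit A \<kappa> l)
     in
       (\<forall>A\<in>SO. \<forall>\<kappa>\<in>{0..1}. \<forall>l N. set_integrable lborel (cube (x N) (r N)) (integrand A \<kappa> l N)) \<and>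
       (\<forall>A\<in>SO. \<forall>\<kappa>\<in>{0..1}. \<forall>l. convergent (\<lambda>N. average A \<kappa> l N)) \<and>
       (\<forall>A\<in>SO. \<forall>\<kappa>\<in>{0..1}. (\<lambda>l. limit A \<kappa> l) summable_on UNIV) \<and>
       (\<forall>A\<in>SO. set_integrable lborel {0..1} (\<lambda>\<kappa>. series A \<kappa>)) \<and>
       integrable \<mu> (\<lambda>A. LINT \<kappa>:{0..1}|lborel. series A \<kappa>) \<and>
       \<alpha> *\<^sub>R f = (LINT A|\<mu>. (LINT \<kappa>:{0..1}|lborel. series A \<kappa>)))"
proof (intro allI impI)
  fix x :: "nat \<Rightarrow> real^'n::{finite,linorder}" and r :: "nat \<Rightarrow> real" and f :: "(real^'n::{finite,linorder}) L2"
  assume xr: "cube_sequence x r"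
  define Q where "Q N = cube (x N) (r N)" for N
  define c where "c N = 1 / measure lborel (Q N)" for N
  have cont: "continuous_on (UNIV - {0}) m" by (rule smooth_on_imp_continuous_on[OF m_smooth])
  have bump: "bump \<Phi>"
  proof -
    have "continuous_on UNIV \<Phi>" using \<Phi>_schwartz by (auto simp: schwartz_def intro: smooth_on_imp_continuous_on)
    then have "\<Phi> \<in> borel_measurable borel" by (rule borel_measurable_continuous_onI)
    moreover have "0 \<le> \<Phi> x" for x
      using \<Phi>_bounds[of x] by (metis indicator_pos_le order_trans)
    ultimately show ?thesis using \<Phi>_bounds by (simp add: bump_def)
  qed
  have zero: "m \<xi> = 0" if "\<xi> \<noteq> 0" "\<xi> \<notin> support_box 0" for \<xi>
    by (rule multiplier_support[OF bump cont m_limit that])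
  define m0 where "m0 \<xi> = (if \<xi> = 0 then 0 else m \<xi>)" for \<xi>
  obtain C where "dyadic_multiplier m0 C"
    using dyadic_multiplier_cutoff[OF cont zero] unfolding m0_def by blast
  then interpret dyadic_multiplier m0 C .
  have sum_eq: "dyadic_sum m \<xi> = dyadic_sum m0 \<xi>" if "\<xi> \<noteq> 0" for \<xi>
    using that by (simp add: dyadic_sum_def m0_def)
  define T where "T A \<kappa> h = rho (matrix_inv A) (dilate (2 powr (- \<kappa>)) h)" for A :: "real^'n::{finite,linorder}^'n::{finite,linorder}" and \<kappa> :: real and h
  define g where "g A \<kappa> = dilate (2 powr \<kappa>) (rho A f)" for A and \<kappa> :: real
  define B where "B l h \<eta> = modulate (- \<eta>) (model_op \<Phi> \<eta> l (modulate \<eta> h))" for l h \<eta>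
  define avg where "avg A \<kappa> l N = (LINT \<eta>:Q N|lborel. c N *\<^sub>R T A \<kappa> (B l (g A \<kappa>) \<eta>))" for A \<kappa> l N
  have orth: "orthogonal_matrix A" if "A \<in> SO" for A :: "real^'n::{finite,linorder}^'n::{finite,linorder}"
    using that by (simp add: SO_def)
  have T: "L2_isometry (T A \<kappa>)" if "A \<in> SO" for A \<kappa>
    unfolding T_def
    by (intro L2_isometry_comp[OF L2_isometry_rho L2_isometry_dilate] matrix_inv_orthogonal orth that) simp
  have int: "integrable lborel (\<lambda>\<eta>. indicator (Q N) \<eta> *\<^sub>R (c N *\<^sub>R B l h \<eta>))" for l h N
    using integrable_scaleR_right[OF set_integrable_conjugated_model_op[OF bump, of "x N" "r N" l h, unfolded set_integrable_def], of "c N"]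
    by (simp add: Q_def B_def mult.commute)
  have T_int: "T A \<kappa> (indicator (Q N) \<eta> *\<^sub>R (c N *\<^sub>R h)) = indicator (Q N) \<eta> *\<^sub>R (c N *\<^sub>R T A \<kappa> h)" if "A \<in> SO" for A \<kappa> N \<eta> h
    by (simp only: L2_linearD(3)[OF L2_isometryD(1)[OF T[OF that]]])
  have integrand: "set_integrable lborel (Q N) (\<lambda>\<eta>. c N *\<^sub>R T A \<kappa> (B l (g A \<kappa>) \<eta>))" if "A \<in> SO" for A \<kappa> l N
    using integrable_bounded_linear[OF L2_isometryD(3)[OF T[OF that, of \<kappa>]] int[of N l "g A \<kappa>"]]
    by (simp only: T_int[OF that] set_integrable_def)
  \<comment> \<open>\<open>T A \<kappa>\<close> does not involve \<open>\<eta>\<close> and is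
    bounded and linear, so it can be taken out of the Bochner integral.\<close>
  have average: "avg A \<kappa> l N = T A \<kappa> (LINT \<eta>:Q N|lborel. c N *\<^sub>R B l (g A \<kappa>) \<eta>)" if "A \<in> SO" for A \<kappa> l N
    unfolding avg_def set_lebesgue_integral_def
    using integral_bounded_linear[OF L2_isometryD(3)[OF T[OF that, of \<kappa>]] int[of N l "g A \<kappa>"]]
    by (simp only: T_int[OF that])
  define lim_op where "lim_op A \<kappa> l = inverse_fourier_L2 (mult_op (\<lambda>\<xi>. m0 ((2 powi l) *\<^sub>R ((2 powr (- \<kappa>)) *\<^sub>R (A *v \<xi>)))) (fourier_L2 f))"
    for A :: "real^'n::{finite,linorder}^'n::{finite,linorder}" and \<kappa> :: real and l :: int
  have lim: "(\<lambda>N. avg A \<kappa> l N) \<longlonglongrightarrow> lim_op A \<kappa> l" if A: "A \<in> SO" for A \<kappa> l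
  proof -
    note o = orth[OF A]
    define s where "s = 2 powr (- \<kappa>)"
    have s: "s > 0" "inverse s > 0" by (simp_all add: s_def)
    have si: "2 powr \<kappa> = inverse s" by (simp add: s_def powr_minus)
    define h where "h \<xi> = m0 ((2 powi l) *\<^sub>R \<xi>)" for \<xi>
    have h: "h \<in> borel_measurable borel"
      unfolding h_def by (intro borel_measurable_continuous_onI continuous_on_compose2[OF local.cont] continuous_intros) auto
    have Fg: "fourier_L2 (g A \<kappa>) = dilate s (rho A (fourier_L2 f))"
      by (simp add: g_def si fourier_L2_dilate s fourier_L2_rho o)
    \<comment> \<open>\<open>m\<close> and \<open>m0\<close> can differ at the origin alone, a null
      set, so they give the same L^2 class.\<close>
    have eq: "L2_of (\<lambda>\<xi>. m ((2 powi l) *\<^sub>R \<xi>) * rep_L2 (fourier_L2 (g A \<kappa>)) \<xi>) = mult_op h (fourier_L2 (g A \<kappa>))"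
      unfolding mult_op_def
    proof (rule L2_of_cong_AE)
      show "square_integrable (\<lambda>\<xi>. m ((2 powi l) *\<^sub>R \<xi>) * rep_L2 (fourier_L2 (g A \<kappa>)) \<xi>)"
        using m_limit[OF xr] by blast
      show "square_integrable (\<lambda>\<xi>. h \<xi> * rep_L2 (fourier_L2 (g A \<kappa>)) \<xi>)"
        by (rule square_integrable_mult_fun[OF h, of C]) (auto simp: h_def bound square_integrable_rep_L2)
      show "AE \<xi> in lborel. m ((2 powi l) *\<^sub>R \<xi>) * rep_L2 (fourier_L2 (g A \<kappa>)) \<xi> = h \<xi> * rep_L2 (fourier_L2 (g A \<kappa>)) \<xi>"
        using AE_lborel_singleton[of 0] by eventually_elim (simp add: h_def m0_def)
    qed
    have "(\<lambda>N. LINT \<eta>:Q N|lborel. c N *\<^sub>R B l (g A \<kappa>) \<eta>) \<longlonglongrightarrow> inverse_fourier_L2 (mult_op h (fourier_L2 (g A \<kappa>)))"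
      using m_limit[OF xr, of l "g A \<kappa>"] unfolding eq by (simp add: Q_def c_def B_def)
    from bounded_linear.tendsto[OF L2_isometryD(3)[OF T[OF A, of \<kappa>]] this]
    have "(\<lambda>N. avg A \<kappa> l N) \<longlonglongrightarrow> T A \<kappa> (inverse_fourier_L2 (mult_op h (fourier_L2 (g A \<kappa>))))"
      by (simp only: average[OF A])
    also have "T A \<kappa> (inverse_fourier_L2 (mult_op h (fourier_L2 (g A \<kappa>)))) = lim_op A \<kappa> l"
    proof -
      \<comment> \<open>The transform inverts dilations and commutes with rotations, so the operator
        becomes a conjugated multiplication with \<open>s = 2 powr (- \<kappa>)\<close>.\<close>
      have "fourier_L2 (T A \<kappa> (inverse_fourier_L2 (mult_op h (fourier_L2 (g A \<kappa>)))))
          = rho (matrix_inv A) (dilate (inverse s) (mult_op h (dilate s (rho A (fourier_L2 f)))))"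
        unfolding T_def s_def[symmetric] fourier_L2_rho[OF matrix_inv_orthogonal(2)[OF o]] fourier_L2_dilate[OF s(1)]
          fourier_L2_inverse Fg ..
      also have "\<dots> = mult_op (\<lambda>\<xi>. h (s *\<^sub>R (A *v \<xi>))) (fourier_L2 f)"
        by (rule mult_op_conjugate[OF o h _ s(1), of C]) (simp add: h_def bound)
      finally have "inverse_fourier_L2 (fourier_L2 (T A \<kappa> (inverse_fourier_L2 (mult_op h (fourier_L2 (g A \<kappa>))))))
          = inverse_fourier_L2 (mult_op (\<lambda>\<xi>. h (s *\<^sub>R (A *v \<xi>))) (fourier_L2 f))" by simp
      then show ?thesis by (simp add: lim_op_def h_def s_def)
    qed
    finally show ?thesis .
  qed
  have series: "(lim_op A \<kappa> has_sum radial_op f A \<kappa>) UNIV" for A \<kappa>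
    using has_sum_bounded_linear[OF L2_isometryD(3)[OF L2_isometry_inverse_fourier_L2]
        has_sum_mult_op[OF borel_measurable_scaled_matrix[of "2 powr (- \<kappa>)" A], of "fourier_L2 f"]]
    by (simp add: lim_op_def[abs_def] radial_op_def radial_mult_def[abs_def] o_def)
  have lim_eq: "lim (\<lambda>N. avg A \<kappa> l N) = lim_op A \<kappa> l" if "A \<in> SO" for A \<kappa> l
    by (rule limI[OF lim[OF that]])
  have series_eq: "(\<Sum>\<^sub>\<infinity>l\<in>UNIV. lim (\<lambda>N. avg A \<kappa> l N)) = radial_op f A \<kappa>" if "A \<in> SO" for A \<kappa>
    unfolding lim_eq[OF that] by (rule infsumI[OF series])
  have space: "space \<mu> = SO" and sets: "sets \<mu> = sets (restrict_space borel SO)" and prob: "emeasure \<mu> (space \<mu>) = 1"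
    using haar by (auto simp: normalized_haar_SO_def)
  have \<alpha>0: "complex_of_real \<alpha> =
        (LINT A|\<mu>. (LINT \<kappa>:{0..1}|lborel. dyadic_sum m0 ((2 powr \<kappa>) *\<^sub>R (A *v \<xi>))))" if "\<xi> \<noteq> 0" for \<xi>
  proof -
    \<comment> \<open>The dyadic sums of \<open>m\<close> and \<open>m0\<close> agree off the
      origin, and a rotation followed by a dilation keeps nonzero frequencies there.\<close>
    have nz: "(2 powr \<kappa>) *\<^sub>R (A *v \<xi>) \<noteq> 0" if "A \<in> SO" for A \<kappa>
      using orthogonal_matrix_inv_mult(1)[OF orth[OF that], of \<xi>] \<open>\<xi> \<noteq> 0\<close> by auto
    show ?thesis
      unfolding \<alpha>_eq[OF that]
      by (intro Bochner_Integration.integral_cong refl) (simp add: space sum_eq[OF nz])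
  qed
  note main = radial_op_average[OF space sets prob \<alpha>0]
  have A_int: "(LINT \<kappa>:{0..1}|lborel. (\<Sum>\<^sub>\<infinity>l\<in>UNIV. lim (\<lambda>N. avg A \<kappa> l N))) = (LINT \<kappa>:{0..1}|lborel. radial_op f A \<kappa>)"
    if "A \<in> space \<mu>" for A
    using that by (simp add: series_eq space)
  have result: "(\<forall>A\<in>SO. \<forall>\<kappa>\<in>{0..1}. \<forall>l N. set_integrable lborel (Q N) (\<lambda>\<eta>. c N *\<^sub>R T A \<kappa> (B l (g A \<kappa>) \<eta>))) \<and>
       (\<forall>A\<in>SO. \<forall>\<kappa>\<in>{0..1}. \<forall>l. convergent (\<lambda>N. avg A \<kappa> l N)) \<and>
       (\<forall>A\<in>SO. \<forall>\<kappa>\<in>{0..1}. (\<lambda>l. lim (\<lambda>N. avg A \<kappa> l N)) summable_on UNIV) \<and>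
       (\<forall>A\<in>SO. set_integrable lborel {0..1} (\<lambda>\<kappa>. \<Sum>\<^sub>\<infinity>l\<in>UNIV. lim (\<lambda>N. avg A \<kappa> l N))) \<and>
       integrable \<mu> (\<lambda>A. LINT \<kappa>:{0..1}|lborel. (\<Sum>\<^sub>\<infinity>l\<in>UNIV. lim (\<lambda>N. avg A \<kappa> l N))) \<and>
       \<alpha> *\<^sub>R f = (LINT A|\<mu>. (LINT \<kappa>:{0..1}|lborel. (\<Sum>\<^sub>\<infinity>l\<in>UNIV. lim (\<lambda>N. avg A \<kappa> l N))))"
  proof (intro conjI ballI allI)
    show "(\<lambda>l. lim (\<lambda>N. avg A \<kappa> l N)) summable_on UNIV" if "A \<in> SO" for A \<kappa>
      unfolding lim_eq[OF that] using series[of A \<kappa>] by (auto simp: summable_on_def)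
    show "set_integrable lborel {0..1} (\<lambda>\<kappa>. \<Sum>\<^sub>\<infinity>l\<in>UNIV. lim (\<lambda>N. avg A \<kappa> l N))" if "A \<in> SO" for A
      unfolding series_eq[OF that] by (rule main(1)[OF _ that])
    show "integrable \<mu> (\<lambda>A. LINT \<kappa>:{0..1}|lborel. (\<Sum>\<^sub>\<infinity>l\<in>UNIV. lim (\<lambda>N. avg A \<kappa> l N)))"
      by (subst Bochner_Integration.integrable_cong[OF refl A_int]) (assumption, rule main(2))
    show "\<alpha> *\<^sub>R f = (LINT A|\<mu>. (LINT \<kappa>:{0..1}|lborel. (\<Sum>\<^sub>\<infinity>l\<in>UNIV. lim (\<lambda>N. avg A \<kappa> l N))))"
      by (subst Bochner_Integration.integral_cong[OF refl A_int]) (assumption, rule main(3))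
    show "convergent (\<lambda>N. avg A \<kappa> l N)" if "A \<in> SO" for A \<kappa> l
      by (rule convergentI[OF lim[OF that]])
  qed (rule integrand)
  then show "let
       integrand = (\<lambda>A \<kappa> l N \<eta>. (1 / measure lborel (cube (x N) (r N))) *\<^sub>R
         rho (matrix_inv A) (dilate (2 powr (- \<kappa>))
           (modulate (- \<eta>) (model_op \<Phi> \<eta> l (modulate \<eta>
             (dilate (2 powr \<kappa>) (rho A f)))))));
       average = (\<lambda>A \<kappa> l N. LINT \<eta>:cube (x N) (r N)|lborel. integrand A \<kappa> l N \<eta>);
       limit = (\<lambda>A \<kappa> (l::int). lim (\<lambda>N. average A \<kappa> l N));
       series = (\<lambda>A \<kappa>. \<Sum>\<^sub>\<infinity>l\<in>UNIV. limit A \<kappa> l)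
     in
       (\<forall>A\<in>SO. \<forall>\<kappa>\<in>{0..1}. \<forall>l N. set_integrable lborel (cube (x N) (r N)) (integrand A \<kappa> l N)) \<and>
       (\<forall>A\<in>SO. \<forall>\<kappa>\<in>{0..1}. \<forall>l. convergent (\<lambda>N. average A \<kappa> l N)) \<and>
       (\<forall>A\<in>SO. \<forall>\<kappa>\<in>{0..1}. (\<lambda>l. limit A \<kappa> l) summable_on UNIV) \<and>
       (\<forall>A\<in>SO. set_integrable lborel {0..1} (\<lambda>\<kappa>. series A \<kappa>)) \<and>
       integrable \<mu> (\<lambda>A. LINT \<kappa>:{0..1}|lborel. series A \<kappa>) \<and>
       \<alpha> *\<^sub>R f = (LINT A|\<mu>. (LINT \<kappa>:{0..1}|lborel. series A \<kappa>))"
    unfolding Let_def avg_def T_def B_def g_def c_def Q_def .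
qed

end
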